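(* Let $\Omega\subset\mathbb R^N$ be a bounded Lipschitz domain, $s\in(0,1)$, and let $A_s=I+(-\Delta)^s$ be the positive self-adjoint operator on $L^2(\Omega)$ associated with the form $a_s$. The operator $$A_s^{1/2}:D(A_s^{1/2})=H_0^s(\Omega)\longrightarrow L^2(\Omega)$$ is an isometric isomorphism of the Hilbert space $(H_0^s(\Omega),\|\cdot\|_{H_0^s(\Omega)})$ onto $L^2(\Omega)$, with bounded inverse $$A_s^{-1/2}:L^2(\Omega)\longrightarrow H_0^s(\Omega).$$ Consequently, the transformation $z=A_s^{1/2}u$ identifies $H_0^s(\Omega)$ isometrically with $L^2(\Omega)$.
   Context: All spaces are real. $H_0^s(\Omega)$ is the space of functions $u\in H^s(\mathbb R^N)$ with $u=0$ a.e. in $\mathbb R^N\setminus\Omega$ (also regarded as functions on $\Omega$). On $H_0^s(\Omega)$ consider the closed, symmetric, coercive bilinear form $$a_s(u,v)=\int_\Omega uv\,dx+\frac{C_{N,s}}{2}\iint_{\mathbb R^{2N}}\frac{(u(x)-u(y))(v(x)-v(y))}{|x-y|^{N+2s}}\,dx\,dy,$$ where $C_{N,s}>0$ is the standard normalization constant of the integral fractional Laplacian, $C_{N,s}=\frac{4^s s\,\Gamma(N/2+s)}{\pi^{N/2}\Gamma(1-s)}$. $H_0^s(\Omega)$ is a Hilbert space with norm $\|u\|_{H_0^s(\Omega)}^2=a_s(u,u)$. $A_s=I+(-\Delta)^s$ is the unique positive self-adjoint operator on $L^2(\Omega)$ associated with the closed form $a_s$ by the first representation theorem (its extension to $H_0^s(\Omega)\to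 H^{-s}(\Omega)$ satisfies $\langle A_su,v\rangle_{H^{-s},H_0^s}=a_s(u,v)$ for $u,v\in H_0^s(\Omega)$). Powers $A_s^\theta$, $\theta\in\mathbb R$, are defined by the spectral theorem. *)

theory Defs
  imports "HOL-Analysis.Analysis"
begin

section \<open>The real Hilbert space of square-integrable functions on a Euclidean space\<close>

definition square_integrable :: "('a::euclidean_space \<Rightarrow> real) \<Rightarrow> bool" where
  "square_integrable f \<longleftrightarrow> f \<in> borel_measurable lborel \<and> integrable lborel (\<lambda>x. (f x)\<^sup>2)"

definition L2rel :: "('a::euclidean_space \<Rightarrow> real) \<Rightarrow> ('a \<Rightarrow> real) \<Rightarrow> bool" where
  "L2rel f g \<longleftrightarrow> square_integrable f \<and> square_integrable g \<and> (AE x in lborel. f x = g x)"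

lemma square_integrable_zero: "square_integrable (\<lambda>x. 0)"
  by (simp add: square_integrable_def)

lemma square_integrable_scale:
  assumes "square_integrable f" shows "square_integrable (\<lambda>x. c * f x)"
  using assms by (auto simp: square_integrable_def power_mult_distrib)

lemma square_integrable_mult:
  assumes "square_integrable f" "square_integrable g"
  shows "integrable lborel (\<lambda>x. f x * g x)"
proof (rule Bochner_Integration.integrable_bound)
  show "integrable lborel (\<lambda>x. (f x)\<^sup>2 + (g x)\<^sup>2)"
    using assms by (auto simp: square_integrable_def)
  show "(\<lambda>x. f x * g x) \<in> borel_measurable lborel"
    using assms by (auto simp: square_integrable_def)
  have "\<bar>a * b\<bar> \<le> a\<^sup>2 + b\<^sup>2" for a b :: real
  proof -
    have "0 \<le> (\<bar>a\<bar> - \<bar>b\<bar>)\<^sup>2" by simp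
    then have "2 * (\<bar>a\<bar> * \<bar>b\<bar>) \<le> a\<^sup>2 + b\<^sup>2" by (simp add: power2_diff)
    moreover have "0 \<le> \<bar>a\<bar> * \<bar>b\<bar>" by simp
    ultimately show ?thesis unfolding abs_mult by linarith
  qed
  then show "AE x in lborel. norm (f x * g x) \<le> norm ((f x)\<^sup>2 + (g x)\<^sup>2)"
    by simp
qed

lemma square_integrable_add:
  assumes "square_integrable f" "square_integrable g"
  shows "square_integrable (\<lambda>x. f x + g x)"
proof -
  have "integrable lborel (\<lambda>x. (f x)\<^sup>2 + (g x)\<^sup>2 + 2 * (f x * g x))"
    using assms square_integrable_mult[OF assms] by (auto simp: square_integrable_def)
  moreover have "(\<lambda>x. (f x)\<^sup>2 + (g x)\<^sup>2 + 2 * (f x * g x)) = (\<lambda>x. (f x + g x)\<^sup>2)"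
    by (auto simp: power2_sum)
  ultimately show ?thesis
    using assms by (auto simp: square_integrable_def)
qed

lemma square_integrable_diff:
  assumes "square_integrable f" "square_integrable g"
  shows "square_integrable (\<lambda>x. f x - g x)"
  using square_integrable_add[OF assms(1) square_integrable_scale[OF assms(2), of "-1"]] by simp

lemma L2rel_part_equivp: "part_equivp (L2rel :: ('a::euclidean_space \<Rightarrow> real) \<Rightarrow> _)"
proof (rule part_equivpI)
  show "\<exists>f :: 'a \<Rightarrow> real. L2rel f f"
    by (rule exI[of _ "\<lambda>x. 0"]) (simp add: L2rel_def square_integrable_zero)
  show "symp (L2rel :: ('a \<Rightarrow> real) \<Rightarrow> _)"
    by (auto simp: symp_def L2rel_def)
  show "transp (L2rel :: ('a \<Rightarrow> real) \<Rightarrow> _)"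
    by (auto simp: transp_def L2rel_def elim: AE_mp)
qed

quotient_type (overloaded) 'a L2 = "'a::euclidean_space \<Rightarrow> real" / partial: L2rel
  by (rule L2rel_part_equivp)

instantiation L2 :: (euclidean_space) real_vector
begin

lift_definition zero_L2 :: "'a L2" is "\<lambda>x. 0"
  by (simp add: L2rel_def square_integrable_zero)

lift_definition plus_L2 :: "'a L2 \<Rightarrow> 'a L2 \<Rightarrow> 'a L2" is "\<lambda>f g x. f x + g x"
  by (auto simp: L2rel_def square_integrable_add)

lift_definition minus_L2 :: "'a L2 \<Rightarrow> 'a L2 \<Rightarrow> 'a L2" is "\<lambda>f g x. f x - g x"
  by (auto simp: L2rel_def square_integrable_diff)

lift_definition uminus_L2 :: "'a L2 \<Rightarrow> 'a L2" is "\<lambda>f x. - f x"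
  using square_integrable_scale[of _ "-1"] by (auto simp: L2rel_def)

lift_definition scaleR_L2 :: "real \<Rightarrow> 'a L2 \<Rightarrow> 'a L2" is "\<lambda>c f x. c * f x"
  by (auto simp: L2rel_def square_integrable_scale)

instance
proof
  fix a b c :: "'a L2" and r q :: real
  show "a + b + c = a + (b + c)"
    by transfer (auto simp: L2rel_def add.assoc intro!: square_integrable_add)
  show "a + b = b + a"
    by transfer (auto simp: L2rel_def add.commute intro!: square_integrable_add)
  show "0 + a = a"
    by transfer (auto simp: L2rel_def)
  show "- a + a = 0"
    by transfer (auto simp: L2rel_def square_integrable_zero)
  show "a - b = a + - b"
    by transfer (auto simp: L2rel_def square_integrable_diff)
  show "r *\<^sub>R (a + b) = r *\<^sub>R a + r *\<^sub>R b"
    by transfer (auto simp: L2rel_def distrib_left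
        intro!: square_integrable_add square_integrable_scale)
  show "(r + q) *\<^sub>R a = r *\<^sub>R a + q *\<^sub>R a"
    by transfer (auto simp: L2rel_def distrib_right
        intro!: square_integrable_add square_integrable_scale)
  show "r *\<^sub>R q *\<^sub>R a = (r * q) *\<^sub>R a"
    by transfer (auto simp: L2rel_def mult.assoc intro!: square_integrable_scale)
  show "1 *\<^sub>R a = a"
    by transfer (auto simp: L2rel_def)
qed

end

instantiation L2 :: (euclidean_space) real_inner
begin

lift_definition inner_L2 :: "'a L2 \<Rightarrow> 'a L2 \<Rightarrow> real" is "\<lambda>f g. LINT x|lborel. f x * g x"
  by (rule integral_cong_AE) (auto simp: L2rel_def square_integrable_def)

definition norm_L2 :: "'a L2 \<Rightarrow> real" where
  "norm_L2 u = sqrt (u \<bullet> u)"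

definition sgn_L2 :: "'a L2 \<Rightarrow> 'a L2" where
  "sgn_L2 u = u /\<^sub>R norm u"

definition dist_L2 :: "'a L2 \<Rightarrow> 'a L2 \<Rightarrow> real" where
  "dist_L2 u v = norm (u - v)"

definition uniformity_L2 :: "('a L2 \<times> 'a L2) filter" where
  "uniformity_L2 = (INF e\<in>{0<..}. principal {(x, y). dist x y < e})"

definition open_L2 :: "'a L2 set \<Rightarrow> bool" where
  "open_L2 U \<longleftrightarrow> (\<forall>x\<in>U. eventually (\<lambda>(x', y). x' = x \<longrightarrow> y \<in> U) uniformity)"

instance
proof
  fix a b c :: "'a L2" and r :: real and U :: "'a L2 set"
  show "dist a b = norm (a - b)" by (rule dist_L2_def)
  show "sgn a = a /\<^sub>R norm a" by (rule sgn_L2_def)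
  show "uniformity = (INF e\<in>{0<..}. principal {(x :: 'a L2, y). dist x y < e})"
    by (rule uniformity_L2_def)
  show "open U = (\<forall>x\<in>U. \<forall>\<^sub>F (x', y) in uniformity. x' = x \<longrightarrow> y \<in> U)"
    by (rule open_L2_def)
  show "a \<bullet> b = b \<bullet> a"
    by transfer (simp add: mult.commute)
  show "(a + b) \<bullet> c = a \<bullet> c + b \<bullet> c"
    by transfer (simp add: L2rel_def distrib_right square_integrable_mult)
  show "(r *\<^sub>R a) \<bullet> b = r * (a \<bullet> b)"
    by transfer (simp add: mult.assoc)
  show "0 \<le> a \<bullet> a"
    by transfer simp
  show "(a \<bullet> a = 0) = (a = 0)"
  proof transfer
    fix f :: "'a \<Rightarrow> real" assume "L2rel f f"
    then have f: "square_integrable f" by (simp add: L2rel_def)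
    have "((LINT x|lborel. f x * f x) = 0) = (AE x in lborel. f x * f x = 0)"
      by (rule integral_nonneg_eq_0_iff_AE) (auto simp: square_integrable_mult f)
    then show "((LINT x|lborel. f x * f x) = 0) = L2rel f (\<lambda>x. 0)"
      using f by (simp add: L2rel_def square_integrable_zero)
  qed
  show "norm a = sqrt (a \<bullet> a)" by (rule norm_L2_def)
qed

end

text \<open>
  \<open>rep_L2 u\<close> is some Borel function in the class \<open>u\<close>; the definitions below do not depend on which.
  \<open>L2(\<Omega>)\<close> is the closed subspace of \<open>L2(R^N)\<close> of classes vanishing a.e. outside \<open>\<Omega>\<close>
  (extension by zero), so that \<open>H0s \<Omega> s\<close> is literally a subset of it.
\<close>

definition L2_on :: "'a::euclidean_space set \<Rightarrow> 'a L2 set" where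
  "L2_on \<Omega> = {u. AE x in lborel. x \<notin> \<Omega> \<longrightarrow> rep_L2 u x = 0}"


section \<open>Lipschitz domains\<close>

text \<open>
  Near every boundary point, \<open>\<Omega>\<close> is the strict epigraph of a Lipschitz function over the
  hyperplane orthogonal to a unit vector \<open>e\<close>, in the direction \<open>e\<close>.
\<close>

definition lipschitz_domain :: "'a::euclidean_space set \<Rightarrow> bool" where
  "lipschitz_domain \<Omega> \<longleftrightarrow> open \<Omega> \<and> connected \<Omega> \<and> \<Omega> \<noteq> {} \<and>
     (\<forall>p \<in> frontier \<Omega>. \<exists>r>0. \<exists>e L \<phi>. norm e = 1 \<and> L-lipschitz_on {y. y \<bullet> e = 0} \<phi> \<and>
        \<Omega> \<inter> ball p r = {x \<in> ball p r. \<phi> (x - (x \<bullet> e) *\<^sub>R e) < x \<bullet> e})"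


section \<open>Fractional Sobolev spaces and the form \<open>a\<^sub>s\<close>\<close>

text \<open>The dimension \<open>N\<close> is \<open>DIM('a)\<close>; \<open>lborel\<close> on \<open>'a \<times> 'a\<close> is Lebesgue measure on \<open>R^(2N)\<close>.\<close>

definition Hs :: "real \<Rightarrow> 'a::euclidean_space L2 set" where
  "Hs s = {u. integrable lborel (\<lambda>(x :: 'a, y :: 'a).
       (rep_L2 u x - rep_L2 u y)\<^sup>2 / norm (x - y) powr (real DIM('a) + 2 * s))}"

definition H0s :: "'a::euclidean_space set \<Rightarrow> real \<Rightarrow> 'a L2 set" where
  "H0s \<Omega> s = {u \<in> Hs s. AE x in lborel. x \<notin> \<Omega> \<longrightarrow> rep_L2 u x = 0}"

definition frac_const :: "real \<Rightarrow> real \<Rightarrow> real" where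
  "frac_const N s = 4 powr s * s * Gamma (N / 2 + s) / (pi powr (N / 2) * Gamma (1 - s))"

definition frac_form :: "'a::euclidean_space set \<Rightarrow> real \<Rightarrow> 'a L2 \<Rightarrow> 'a L2 \<Rightarrow> real" where
  "frac_form \<Omega> s u v =
     (LINT x:\<Omega>|lborel. rep_L2 u x * rep_L2 v x) +
     frac_const (real DIM('a)) s / 2 *
       (LINT (x, y)|(lborel :: ('a \<times> 'a) measure).
          (rep_L2 u x - rep_L2 u y) * (rep_L2 v x - rep_L2 v y) / norm (x - y) powr (real DIM('a) + 2 * s))"

definition H0s_norm :: "'a::euclidean_space set \<Rightarrow> real \<Rightarrow> 'a L2 \<Rightarrow> real" where
  "H0s_norm \<Omega> s u = sqrt (frac_form \<Omega> s u u)"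


section \<open>Unbounded operators, represented by their graphs\<close>

definition op_app :: "('h \<times> 'h) set \<Rightarrow> 'h \<Rightarrow> 'h" where
  "op_app T u = (THE w. (u, w) \<in> T)"

text \<open>
  The operator associated with a form \<open>a\<close> with domain \<open>V\<close> in the Hilbert space \<open>H\<close>, as given by the
  first representation theorem.
\<close>

definition form_operator ::
  "'h::real_inner set \<Rightarrow> 'h set \<Rightarrow> ('h \<Rightarrow> 'h \<Rightarrow> real) \<Rightarrow> ('h \<times> 'h) set" where
  "form_operator H V a = {(u, f). u \<in> V \<and> f \<in> H \<and> (\<forall>v\<in>V. a u v = f \<bullet> v)}"

definition frac_operator :: "'a::euclidean_space set \<Rightarrow> real \<Rightarrow> ('a L2 \<times> 'a L2) set" where
  "frac_operator \<Omega> s = form_operator (L2_on \<Omega>) (H0s \<Omega> s) (frac_form \<Omega> s)"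


section \<open>Powers of a self-adjoint operator via its spectral measure\<close>

text \<open>Projection-valued measures on the Borel sets of the real line, acting on the Hilbert space \<open>H\<close>.\<close>

definition spectral_measure :: "'h::real_inner set \<Rightarrow> (real set \<Rightarrow> 'h \<Rightarrow> 'h) \<Rightarrow> bool" where
  "spectral_measure H E \<longleftrightarrow>
     (\<forall>B\<in>sets borel.
        (\<forall>u\<in>H. E B u \<in> H \<and> E B (E B u) = E B u) \<and>
        (\<forall>u\<in>H. \<forall>v\<in>H. E B (u + v) = E B u + E B v \<and> E B u \<bullet> v = u \<bullet> E B v) \<and>
        (\<forall>u\<in>H. \<forall>c. E B (c *\<^sub>R u) = c *\<^sub>R E B u)) \<and>
     (\<forall>u\<in>H. E UNIV u = u) \<and>
     (\<forall>B. range B \<subseteq> sets borel \<longrightarrow> disjoint_family B \<longrightarrow>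
        (\<forall>u\<in>H. (\<lambda>n. E (B n) u) sums E (\<Union>n::nat. B n) u))"

definition scalar_measure :: "(real set \<Rightarrow> 'h::real_inner \<Rightarrow> 'h) \<Rightarrow> 'h \<Rightarrow> real measure" where
  "scalar_measure E u = measure_of UNIV (sets borel) (\<lambda>B. ennreal (E B u \<bullet> u))"

text \<open>
  The graph of \<open>\<integral> f dE\<close>: its domain is the set of \<open>u\<close> with \<open>f \<in> L2(\<mu>\<^sub>u)\<close>, \<open>\<mu>\<^sub>u = scalar_measure E u\<close>,
  and its value at \<open>u\<close> is the limit of \<open>(\<integral> g\<^sub>n dE) u\<close> for simple functions \<open>g\<^sub>n\<close> converging to \<open>f\<close>
  in \<open>L2(\<mu>\<^sub>u)\<close>.
\<close>

definition spectral_integral ::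
  "'h::real_inner set \<Rightarrow> (real set \<Rightarrow> 'h \<Rightarrow> 'h) \<Rightarrow> (real \<Rightarrow> real) \<Rightarrow> ('h \<times> 'h) set" where
  "spectral_integral H E f = {(u, w). u \<in> H \<and> w \<in> H \<and>
     integrable (scalar_measure E u) (\<lambda>t. (f t)\<^sup>2) \<and>
     (\<exists>g. (\<forall>n::nat. simple_function borel (g n)) \<and>
        (\<lambda>n. LINT t|scalar_measure E u. (g n t - f t)\<^sup>2) \<longlonglongrightarrow> 0 \<and>
        (\<lambda>n. \<Sum>c\<in>range (g n). c *\<^sub>R E (g n -` {c}) u) \<longlonglongrightarrow> w)}"

text \<open>
  By the spectral theorem a self-adjoint operator \<open>A\<close> on \<open>H\<close> has exactly one spectral measure with
  \<open>A = \<integral> t dE(t)\<close>, up to the irrelevant values of \<open>E\<close> on non-Borel sets and outside \<open>H\<close>; hence the choice.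
  If \<open>A\<close> is positive, \<open>E\<close> vanishes on \<open>{..0}\<close>, so only the values \<open>t powr \<theta>\<close> for \<open>t > 0\<close> matter.
\<close>

definition spectral_resolution ::
  "'h::real_inner set \<Rightarrow> ('h \<times> 'h) set \<Rightarrow> (real set \<Rightarrow> 'h \<Rightarrow> 'h)" where
  "spectral_resolution H A = (SOME E. spectral_measure H E \<and> spectral_integral H E (\<lambda>t. t) = A)"

definition op_power :: "'h::real_inner set \<Rightarrow> ('h \<times> 'h) set \<Rightarrow> real \<Rightarrow> ('h \<times> 'h) set" where
  "op_power H A \<theta> = spectral_integral H (spectral_resolution H A) (\<lambda>t. t powr \<theta>)"

definition frac_power :: "'a::euclidean_space set \<Rightarrow> real \<Rightarrow> real \<Rightarrow> ('a L2 \<times> 'a L2) set" where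
  "frac_power \<Omega> s \<theta> = op_power (L2_on \<Omega>) (frac_operator \<Omega> s) \<theta>"


section \<open>Linear maps between normed subspaces\<close>

definition linear_between :: "'v::real_vector set \<Rightarrow> 'w::real_vector set \<Rightarrow> ('v \<Rightarrow> 'w) \<Rightarrow> bool" where
  "linear_between V W f \<longleftrightarrow> f ` V \<subseteq> W \<and>
     (\<forall>u\<in>V. \<forall>v\<in>V. f (u + v) = f u + f v) \<and> (\<forall>u\<in>V. \<forall>c. f (c *\<^sub>R u) = c *\<^sub>R f u)"

definition bounded_linear_between ::
  "'v::real_vector set \<Rightarrow> ('v \<Rightarrow> real) \<Rightarrow> 'w::real_vector set \<Rightarrow> ('w \<Rightarrow> real) \<Rightarrow> ('v \<Rightarrow> 'w) \<Rightarrow> bool" where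
  "bounded_linear_between V nV W nW f \<longleftrightarrow>
     linear_between V W f \<and> (\<exists>C. \<forall>u\<in>V. nW (f u) \<le> C * nV u)"

definition isometric_isomorphism ::
  "'v::real_vector set \<Rightarrow> ('v \<Rightarrow> real) \<Rightarrow> 'w::real_vector set \<Rightarrow> ('w \<Rightarrow> real) \<Rightarrow> ('v \<Rightarrow> 'w) \<Rightarrow> bool" where
  "isometric_isomorphism V nV W nW f \<longleftrightarrow>
     linear_between V W f \<and> bij_betw f V W \<and> (\<forall>u\<in>V. nW (f u) = nV u)"

end

(*
  The form a_s is closed and coercive, so the form operator A_s maps its domain bijectively onto L2(Omega).
  Averaging over a grid of cubes of side h approximates u in L2(Omega) up to C h^s times the H^s-seminorm;
  hence H_0^s(Omega) embeds compactly, and minimising the Rayleigh quotient yields an orthonormal basis of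
  eigenvectors of A_s and with it a spectral resolution E.  For any resolution E of A_s, coercivity confines
  E to [1, oo).  On the domain of A_s we have |A_s^(1/2) u|^2 = a_s(u,u); truncating with E[-n,n] extends
  this to the domain of A_s^(1/2).  As A_s^(1/2) is onto, the Riesz theorem shows that the functional
  z |-> a_s(A_s^(-1/2) z, v) is represented by a z0 with v = A_s^(-1/2) z0, for every v in H_0^s(Omega).
*)
theory Submission
  imports Defs "HOL-Library.Diagonal_Subsequence"
begin

section \<open>Complete bilinear forms\<close>

text \<open>\<open>spectral_resolution\<close> is a Hilbert choice, so nothing can be said about it
  until some resolution has been exhibited; even then it is not known to be the diagonal one that
  was built. Hence everything about the square root is proved for an arbitrary resolution of the
  form operator. Two features shape the set-up. L2(Omega) and H_0^s(Omega) are subsets of one type,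
  so carriers \<open>H\<close> and \<open>V\<close> run through all statements. The form norm is not
  the norm of that type, so Hilbert space theory is developed for a bilinear form on a carrier, with
  completeness as an assumption; it is met because the difference quotient is a closed operator into
  L2 of the product space. The delicate half of the domain equality is that every \<open>v\<close>
  in \<open>V\<close> lies in the domain of the square root. If \<open>z0\<close> represents z |->
  a(R z, v), with \<open>R\<close> the inverse square root, then v - R z0 is
  \<open>a\<close>-orthogonal to the range of \<open>R\<close>, which contains the domain of
  \<open>A\<close>. As \<open>A\<close> is onto, v - R z0 is the image of some x in that domain, and
  testing A x = v - R z0 with itself gives 0.\<close>

lemma linear_part_zero:
  fixes b c :: real
  assumes "\<And>t. 0 \<le> 2 * t * b + t\<^sup>2 * c" shows "b = 0"
proof -
  \<comment> \<open>\<open>d\<close> is positive and strictly larger than \<open>c\<close>, whatever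
    the sign of \<open>c\<close>, so the quadratic at t = - b / d is at most - b^2 / d.\<close>
  define d where "d = \<bar>c\<bar> + 1"
  have d: "d > 0" "c < d" by (auto simp: d_def)
  have "0 \<le> 2 * (- b / d) * b + (- b / d)\<^sup>2 * c" by (rule assms)
  also have "\<dots> \<le> 2 * (- b / d) * b + (- b / d)\<^sup>2 * d"
    using d by (intro add_left_mono mult_left_mono) auto
  also have "\<dots> = - (b\<^sup>2 / d)" using d by (simp add: power2_eq_square field_simps)
  finally show "b = 0" using d by (simp add: divide_le_0_iff)
qed

text \<open>Completeness is phrased through \<open>a\<close> alone because the type carries no
  matching norm. The form is only semidefinite here, so limits need not be unique; uniqueness comes
  later from coercivity. The locale serves both for the fractional form and for the inner product on
  a closed subspace.\<close>

locale hilbert_form =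
  fixes V :: "'v::real_vector set" and a :: "'v \<Rightarrow> 'v \<Rightarrow> real"
  assumes subspace_V: "subspace V"
    and add_left: "\<lbrakk>u \<in> V; v \<in> V; w \<in> V\<rbrakk> \<Longrightarrow> a (u + v) w = a u w + a v w"
    and scale_left: "\<lbrakk>u \<in> V; v \<in> V\<rbrakk> \<Longrightarrow> a (c *\<^sub>R u) v = c * a u v"
    and sym: "\<lbrakk>u \<in> V; v \<in> V\<rbrakk> \<Longrightarrow> a u v = a v u"
    and nonneg: "u \<in> V \<Longrightarrow> 0 \<le> a u u"
    and complete: "\<lbrakk>\<And>n. X n \<in> V;
        \<And>e. e > 0 \<Longrightarrow> \<exists>N. \<forall>m\<ge>N. \<forall>n\<ge>N. a (X m - X n) (X m - X n) < e\<rbrakk>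
      \<Longrightarrow> \<exists>x\<in>V. (\<lambda>n::nat. a (X n - x) (X n - x)) \<longlonglongrightarrow> 0"
begin

lemma add_mem: "u \<in> V \<Longrightarrow> v \<in> V \<Longrightarrow> u + v \<in> V"
  and diff_mem: "u \<in> V \<Longrightarrow> v \<in> V \<Longrightarrow> u - v \<in> V"
  and scale_mem: "u \<in> V \<Longrightarrow> c *\<^sub>R u \<in> V"
  and zero_mem: "0 \<in> V"
  using subspace_V by (auto intro: subspace_add subspace_diff subspace_scale subspace_0)

lemma diff_left: "\<lbrakk>u \<in> V; v \<in> V; w \<in> V\<rbrakk> \<Longrightarrow> a (u - v) w = a u w - a v w"
  using add_left[of "u - v" v w] by (simp add: diff_mem)

lemma add_right: "\<lbrakk>u \<in> V; v \<in> V; w \<in> V\<rbrakk> \<Longrightarrow> a w (u + v) = a w u + a w v"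
  by (simp add: sym[of w] add_left add_mem)

lemma diff_right: "\<lbrakk>u \<in> V; v \<in> V; w \<in> V\<rbrakk> \<Longrightarrow> a w (u - v) = a w u - a w v"
  by (simp add: sym[of w] diff_left diff_mem)

lemma scale_right: "\<lbrakk>u \<in> V; v \<in> V\<rbrakk> \<Longrightarrow> a v (c *\<^sub>R u) = c * a v u"
  by (simp add: sym[of v] scale_left scale_mem)

lemmas bilinear = add_left add_right diff_left diff_right scale_left scale_right

lemmas mem = add_mem diff_mem scale_mem zero_mem

lemma zero_left: "v \<in> V \<Longrightarrow> a 0 v = 0"
  using scale_left[of v v 0] by simp

lemma quadratic: "\<lbrakk>u \<in> V; v \<in> V\<rbrakk> \<Longrightarrow> a (u + t *\<^sub>R v) (u + t *\<^sub>R v) = a u u + 2 * t * a u v + t\<^sup>2 * a v v"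
  by (simp add: bilinear mem sym[of v u] power2_eq_square algebra_simps)

lemma Cauchy_Schwarz:
  assumes "u \<in> V" "v \<in> V" shows "(a u v)\<^sup>2 \<le> a u u * a v v"
\<comment> \<open>In a semidefinite form \<open>a v v = 0\<close> does not give v = 0; nonnegativity
  on the line v + t u then forces the mixed term to vanish.\<close>
proof (cases "a v v = 0")
  case True
  have "0 \<le> 2 * t * a u v + t\<^sup>2 * a u u" for t
  proof -
    have "0 \<le> a (v + t *\<^sub>R u) (v + t *\<^sub>R u)" using assms by (intro nonneg mem)
    then show ?thesis using assms True by (simp add: quadratic sym[of v u])
  qed
  then have "a u v = 0" by (rule linear_part_zero)
  then show ?thesis using assms by (simp add: nonneg)
next
  case False
  then have p: "a v v > 0" using nonneg[OF assms(2)] by simp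
  \<comment> \<open>The minimiser of the quadratic in \<open>t\<close>.\<close>
  define t where "t = - a u v / a v v"
  have "0 \<le> a (u + t *\<^sub>R v) (u + t *\<^sub>R v)" using assms by (intro nonneg mem)
  also have "\<dots> = a u u + 2 * t * a u v + t\<^sup>2 * a v v"
    using assms by (rule quadratic)
  also have "\<dots> = a u u - (a u v)\<^sup>2 / a v v"
    using p by (simp add: t_def power2_eq_square field_simps)
  finally show ?thesis using p by (simp add: field_simps)
qed

lemma tendsto_form:
  assumes "\<And>n. X n \<in> V" "x \<in> V" "v \<in> V" "(\<lambda>n::nat. a (X n - x) (X n - x)) \<longlonglongrightarrow> 0"
  shows "(\<lambda>n. a (X n) v) \<longlonglongrightarrow> a x v"
proof -
  have "(\<lambda>n. (a (X n - x) v)\<^sup>2) \<longlonglongrightarrow> 0"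
  proof (rule tendsto_sandwich[OF _ _ tendsto_const])
    show "\<forall>\<^sub>F n in sequentially. (a (X n - x) v)\<^sup>2 \<le> a (X n - x) (X n - x) * a v v"
      using assms by (intro always_eventually allI Cauchy_Schwarz mem)
    show "(\<lambda>n. a (X n - x) (X n - x) * a v v) \<longlonglongrightarrow> 0"
      using tendsto_mult[OF assms(4) tendsto_const] by simp
  qed simp
  then have "(\<lambda>n. a (X n - x) v) \<longlonglongrightarrow> 0" by simp
  then show ?thesis using assms by (simp add: bilinear LIM_zero_iff)
qed

lemma tendsto_form_diag:
  assumes "\<And>n. X n \<in> V" "x \<in> V" "(\<lambda>n::nat. a (X n - x) (X n - x)) \<longlonglongrightarrow> 0"
  shows "(\<lambda>n. a (X n) (X n)) \<longlonglongrightarrow> a x x"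
proof -
  have "(\<lambda>n. a (X n - x) (X n - x) + 2 * a (X n) x - a x x) \<longlonglongrightarrow> 0 + 2 * a x x - a x x"
    by (intro tendsto_intros tendsto_form assms)
  moreover have "a (X n - x) (X n - x) + 2 * a (X n) x - a x x = a (X n) (X n)" for n
    using assms by (simp add: bilinear mem sym[of x "X n"])
  ultimately show ?thesis by simp
qed

lemma parallelogram:
  assumes "u \<in> V" "v \<in> V"
  shows "a (u - v) (u - v) = 2 * a u u + 2 * a v v - a (u + v) (u + v)"
  using assms by (simp add: bilinear mem sym[of v u])

text \<open>Direct method: the representing vector is sought as a minimiser of a v v - 2 l v. The
  parallelogram law makes a minimising sequence Cauchy, completeness supplies a limit, and the
  vanishing first variation there is the claim. The bound is stated for squares, so \<open>C\<close>
  plays the part of a squared operator norm.\<close>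

theorem Riesz_representation:
  assumes add: "\<And>u v. u \<in> V \<Longrightarrow> v \<in> V \<Longrightarrow> l (u + v) = l u + l v"
    and scale: "\<And>c u. u \<in> V \<Longrightarrow> l (c *\<^sub>R u) = c * l u"
    and C: "0 \<le> C" and bound: "\<And>u. u \<in> V \<Longrightarrow> (l u)\<^sup>2 \<le> C * a u u"
  shows "\<exists>w\<in>V. \<forall>v\<in>V. a w v = l v"
proof -
  define J where "J v = a v v - 2 * l v" for v
  have J_lower: "- C \<le> J v" if "v \<in> V" for v
  proof -
    have "(2 * l v)\<^sup>2 \<le> 4 * (C * a v v)" using bound[OF that] by (simp add: power_mult_distrib)
    also have "\<dots> \<le> (C + a v v)\<^sup>2" using sum_squares_bound[of C "a v v"] by (simp add: power2_sum)
    finally have "2 * l v \<le> C + a v v" 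
      by (rule power2_le_imp_le) (use C nonneg[OF that] in simp)
    then show ?thesis by (simp add: J_def)
  qed
  define m where "m = (INF v\<in>V. J v)"
  have bdd: "bdd_below (J ` V)" using J_lower by (intro bdd_belowI2)
  have m_le: "m \<le> J v" if "v \<in> V" for v
    unfolding m_def using bdd that by (rule cINF_lower)
  have "\<exists>v\<in>V. J v < m + inverse (real (Suc n))" for n
  proof (rule ccontr)
    assume "\<not> ?thesis"
    then have "m + inverse (real (Suc n)) \<le> m"
      unfolding m_def using zero_mem by (intro cINF_greatest) (auto simp: not_less m_def)
    then show False by simp
  qed
  then obtain X where X: "\<And>n. X n \<in> V" "\<And>n. J (X n) < m + inverse (real (Suc n))" by metis
  have dist_bound: "a (X i - X j) (X i - X j) \<le> 2 * inverse (real (Suc i)) + 2 * inverse (real (Suc j))" for i j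
  proof -
    \<comment> \<open>Testing the infimum at the midpoint and inserting the parallelogram law bounds
      the squared distance by the two excesses over \<open>m\<close>.\<close>
    let ?h = "(1/2) *\<^sub>R (X i + X j)"
    have "m \<le> J ?h" using X by (intro m_le mem)
    moreover have "4 * J ?h = a (X i + X j) (X i + X j) - 4 * (l (X i) + l (X j))"
      using X(1) by (simp add: J_def bilinear mem scale add field_simps)
    ultimately have "4 * m \<le> a (X i + X j) (X i + X j) - 4 * (l (X i) + l (X j))" by simp
    moreover have "p \<le> 2 * d + 2 * e"
      if "4 * m \<le> q - 4 * (x + y)" "p = 2 * b + 2 * c - q" "b - 2 * x < m + d" "c - 2 * y < m + e"
      for b c d e p q x y :: real
      using that by argo
    ultimately show ?thesis
      using parallelogram[OF X(1)[of i] X(1)[of j]] X(2)[of i, unfolded J_def] X(2)[of j, unfolded J_def]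
      by blast
  qed
  have "\<exists>x\<in>V. (\<lambda>n. a (X n - x) (X n - x)) \<longlonglongrightarrow> 0"
  proof (rule complete[OF X(1)])
    fix e :: real assume "e > 0"
    then obtain N where N: "inverse (real (Suc N)) < e / 4" using reals_Archimedean[of "e/4"] by (meson zero_less_divide_iff zero_less_numeral)
    have "2 * inverse (real (Suc n)) < e / 2" if "n \<ge> N" for n
    proof -
      have "inverse (real (Suc n)) \<le> inverse (real (Suc N))"
        using that by (intro le_imp_inverse_le) auto
      then show ?thesis using N by linarith
    qed
    then have "a (X i - X j) (X i - X j) < e" if "i \<ge> N" "j \<ge> N" for i j
      using dist_bound[of i j] that by (smt (verit) field_sum_of_halves)
    then show "\<exists>N. \<forall>i\<ge>N. \<forall>j\<ge>N. a (X i - X j) (X i - X j) < e" by blast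
  qed
  then obtain w where w: "w \<in> V" "(\<lambda>n. a (X n - w) (X n - w)) \<longlonglongrightarrow> 0" by auto
  have "a w v = l v" if v: "v \<in> V" for v
  proof -
    \<comment> \<open>The variation is taken at \<open>X n\<close>, which minimises up to 1 / (n +
      1); this error is the additional summand below and vanishes in the limit.\<close>
    have "0 \<le> 2 * t * (a w v - l v) + t\<^sup>2 * a v v" for t
    proof (rule LIMSEQ_le_const)
      show "(\<lambda>n. inverse (real (Suc n)) + (2 * t * (a (X n) v - l v) + t\<^sup>2 * a v v))
          \<longlonglongrightarrow> 2 * t * (a w v - l v) + t\<^sup>2 * a v v"
        using tendsto_add[OF LIMSEQ_inverse_real_of_nat
            tendsto_add[OF tendsto_mult[OF tendsto_const[of "2*t"] tendsto_diff[OF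
              tendsto_form[OF X(1) w(1) v w(2)] tendsto_const[of "l v"]]] tendsto_const[of "t\<^sup>2 * a v v"]]]
        by (simp only: add_0_left)
      have "0 \<le> inverse (real (Suc n)) + (2 * t * (a (X n) v - l v) + t\<^sup>2 * a v v)" for n
      proof -
        have "m \<le> J (X n + t *\<^sub>R v)" using X v by (intro m_le mem)
        also have "\<dots> = J (X n) + 2 * t * (a (X n) v - l v) + t\<^sup>2 * a v v"
          using X v by (simp add: J_def quadratic add scale mem algebra_simps)
        finally show ?thesis using X(2)[of n] by linarith
      qed
      then show "\<exists>N. \<forall>n\<ge>N. 0 \<le> inverse (real (Suc n)) + (2 * t * (a (X n) v - l v) + t\<^sup>2 * a v v)"
        by auto
    qed
    then have "a w v - l v = 0" by (rule linear_part_zero)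
    then show ?thesis by simp
  qed
  then show ?thesis using w by blast
qed

end

lemma hilbert_form_inner:
  fixes H :: "'h::{real_inner,banach} set"
  assumes "closed H" "subspace H"
  shows "hilbert_form H (\<bullet>)"
proof
  fix X :: "nat \<Rightarrow> 'h"
  assume X: "\<And>n. X n \<in> H"
    and C: "\<And>e. e > 0 \<Longrightarrow> \<exists>N. \<forall>m\<ge>N. \<forall>n\<ge>N. (X m - X n) \<bullet> (X m - X n) < e"
  have "Cauchy X"
  proof (rule metric_CauchyI)
    fix e :: real assume "e > 0"
    then obtain N where N: "\<forall>m\<ge>N. \<forall>n\<ge>N. (X m - X n) \<bullet> (X m - X n) < e\<^sup>2" using C[of "e\<^sup>2"] by auto
    have "dist (X m) (X n) < e" if "m \<ge> N" "n \<ge> N" for m n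
    proof -
      have "(norm (X m - X n))\<^sup>2 < e\<^sup>2" using N that by (simp add: power2_norm_eq_inner)
      then show ?thesis using \<open>e > 0\<close> by (simp add: dist_norm power_less_imp_less_base)
    qed
    then show "\<exists>M. \<forall>m\<ge>M. \<forall>n\<ge>M. dist (X m) (X n) < e" by blast
  qed
  then obtain x where x: "X \<longlonglongrightarrow> x" by (auto simp: Cauchy_convergent_iff convergent_def)
  then have "x \<in> H" using X assms(1) closed_sequentially by blast
  moreover have "(\<lambda>n. (X n - x) \<bullet> (X n - x)) \<longlonglongrightarrow> (x - x) \<bullet> (x - x)"
    by (intro tendsto_intros x)
  ultimately show "\<exists>x\<in>H. (\<lambda>n. (X n - x) \<bullet> (X n - x)) \<longlonglongrightarrow> 0" by auto
next
  show "u \<bullet> v = v \<bullet> u" for u v :: 'h by (rule inner_commute)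
qed (use assms in \<open>auto simp: inner_add_left\<close>)

section \<open>Spectral measures\<close>

lemma simple_fibre: "simple_function borel k \<Longrightarrow> k -` {p} \<in> sets borel"
  using simple_functionD(2)[of borel k "{p}"] by simp

lemma simple_range: "simple_function (borel :: real measure) k \<Longrightarrow> finite (range k)"
  using simple_functionD(1)[of borel k] by simp

text \<open>A choice of approximants depending on \<open>f\<close> alone: one sequence serves every
  vector, so additivity and symmetry of spectral integrals can be read off term by term. The bound 2
  |f| provides the dominating functions.\<close>

definition approx :: "(real \<Rightarrow> real) \<Rightarrow> nat \<Rightarrow> real \<Rightarrow> real" where
  "approx f = (SOME F. (\<forall>n. simple_function borel (F n)) \<and> (\<forall>t. (\<lambda>n. F n t) \<longlonglongrightarrow> f t) \<and>
     (\<forall>n t. \<bar>F n t\<bar> \<le> 2 * \<bar>f t\<bar>))"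

lemma approx:
  assumes "f \<in> borel_measurable borel"
  shows simple_approx: "simple_function borel (approx f n)"
    and approx_tendsto: "(\<lambda>n. approx f n t) \<longlonglongrightarrow> f t"
    and approx_bound: "\<bar>approx f n t\<bar> \<le> 2 * \<bar>f t\<bar>"
proof -
  have "\<exists>F. (\<forall>n. simple_function borel (F n)) \<and> (\<forall>t. (\<lambda>n. F n t) \<longlonglongrightarrow> f t) \<and>
     (\<forall>n t. \<bar>F n t\<bar> \<le> 2 * \<bar>f t\<bar>)"
    using borel_measurable_implies_sequence_metric[OF assms, of 0] by (auto simp: dist_real_def)
  from someI_ex[OF this, folded approx_def] show "simple_function borel (approx f n)"
    "(\<lambda>n. approx f n t) \<longlonglongrightarrow> f t" "\<bar>approx f n t\<bar> \<le> 2 * \<bar>f t\<bar>" by blast+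
qed

lemma integrable_diff_square:
  fixes g f :: "real \<Rightarrow> real"
  assumes "f \<in> borel_measurable M" "g \<in> borel_measurable M"
    "integrable M (\<lambda>t. (f t)\<^sup>2)" "integrable M (\<lambda>t. (g t)\<^sup>2)"
  shows "integrable M (\<lambda>t. (g t - f t)\<^sup>2)"
proof (rule Bochner_Integration.integrable_bound)
  show "integrable M (\<lambda>t. 2 * (g t)\<^sup>2 + 2 * (f t)\<^sup>2)" using assms by simp
  show "AE t in M. norm ((g t - f t)\<^sup>2) \<le> norm (2 * (g t)\<^sup>2 + 2 * (f t)\<^sup>2)"
  proof (intro always_eventually allI)
    fix t
    have "0 \<le> (g t + f t)\<^sup>2" by simp
    then have "(g t - f t)\<^sup>2 \<le> 2 * (g t)\<^sup>2 + 2 * (f t)\<^sup>2"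
      unfolding power2_sum power2_diff by linarith
    then show "norm ((g t - f t)\<^sup>2) \<le> norm (2 * (g t)\<^sup>2 + 2 * (f t)\<^sup>2)" by simp
  qed
qed (use assms in measurable)

locale projection_valued_measure =
  fixes H :: "'h::{real_inner,banach} set" and E :: "real set \<Rightarrow> 'h \<Rightarrow> 'h"
  assumes closed_H: "closed H" and subspace_H: "subspace H"
    and spectral: "spectral_measure H E"
begin

section \<open>Algebra of the projections\<close>

lemma H_mem: "u \<in> H \<Longrightarrow> v \<in> H \<Longrightarrow> u + v \<in> H" "u \<in> H \<Longrightarrow> v \<in> H \<Longrightarrow> u - v \<in> H"
    "u \<in> H \<Longrightarrow> c *\<^sub>R u \<in> H" "0 \<in> H" "(\<And>i. i \<in> I \<Longrightarrow> f i \<in> H) \<Longrightarrow> sum f I \<in> H"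
  using subspace_H by (auto intro: subspace_add subspace_diff subspace_scale subspace_0 subspace_sum)

context
  fixes B :: "real set" assumes B: "B \<in> sets borel"
begin

lemma E_mem: "u \<in> H \<Longrightarrow> E B u \<in> H"
  and E_idem: "u \<in> H \<Longrightarrow> E B (E B u) = E B u"
  and E_add: "u \<in> H \<Longrightarrow> v \<in> H \<Longrightarrow> E B (u + v) = E B u + E B v"
  and E_sym: "u \<in> H \<Longrightarrow> v \<in> H \<Longrightarrow> E B u \<bullet> v = u \<bullet> E B v"
  and E_scale: "u \<in> H \<Longrightarrow> E B (c *\<^sub>R u) = c *\<^sub>R E B u"
  using spectral B unfolding spectral_measure_def by blast+

lemma E_zero: "E B 0 = 0"
  using E_scale[of 0 0] H_mem(4) by simp

lemma E_diff: "u \<in> H \<Longrightarrow> v \<in> H \<Longrightarrow> E B (u - v) = E B u - E B v"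
  using E_add[of "u - v" v] by (simp add: H_mem)

lemma E_sum: "(\<And>i. i \<in> I \<Longrightarrow> f i \<in> H) \<Longrightarrow> E B (sum f I) = (\<Sum>i\<in>I. E B (f i))"
  by (induction I rule: infinite_finite_induct) (auto simp: E_zero E_add H_mem)

lemma E_inner_self: "u \<in> H \<Longrightarrow> E B u \<bullet> u = (norm (E B u))\<^sup>2"
  using E_sym[of "E B u" u] by (simp add: E_idem E_mem power2_norm_eq_inner inner_commute)

lemma E_norm_le:
  assumes u: "u \<in> H" shows "norm (E B u) \<le> norm u"
proof -
  have "norm (E B u) * norm (E B u) \<le> norm (E B u) * norm u"
    using E_inner_self[OF u] norm_cauchy_schwarz[of "E B u" u] by (simp add: power2_eq_square)
  then show ?thesis by (cases "norm (E B u) = 0") auto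
qed

end

lemma E_UNIV: "u \<in> H \<Longrightarrow> E UNIV u = u"
  using spectral unfolding spectral_measure_def by blast

lemma E_sums:
  "\<lbrakk>range B \<subseteq> sets borel; disjoint_family B; u \<in> H\<rbrakk> \<Longrightarrow> (\<lambda>n. E (B n) u) sums E (\<Union>n::nat. B n) u"
  using spectral unfolding spectral_measure_def by blast

text \<open>Countable additivity for the constant sequence of empty sets gives a convergent series
  of equal terms, so the terms vanish.\<close>

lemma E_empty: assumes u: "u \<in> H" shows "E {} u = 0"
proof -
  have "(\<lambda>n::nat. E {} u) sums E {} u"
    using E_sums[of "\<lambda>n. {}" u] u by (auto simp: disjoint_family_on_def)
  then have "(\<lambda>n::nat. E {} u) \<longlonglongrightarrow> 0" by (intro summable_LIMSEQ_zero) (auto simp: summable_def)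
  then show ?thesis by (simp add: LIMSEQ_const_iff)
qed

lemma E_Un:
  assumes "A \<in> sets borel" "B \<in> sets borel" "A \<inter> B = {}" and u: "u \<in> H"
  shows "E (A \<union> B) u = E A u + E B u"
proof -
  define F where "F n = (if n = 0 then A else if n = 1 then B else {})" for n :: nat
  have "(\<Union>n. F n) = A \<union> B" by (auto simp: F_def split: if_splits)
  moreover have "range F \<subseteq> sets borel" "disjoint_family F"
    using assms by (auto simp: F_def disjoint_family_on_def)
  ultimately have "(\<lambda>n. E (F n) u) sums E (A \<union> B) u" using E_sums[of F u] u by simp
  moreover have "(\<lambda>n. E (F n) u) sums (\<Sum>n\<in>{0,1}. E (F n) u)"
    by (rule sums_finite) (auto simp: F_def E_empty u)
  ultimately show ?thesis using sums_unique2 by (fastforce simp: F_def)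
qed

lemma E_UN_finite:
  assumes "finite I" "\<And>i. i \<in> I \<Longrightarrow> A i \<in> sets borel" "disjoint_family_on A I" and u: "u \<in> H"
  shows "E (\<Union>i\<in>I. A i) u = (\<Sum>i\<in>I. E (A i) u)"
  using assms(1-3)
proof (induction I)
  case (insert i I)
  have "E (A i \<union> (\<Union>j\<in>I. A j)) u = E (A i) u + E (\<Union>j\<in>I. A j) u"
    using insert u by (intro E_Un sets.finite_UN) (auto simp: disjoint_family_on_def)
  then show ?case using insert by (simp add: disjoint_family_on_def)
qed (simp add: E_empty u)

text \<open>If \<open>P + Q\<close> is a projection, comparing \<open>\<parallel>(P + Q) Q u\<parallel>\<^sup>2\<close> with \<open>\<langle>(P + Q) Q u, Q u\<rangle>\<close> forces \<open>P Q u = 0\<close>.\<close>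

lemma E_disjoint:
  assumes "A \<in> sets borel" "B \<in> sets borel" "A \<inter> B = {}" and u: "u \<in> H"
  shows "E A (E B u) = 0"
proof -
  let ?q = "E B u"
  have q: "?q \<in> H" "E B ?q = ?q" using assms by (auto simp: E_mem E_idem)
  have "E (A \<union> B) ?q \<bullet> ?q = (norm (E (A \<union> B) ?q))\<^sup>2"
    using assms q by (intro E_inner_self) auto
  moreover have "E (A \<union> B) ?q = E A ?q + ?q" using assms q by (simp add: E_Un)
  moreover have "E A ?q \<bullet> ?q = (norm (E A ?q))\<^sup>2" using assms q by (intro E_inner_self)
  ultimately show ?thesis
    by (simp add: power2_norm_eq_inner inner_add_left inner_add_right inner_commute)
qed

text \<open>Multiplicativity is not an axiom of \<open>spectral_measure\<close>; it follows from
  additivity. Splitting \<open>B\<close>, and then \<open>A\<close>, along the intersection leaves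
  mixed terms over disjoint sets, which \<open>E_disjoint\<close> annihilates.\<close>

lemma E_Int:
  assumes A: "A \<in> sets borel" and B: "B \<in> sets borel" and u: "u \<in> H"
  shows "E A (E B u) = E (A \<inter> B) u"
proof -
  have *: "E S v = E (S \<inter> T) v + E (S - T) v" if "S \<in> sets borel" "T \<in> sets borel" "v \<in> H" for S T v
    using E_Un[of "S \<inter> T" "S - T" v] that by (simp add: Int_Diff_Un Int_Diff_disjoint)
  have "E A (E B u) = E A (E (B \<inter> A) u) + E A (E (B - A) u)"
    using assms by (simp add: *[of B A u] E_add E_mem)
  also have "E A (E (B - A) u) = 0" using assms by (intro E_disjoint) auto
  also have "E A (E (B \<inter> A) u) = E (A \<inter> B) (E (B \<inter> A) u) + E (A - B) (E (B \<inter> A) u)"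
    using assms by (intro *) (auto simp: E_mem)
  also have "E (A - B) (E (B \<inter> A) u) = 0" using assms by (intro E_disjoint) auto
  also have "E (A \<inter> B) (E (B \<inter> A) u) = E (A \<inter> B) u"
    using assms by (simp add: E_idem Int_commute)
  finally show ?thesis by simp
qed

lemma E_tendsto:
  assumes "B \<in> sets borel" "\<And>n. X n \<in> H" "x \<in> H" "X \<longlonglongrightarrow> x"
  shows "(\<lambda>n::nat. E B (X n)) \<longlonglongrightarrow> E B x"
proof -
  have "(\<lambda>n. norm (X n - x)) \<longlonglongrightarrow> 0" using assms(4) by (simp add: LIM_zero_iff tendsto_norm_zero_iff)
  then have "(\<lambda>n. E B (X n) - E B x) \<longlonglongrightarrow> 0"
    by (rule Lim_null_comparison[rotated])
       (use assms E_norm_le[of B "X _ - x"] in \<open>auto simp: E_diff H_mem\<close>)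
  then show ?thesis by (simp add: LIM_zero_iff)
qed

section \<open>Scalar measures\<close>

abbreviation "\<mu> \<equiv> scalar_measure E"

lemma space_\<mu> [simp]: "space (\<mu> u) = UNIV" and sets_\<mu> [simp, measurable_cong]: "sets (\<mu> u) = sets borel"
  using sets.sigma_sets_eq[of "borel :: real measure"] by (auto simp: scalar_measure_def space_measure_of_conv sets_measure_of_conv)

text \<open>Norm convergent additivity of \<open>E\<close> passes to the scalar set function through
  continuity of the inner product, and a self-adjoint idempotent turns
  \<open>E B u \<bullet> u\<close> into a squared norm.\<close>

lemma emeasure_\<mu>:
  assumes u: "u \<in> H" and B: "B \<in> sets borel"
  shows "emeasure (\<mu> u) B = ennreal ((norm (E B u))\<^sup>2)"
proof -
  have "emeasure (\<mu> u) B = ennreal (E B u \<bullet> u)"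
  proof (rule emeasure_measure_of[OF scalar_measure_def])
    show "positive (sets (\<mu> u)) (\<lambda>B. ennreal (E B u \<bullet> u))"
      by (simp add: positive_def E_empty u)
    show "countably_additive (sets (\<mu> u)) (\<lambda>B. ennreal (E B u \<bullet> u))"
    proof (rule countably_additiveI)
      fix A :: "nat \<Rightarrow> real set"
      assume A: "range A \<subseteq> sets (\<mu> u)" "disjoint_family A"
      then have "(\<lambda>n. E (A n) u \<bullet> u) sums (E (\<Union>n. A n) u \<bullet> u)"
        using E_sums[of A u] u by (intro bounded_linear.sums[OF bounded_linear_inner_left]) auto
      moreover have "0 \<le> E (A n) u \<bullet> u" for n
        using A u by (subst E_inner_self) auto
      ultimately show "(\<Sum>n. ennreal (E (A n) u \<bullet> u)) = ennreal (E (\<Union>n. A n) u \<bullet> u)"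
        by (metis suminf_ennreal_eq)
    qed
  qed (use B in auto)
  then show ?thesis using u B by (simp add: E_inner_self)
qed

lemma measure_\<mu>: "u \<in> H \<Longrightarrow> B \<in> sets borel \<Longrightarrow> measure (\<mu> u) B = (norm (E B u))\<^sup>2"
  by (simp add: measure_def emeasure_\<mu>)

lemma finite_measure_\<mu>: "u \<in> H \<Longrightarrow> finite_measure (\<mu> u)"
  by (rule finite_measureI) (simp add: emeasure_\<mu>)

lemma emeasure_\<mu>_E:
  assumes "u \<in> H" "B \<in> sets borel" "C \<in> sets borel"
  shows "emeasure (\<mu> (E B u)) C = emeasure (\<mu> u) (C \<inter> B)"
  using assms by (simp add: emeasure_\<mu> E_mem E_Int)

section \<open>Integrals of simple functions\<close>

definition simple_integral :: "(real \<Rightarrow> real) \<Rightarrow> 'h \<Rightarrow> 'h" where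
  "simple_integral g u = (\<Sum>c\<in>range g. c *\<^sub>R E (g -` {c}) u)"

text \<open>A fibre of the composite is a finite union of fibres of \<open>k\<close>, so an integral
  may be computed on a finer partition. With \<open>k\<close> a pair of simple functions this
  provides a common partition for both, which is how linearity in the integrand is obtained.\<close>

lemma simple_integral_comp:
  assumes k: "simple_function borel k" and u: "u \<in> H"
  shows "simple_integral (\<lambda>t. \<phi> (k t)) u = (\<Sum>p\<in>range k. \<phi> p *\<^sub>R E (k -` {p}) u)"
proof -
  have "E ((\<lambda>t. \<phi> (k t)) -` {c}) u = (\<Sum>p\<in>{p\<in>range k. \<phi> p = c}. E (k -` {p}) u)" for c
  proof -
    have "(\<lambda>t. \<phi> (k t)) -` {c} = (\<Union>p\<in>{p\<in>range k. \<phi> p = c}. k -` {p})" by auto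
    then show ?thesis
      using k u simple_range[OF k]
      by (simp only:) (intro E_UN_finite, auto simp: simple_fibre disjoint_family_on_def)
  qed
  then have "simple_integral (\<lambda>t. \<phi> (k t)) u
      = (\<Sum>c\<in>range (\<lambda>t. \<phi> (k t)). \<Sum>p\<in>{p\<in>range k. \<phi> p = c}. \<phi> p *\<^sub>R E (k -` {p}) u)"
    by (simp add: simple_integral_def scaleR_sum_right)
  also have "\<dots> = (\<Sum>p\<in>range k. \<phi> p *\<^sub>R E (k -` {p}) u)"
    using sum.image_gen[OF simple_range[OF k], of "\<lambda>p. \<phi> p *\<^sub>R E (k -` {p}) u" \<phi>]
    by (simp add: image_image)
  finally show ?thesis .
qed

lemma simple_integral_mem: "simple_function borel g \<Longrightarrow> u \<in> H \<Longrightarrow> simple_integral g u \<in> H"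
  unfolding simple_integral_def by (intro H_mem E_mem simple_fibre)

lemma simple_integral_add_arg:
  "\<lbrakk>simple_function borel g; u \<in> H; v \<in> H\<rbrakk>
    \<Longrightarrow> simple_integral g (u + v) = simple_integral g u + simple_integral g v"
  by (simp add: simple_integral_def E_add simple_fibre scaleR_add_right sum.distrib)

lemma simple_integral_scale_arg:
  "\<lbrakk>simple_function borel g; u \<in> H\<rbrakk> \<Longrightarrow> simple_integral g (c *\<^sub>R u) = c *\<^sub>R simple_integral g u"
  by (simp add: simple_integral_def E_scale simple_fibre scaleR_sum_right mult.commute)

lemma simple_integral_sym:
  "\<lbrakk>simple_function borel g; u \<in> H; v \<in> H\<rbrakk> \<Longrightarrow> simple_integral g u \<bullet> v = u \<bullet> simple_integral g v"
  by (simp add: simple_integral_def inner_sum_left inner_sum_right E_sym simple_fibre)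

lemma simple_integral_add:
  assumes g: "simple_function borel g" and h: "simple_function borel h" and u: "u \<in> H"
  shows "simple_integral (\<lambda>t. g t + h t) u = simple_integral g u + simple_integral h u"
    and "simple_integral (\<lambda>t. g t - h t) u = simple_integral g u - simple_integral h u"
proof -
  have k: "simple_function borel (\<lambda>t. (g t, h t))" using g h by (rule simple_function_Pair)
  note * = simple_integral_comp[OF k u]
  show "simple_integral (\<lambda>t. g t + h t) u = simple_integral g u + simple_integral h u"
    using *[of "\<lambda>p. fst p + snd p"] *[of fst] *[of snd] by (simp add: scaleR_left_distrib sum.distrib)
  show "simple_integral (\<lambda>t. g t - h t) u = simple_integral g u - simple_integral h u"
    using *[of "\<lambda>p. fst p - snd p"] *[of fst] *[of snd] by (simp add: scaleR_left_diff_distrib sum_subtractf)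
qed

lemma simple_integral_scale:
  assumes g: "simple_function borel g" and u: "u \<in> H"
  shows "simple_integral (\<lambda>t. c * g t) u = c *\<^sub>R simple_integral g u"
  using simple_integral_comp[OF g u, of "\<lambda>p. c * p"] by (simp add: simple_integral_def scaleR_sum_right)

lemma E_simple_integral:
  assumes g: "simple_function borel g" and u: "u \<in> H" and B: "B \<in> sets borel"
  shows "E B (simple_integral g u) = simple_integral (\<lambda>t. indicator B t * g t) u"
    and "simple_integral g (E B u) = E B (simple_integral g u)"
proof -
  \<comment> \<open>Each fibre of this pair lies either inside or outside \<open>B\<close>, so
    \<open>E B\<close> keeps or kills the corresponding term.\<close>
  have k: "simple_function borel (\<lambda>t. (indicator B t :: real, g t))"
    using g B by (intro simple_function_Pair simple_function_indicator) auto
  note * = simple_integral_comp[OF k u]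
  have fib: "(\<lambda>t. (indicator B t :: real, g t)) -` {p} \<in> sets borel" for p by (rule simple_fibre[OF k])
  have "E B (simple_integral g u) = E B (simple_integral (\<lambda>t. snd (indicator B t :: real, g t)) u)" by simp
  also have "\<dots> = (\<Sum>p\<in>range (\<lambda>t. (indicator B t :: real, g t)). E B (snd p *\<^sub>R E ((\<lambda>t. (indicator B t :: real, g t)) -` {p}) u))"
    unfolding * using B u fib by (intro E_sum[OF B]) (auto intro!: H_mem E_mem)
  also have "\<dots> = (\<Sum>p\<in>range (\<lambda>t. (indicator B t :: real, g t)). (fst p * snd p) *\<^sub>R E ((\<lambda>t. (indicator B t :: real, g t)) -` {p}) u)"
  proof (rule sum.cong[OF refl])
    fix p :: "real \<times> real" assume "p \<in> range (\<lambda>t. (indicator B t :: real, g t))"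
    let ?F = "(\<lambda>t. (indicator B t :: real, g t)) -` {p}"
    have "E B (snd p *\<^sub>R E ?F u) = snd p *\<^sub>R E (B \<inter> ?F) u"
      using B u fib by (simp add: E_scale E_mem E_Int)
    also have "\<dots> = (fst p * snd p) *\<^sub>R E ?F u"
    proof (cases "fst p = 1")
      case True
      then have "B \<inter> ?F = ?F" by (auto simp: indicator_def split: if_splits)
      then show ?thesis using True by simp
    next
      case False
      then have "B \<inter> ?F = {}" by auto
      moreover have "fst p = 0" using False \<open>p \<in> _\<close> by (auto simp: indicator_def split: if_splits)
      ultimately show ?thesis using u by (simp add: E_empty)
    qed
    finally show "E B (snd p *\<^sub>R E ?F u) = (fst p * snd p) *\<^sub>R E ?F u" .
  qed
  also have "\<dots> = simple_integral (\<lambda>t. indicator B t * g t) u"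
    using *[of "\<lambda>p. fst p * snd p"] by simp
  finally show "E B (simple_integral g u) = simple_integral (\<lambda>t. indicator B t * g t) u" .
  show "simple_integral g (E B u) = E B (simple_integral g u)"
    using B u simple_fibre[OF g]
    by (simp add: simple_integral_def E_Int E_sum E_mem E_scale H_mem Int_commute)
qed

lemma integral_simple:
  assumes k: "simple_function borel k" and u: "u \<in> H"
  shows "integrable (\<mu> u) (\<lambda>t. \<phi> (k t) :: real)"
    and "(LINT t|\<mu> u. \<phi> (k t)) = (\<Sum>p\<in>range k. \<phi> p * (norm (E (k -` {p}) u))\<^sup>2)"
proof -
  interpret finite_measure "\<mu> u" using u by (rule finite_measure_\<mu>)
  have eq: "\<phi> (k t) = (\<Sum>p\<in>range k. \<phi> p * indicator (k -` {p}) t)" for t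
    using simple_range[OF k] by (simp add: indicator_def sum.If_cases if_distrib[of "\<lambda>x. _ * x"] vimage_def cong: if_cong)
  have int: "integrable (\<mu> u) (\<lambda>t. \<phi> p * indicator (k -` {p}) t)" for p
    using simple_fibre[OF k, of p] by (intro integrable_mult_right integrable_real_indicator) (auto simp: emeasure_eq_measure)
  show "integrable (\<mu> u) (\<lambda>t. \<phi> (k t))" unfolding eq using int by auto
  have "(LINT t|\<mu> u. \<phi> (k t)) = (\<Sum>p\<in>range k. LINT t|\<mu> u. \<phi> p * indicator (k -` {p}) t)"
    unfolding eq using int by (intro Bochner_Integration.integral_sum)
  also have "\<dots> = (\<Sum>p\<in>range k. \<phi> p * (norm (E (k -` {p}) u))\<^sup>2)"
    using simple_fibre[OF k] u by (simp add: measure_\<mu>)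
  finally show "(LINT t|\<mu> u. \<phi> (k t)) = (\<Sum>p\<in>range k. \<phi> p * (norm (E (k -` {p}) u))\<^sup>2)" .
qed

text \<open>Pythagoras: projections belonging to distinct fibres have orthogonal ranges. This
  isometry into L2(\<mu> u) carries the integral from simple to general functions.\<close>

lemma norm_simple_integral:
  assumes g: "simple_function borel g" and u: "u \<in> H"
  shows "(norm (simple_integral g u))\<^sup>2 = (LINT t|\<mu> u. (g t)\<^sup>2)"
proof -
  have "(norm (simple_integral g u))\<^sup>2
      = (\<Sum>c\<in>range g. \<Sum>d\<in>range g. c * d * (E (g -` {c}) u \<bullet> E (g -` {d}) u))"
    by (simp add: power2_norm_eq_inner simple_integral_def inner_sum_left inner_sum_right sum_distrib_left mult.assoc)
       (simp add: inner_commute)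
  also have "\<dots> = (\<Sum>c\<in>range g. \<Sum>d\<in>range g. if d = c then c\<^sup>2 * (norm (E (g -` {c}) u))\<^sup>2 else 0)"
  proof (intro sum.cong refl)
    fix c d
    have "E (g -` {c}) u \<bullet> E (g -` {d}) u = E (g -` {d}) (E (g -` {c}) u) \<bullet> u"
      using g u by (simp add: E_sym E_mem simple_fibre)
    also have "\<dots> = (if d = c then (norm (E (g -` {c}) u))\<^sup>2 else 0)"
    proof (cases "d = c")
      case False
      then have "g -` {d} \<inter> g -` {c} = {}" by auto
      then show ?thesis using E_disjoint[of "g -` {d}" "g -` {c}" u] g u False by (simp add: simple_fibre)
    qed (use g u in \<open>simp add: E_idem E_inner_self simple_fibre\<close>)
    finally show "c * d * (E (g -` {c}) u \<bullet> E (g -` {d}) u) = (if d = c then c\<^sup>2 * (norm (E (g -` {c}) u))\<^sup>2 else 0)"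
      by (auto simp: power2_eq_square)
  qed
  also have "\<dots> = (\<Sum>c\<in>range g. c\<^sup>2 * (norm (E (g -` {c}) u))\<^sup>2)"
    using simple_range[OF g] by simp
  also have "\<dots> = (LINT t|\<mu> u. (g t)\<^sup>2)" by (rule integral_simple(2)[OF g u, symmetric])
  finally show ?thesis .
qed

lemma simple_measurable: "simple_function borel g \<Longrightarrow> g \<in> borel_measurable (\<mu> u)"
  using borel_measurable_simple_function[of borel g] measurable_cong_sets[OF sets_\<mu> refl, of u borel] by blast

section \<open>Integrals of unbounded functions\<close>

lemma tendsto_approx_L2:
  assumes f: "f \<in> borel_measurable borel" and u: "u \<in> H" and int: "integrable (\<mu> u) (\<lambda>t. (f t)\<^sup>2)"
  shows "(\<lambda>n. LINT t|\<mu> u. (approx f n t - f t)\<^sup>2) \<longlonglongrightarrow> 0"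
proof -
  have meas: "f \<in> borel_measurable (\<mu> u)" "approx f n \<in> borel_measurable (\<mu> u)" for n
    using f simple_measurable[OF simple_approx[OF f]] by auto
  have "(\<lambda>n. LINT t|\<mu> u. (approx f n t - f t)\<^sup>2) \<longlonglongrightarrow> (LINT t|\<mu> u. 0)"
  proof (rule integral_dominated_convergence)
    show "integrable (\<mu> u) (\<lambda>t. 9 * (f t)\<^sup>2)" using int by simp
    show "AE t in \<mu> u. (\<lambda>n. (approx f n t - f t)\<^sup>2) \<longlonglongrightarrow> 0"
      using LIM_zero[OF approx_tendsto[OF f]] by simp
    show "AE t in \<mu> u. norm ((approx f n t - f t)\<^sup>2) \<le> 9 * (f t)\<^sup>2" for n
    proof (intro always_eventually allI)
      fix t
      have "\<bar>approx f n t - f t\<bar> \<le> 3 * \<bar>f t\<bar>" using approx_bound[OF f, of n t] by linarith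
      then have "\<bar>approx f n t - f t\<bar>\<^sup>2 \<le> (3 * \<bar>f t\<bar>)\<^sup>2" by (intro power_mono) auto
      then show "norm ((approx f n t - f t)\<^sup>2) \<le> 9 * (f t)\<^sup>2" by (simp add: power_mult_distrib)
    qed
  qed (use meas in measurable)
  then show ?thesis by simp
qed

lemma dist_simple_integral:
  assumes f: "f \<in> borel_measurable borel" and u: "u \<in> H" and int: "integrable (\<mu> u) (\<lambda>t. (f t)\<^sup>2)"
    and g: "simple_function borel g" and h: "simple_function borel h"
  shows "(norm (simple_integral g u - simple_integral h u))\<^sup>2
    \<le> 2 * (LINT t|\<mu> u. (g t - f t)\<^sup>2) + 2 * (LINT t|\<mu> u. (h t - f t)\<^sup>2)"
proof -
  have k: "simple_function borel (\<lambda>t. g t - h t)" using g h by (rule simple_function_diff)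
  have ig: "integrable (\<mu> u) (\<lambda>t. (g t - f t)\<^sup>2)" if "simple_function borel g" for g
    using f that integral_simple(1)[OF that u, of power2] int
    by (intro integrable_diff_square) (auto simp: simple_measurable)
  have "(norm (simple_integral g u - simple_integral h u))\<^sup>2 = (LINT t|\<mu> u. (g t - h t)\<^sup>2)"
    using norm_simple_integral[OF k u] simple_integral_add(2)[OF g h u] by simp
  also have "\<dots> \<le> (LINT t|\<mu> u. 2 * (g t - f t)\<^sup>2 + 2 * (h t - f t)\<^sup>2)"
  proof (rule integral_mono)
    show "integrable (\<mu> u) (\<lambda>t. (g t - h t)\<^sup>2)" using integral_simple(1)[OF k u, of power2] by simp
    show "integrable (\<mu> u) (\<lambda>t. 2 * (g t - f t)\<^sup>2 + 2 * (h t - f t)\<^sup>2)" using ig g h by simp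
    fix t
    have "0 \<le> ((g t - f t) + (h t - f t))\<^sup>2" by simp
    then show "(g t - h t)\<^sup>2 \<le> 2 * (g t - f t)\<^sup>2 + 2 * (h t - f t)\<^sup>2"
      by (simp add: power2_eq_square algebra_simps)
  qed
  also have "\<dots> = 2 * (LINT t|\<mu> u. (g t - f t)\<^sup>2) + 2 * (LINT t|\<mu> u. (h t - f t)\<^sup>2)"
    using ig g h by simp
  finally show ?thesis .
qed

text \<open>Two sequences with the same limit in L2(\<mu> u) are close to each other there, hence so
  are their integrals by the isometry. The existentially quantified sequence in
  \<open>spectral_integral\<close> may therefore always be replaced by
  \<open>approx f\<close>.\<close>

lemma simple_integral_tendsto_unique:
  assumes f: "f \<in> borel_measurable borel" and u: "u \<in> H" and int: "integrable (\<mu> u) (\<lambda>t. (f t)\<^sup>2)"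
    and g: "\<And>n. simple_function borel (g n)" "(\<lambda>n. LINT t|\<mu> u. (g n t - f t)\<^sup>2) \<longlonglongrightarrow> 0"
    and h: "\<And>n. simple_function borel (h n)" "(\<lambda>n. LINT t|\<mu> u. (h n t - f t)\<^sup>2) \<longlonglongrightarrow> 0"
    and w: "(\<lambda>n. simple_integral (g n) u) \<longlonglongrightarrow> w"
  shows "(\<lambda>n. simple_integral (h n) u) \<longlonglongrightarrow> w"
proof -
  have "(\<lambda>n. (norm (simple_integral (h n) u - simple_integral (g n) u))\<^sup>2) \<longlonglongrightarrow> 0"
  proof (rule tendsto_sandwich[OF _ _ tendsto_const])
    show "\<forall>\<^sub>F n in sequentially. (norm (simple_integral (h n) u - simple_integral (g n) u))\<^sup>2
        \<le> 2 * (LINT t|\<mu> u. (h n t - f t)\<^sup>2) + 2 * (LINT t|\<mu> u. (g n t - f t)\<^sup>2)"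
      by (intro always_eventually allI dist_simple_integral f u int g h)
    show "(\<lambda>n. 2 * (LINT t|\<mu> u. (h n t - f t)\<^sup>2) + 2 * (LINT t|\<mu> u. (g n t - f t)\<^sup>2)) \<longlonglongrightarrow> 0"
      using tendsto_add[OF tendsto_mult[OF tendsto_const h(2)] tendsto_mult[OF tendsto_const g(2)], of 2 2] by simp
  qed simp
  then have "(\<lambda>n. simple_integral (h n) u - simple_integral (g n) u) \<longlonglongrightarrow> 0"
    by (simp add: tendsto_norm_zero_iff)
  from tendsto_add[OF this w] show ?thesis by simp
qed

text \<open>Fatou: the integrals of the squared approximants are squared norms of a convergent
  sequence, hence their limit inferior is finite. So convergence along \<open>approx f\<close> alone
  decides membership in the domain.\<close>

lemma integrable_square_if_bounded:
  assumes f: "f \<in> borel_measurable borel" and u: "u \<in> H"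
    and lim: "(\<lambda>n. simple_integral (approx f n) u) \<longlonglongrightarrow> w"
  shows "integrable (\<mu> u) (\<lambda>t. (f t)\<^sup>2)"
proof (rule integrableI_nonneg)
  have "(\<integral>\<^sup>+ t. ennreal ((f t)\<^sup>2) \<partial>\<mu> u) = (\<integral>\<^sup>+ t. liminf (\<lambda>n. ennreal ((approx f n t)\<^sup>2)) \<partial>\<mu> u)"
  proof (rule nn_integral_cong)
    fix t
    have "(\<lambda>n. ennreal ((approx f n t)\<^sup>2)) \<longlonglongrightarrow> ennreal ((f t)\<^sup>2)"
      by (intro tendsto_ennrealI tendsto_power approx_tendsto f)
    then show "ennreal ((f t)\<^sup>2) = liminf (\<lambda>n. ennreal ((approx f n t)\<^sup>2))"
      by (intro lim_imp_Liminf[symmetric]) auto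
  qed
  also have "\<dots> \<le> liminf (\<lambda>n. \<integral>\<^sup>+ t. ennreal ((approx f n t)\<^sup>2) \<partial>\<mu> u)"
    using simple_measurable[OF simple_approx[OF f]] by (intro nn_integral_liminf) auto
  also have "(\<lambda>n. \<integral>\<^sup>+ t. ennreal ((approx f n t)\<^sup>2) \<partial>\<mu> u) = (\<lambda>n. ennreal ((norm (simple_integral (approx f n) u))\<^sup>2))"
    using integral_simple(1)[OF simple_approx[OF f] u, of power2]
    by (auto simp: norm_simple_integral simple_approx f u nn_integral_eq_integral)
  also have "liminf (\<lambda>n. ennreal ((norm (simple_integral (approx f n) u))\<^sup>2)) = ennreal ((norm w)\<^sup>2)"
    by (intro lim_imp_Liminf tendsto_ennrealI tendsto_intros lim) auto
  finally show "(\<integral>\<^sup>+ t. ennreal ((f t)\<^sup>2) \<partial>\<mu> u) < \<infinity>" by (simp add: le_less_trans)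
qed (use f in auto)

text \<open>The working description of the graph: the simple functions do not vary with the vector,
  and square integrability is a consequence of convergence. Linearity and symmetry thereby reduce to
  limits of the simple case.\<close>

lemma spectral_integral_iff:
  assumes f: "f \<in> borel_measurable borel"
  shows "(u, w) \<in> spectral_integral H E f
    \<longleftrightarrow> u \<in> H \<and> (\<lambda>n. simple_integral (approx f n) u) \<longlonglongrightarrow> w"
proof (intro iffI conjI)
  assume "(u, w) \<in> spectral_integral H E f"
  then obtain g where u: "u \<in> H" and int: "integrable (\<mu> u) (\<lambda>t. (f t)\<^sup>2)"
    and g: "\<And>n::nat. simple_function borel (g n)" "(\<lambda>n. LINT t|\<mu> u. (g n t - f t)\<^sup>2) \<longlonglongrightarrow> 0"
      "(\<lambda>n. simple_integral (g n) u) \<longlonglongrightarrow> w"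
    by (auto simp: spectral_integral_def simple_integral_def)
  show "u \<in> H" by fact
  show "(\<lambda>n. simple_integral (approx f n) u) \<longlonglongrightarrow> w"
    using simple_integral_tendsto_unique[OF f u int g(1,2) simple_approx[OF f] tendsto_approx_L2[OF f u int] g(3)] .
next
  assume A: "u \<in> H \<and> (\<lambda>n. simple_integral (approx f n) u) \<longlonglongrightarrow> w"
  then have u: "u \<in> H" and w: "(\<lambda>n. simple_integral (approx f n) u) \<longlonglongrightarrow> w" by auto
  have int: "integrable (\<mu> u) (\<lambda>t. (f t)\<^sup>2)" by (rule integrable_square_if_bounded[OF f u w])
  moreover have "w \<in> H"
    using closed_sequentially[OF closed_H _ w] simple_integral_mem[OF simple_approx[OF f] u] by blast
  ultimately show "(u, w) \<in> spectral_integral H E f"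
    unfolding spectral_integral_def using u w simple_approx[OF f] tendsto_approx_L2[OF f u int]
    by (auto simp: simple_integral_def)
qed

lemma spectral_integralD:
  assumes "(u, w) \<in> spectral_integral H E f"
  shows "u \<in> H" "w \<in> H" "integrable (\<mu> u) (\<lambda>t. (f t)\<^sup>2)"
  using assms by (auto simp: spectral_integral_def)

lemma spectral_integralI:
  assumes f: "f \<in> borel_measurable borel" and int: "integrable (\<mu> u) (\<lambda>t. (f t)\<^sup>2)" and u: "u \<in> H"
    and g: "\<And>n. simple_function borel (g n)" "(\<lambda>n. LINT t|\<mu> u. (g n t - f t)\<^sup>2) \<longlonglongrightarrow> 0"
    and w: "(\<lambda>n. simple_integral (g n) u) \<longlonglongrightarrow> w"
  shows "(u, w) \<in> spectral_integral H E f"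
  using simple_integral_tendsto_unique[OF f u int g simple_approx[OF f] tendsto_approx_L2[OF f u int] w] u
  by (simp add: spectral_integral_iff[OF f])

text \<open>The approximants are Cauchy in L2(\<mu> u), so their integrals are Cauchy by the
  isometry and converge by completeness.\<close>

lemma spectral_integral_ex:
  assumes f: "f \<in> borel_measurable borel" and u: "u \<in> H" and int: "integrable (\<mu> u) (\<lambda>t. (f t)\<^sup>2)"
  shows "\<exists>w. (u, w) \<in> spectral_integral H E f"
proof -
  let ?S = "\<lambda>n. simple_integral (approx f n) u"
  have "Cauchy ?S"
  proof (rule metric_CauchyI)
    fix e :: real assume "e > 0"
    then have "\<forall>\<^sub>F n in sequentially. (LINT t|\<mu> u. (approx f n t - f t)\<^sup>2) < e\<^sup>2 / 4"
      using tendsto_approx_L2[OF f u int] by (intro order_tendstoD(2)) auto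
    then obtain N where N: "\<And>n. n \<ge> N \<Longrightarrow> (LINT t|\<mu> u. (approx f n t - f t)\<^sup>2) < e\<^sup>2 / 4"
      by (auto simp: eventually_sequentially)
    have "dist (?S m) (?S n) < e" if "m \<ge> N" "n \<ge> N" for m n
    proof -
      have "(norm (?S m - ?S n))\<^sup>2 < e\<^sup>2"
        using dist_simple_integral[OF f u int simple_approx[OF f] simple_approx[OF f], of m n]
          N[OF that(1)] N[OF that(2)] by linarith
      then show ?thesis using \<open>e > 0\<close> by (simp add: dist_norm power_less_imp_less_base)
    qed
    then show "\<exists>M. \<forall>m\<ge>M. \<forall>n\<ge>M. dist (?S m) (?S n) < e" by blast
  qed
  then show ?thesis using u by (auto simp: spectral_integral_iff[OF f] Cauchy_convergent_iff convergent_def)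
qed

lemma spectral_integral_unique:
  assumes "f \<in> borel_measurable borel" "(u, w) \<in> spectral_integral H E f" "(u, w') \<in> spectral_integral H E f"
  shows "w = w'"
  using assms by (auto simp: spectral_integral_iff intro: LIMSEQ_unique)

lemma spectral_integral_add:
  assumes f: "f \<in> borel_measurable borel" and "(u, w) \<in> spectral_integral H E f" "(v, z) \<in> spectral_integral H E f"
  shows "(u + v, w + z) \<in> spectral_integral H E f"
  using assms by (auto simp: spectral_integral_iff simple_integral_add_arg simple_approx H_mem intro: tendsto_add)

lemma spectral_integral_scale:
  assumes f: "f \<in> borel_measurable borel" and "(u, w) \<in> spectral_integral H E f"
  shows "(c *\<^sub>R u, c *\<^sub>R w) \<in> spectral_integral H E f"
  using assms by (auto simp: spectral_integral_iff simple_integral_scale_arg simple_approx H_mem intro: tendsto_scaleR)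

lemma spectral_integral_diff:
  assumes f: "f \<in> borel_measurable borel" and "(u, w) \<in> spectral_integral H E f" "(v, z) \<in> spectral_integral H E f"
  shows "(u - v, w - z) \<in> spectral_integral H E f"
  using spectral_integral_add[OF f assms(2) spectral_integral_scale[OF f assms(3), of "-1"]] by simp

lemma spectral_integral_sym:
  assumes f: "f \<in> borel_measurable borel" and "(u, w) \<in> spectral_integral H E f" "(v, z) \<in> spectral_integral H E f"
  shows "w \<bullet> v = u \<bullet> z"
proof (rule LIMSEQ_unique)
  have *: "u \<in> H" "v \<in> H" "(\<lambda>n. simple_integral (approx f n) u) \<longlonglongrightarrow> w" "(\<lambda>n. simple_integral (approx f n) v) \<longlonglongrightarrow> z"
    using assms by (auto simp: spectral_integral_iff)
  show "(\<lambda>n. simple_integral (approx f n) u \<bullet> v) \<longlonglongrightarrow> w \<bullet> v" by (intro tendsto_intros *)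
  have "(\<lambda>n. u \<bullet> simple_integral (approx f n) v) \<longlonglongrightarrow> u \<bullet> z" by (intro tendsto_intros *)
  then show "(\<lambda>n. simple_integral (approx f n) u \<bullet> v) \<longlonglongrightarrow> u \<bullet> z"
    using * f by (simp add: simple_integral_sym simple_approx)
qed

lemma norm_spectral_integral:
  assumes f: "f \<in> borel_measurable borel" and uw: "(u, w) \<in> spectral_integral H E f"
  shows "(norm w)\<^sup>2 = (LINT t|\<mu> u. (f t)\<^sup>2)"
proof (rule LIMSEQ_unique)
  note D = spectral_integralD[OF uw]
  have lim: "(\<lambda>n. simple_integral (approx f n) u) \<longlonglongrightarrow> w"
    using uw by (simp add: spectral_integral_iff f)
  show "(\<lambda>n. (norm (simple_integral (approx f n) u))\<^sup>2) \<longlonglongrightarrow> (norm w)\<^sup>2"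
    by (intro tendsto_intros lim)
  have meas: "f \<in> borel_measurable (\<mu> u)" "approx f n \<in> borel_measurable (\<mu> u)" for n
    using f simple_measurable[OF simple_approx[OF f]] by auto
  have "(\<lambda>n. LINT t|\<mu> u. (approx f n t)\<^sup>2) \<longlonglongrightarrow> (LINT t|\<mu> u. (f t)\<^sup>2)"
  proof (rule integral_dominated_convergence)
    show "integrable (\<mu> u) (\<lambda>t. 4 * (f t)\<^sup>2)" using D by simp
    show "AE t in \<mu> u. (\<lambda>n. (approx f n t)\<^sup>2) \<longlonglongrightarrow> (f t)\<^sup>2"
      using tendsto_power[OF approx_tendsto[OF f]] by simp
    show "AE t in \<mu> u. norm ((approx f n t)\<^sup>2) \<le> 4 * (f t)\<^sup>2" for n
    proof (intro always_eventually allI)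
      fix t
      have "\<bar>approx f n t\<bar>\<^sup>2 \<le> (2 * \<bar>f t\<bar>)\<^sup>2" using approx_bound[OF f, of n t] by (intro power_mono) auto
      then show "norm ((approx f n t)\<^sup>2) \<le> 4 * (f t)\<^sup>2" by (simp add: power_mult_distrib)
    qed
  qed (use meas in measurable)
  then show "(\<lambda>n. (norm (simple_integral (approx f n) u))\<^sup>2) \<longlonglongrightarrow> (LINT t|\<mu> u. (f t)\<^sup>2)"
    using D(1) f by (simp add: norm_simple_integral simple_approx)
qed

lemma inner_spectral_integral:
  assumes f: "f \<in> borel_measurable borel" and uw: "(u, w) \<in> spectral_integral H E f"
  shows "integrable (\<mu> u) f" "w \<bullet> u = (LINT t|\<mu> u. f t)"
proof -
  note D = spectral_integralD[OF uw]
  interpret finite_measure "\<mu> u" using D(1) by (rule finite_measure_\<mu>)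
  have meas: "f \<in> borel_measurable (\<mu> u)" "approx f n \<in> borel_measurable (\<mu> u)" for n
    using f simple_measurable[OF simple_approx[OF f]] by auto
  show int: "integrable (\<mu> u) f"
  proof (rule Bochner_Integration.integrable_bound)
    show "integrable (\<mu> u) (\<lambda>t. 1 + (f t)\<^sup>2)" using D(3) by simp
    have "\<bar>x\<bar> \<le> 1 + x\<^sup>2" for x :: real
    proof -
      have "0 \<le> (\<bar>x\<bar> - 1)\<^sup>2" by simp
      then have "2 * \<bar>x\<bar> \<le> 1 + x\<^sup>2" by (simp add: power2_diff)
      then show ?thesis by linarith
    qed
    then show "AE t in \<mu> u. norm (f t) \<le> norm (1 + (f t)\<^sup>2)" by simp
  qed (use meas in measurable)
  show "w \<bullet> u = (LINT t|\<mu> u. f t)"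
  proof (rule LIMSEQ_unique)
    show "(\<lambda>n. simple_integral (approx f n) u \<bullet> u) \<longlonglongrightarrow> w \<bullet> u"
      using uw by (intro tendsto_intros) (simp add: spectral_integral_iff f)
    have "(\<lambda>n. LINT t|\<mu> u. approx f n t) \<longlonglongrightarrow> (LINT t|\<mu> u. f t)"
    proof (rule integral_dominated_convergence)
      show "integrable (\<mu> u) (\<lambda>t. 2 * \<bar>f t\<bar>)" using int by simp
    qed (use meas approx_tendsto[OF f] approx_bound[OF f] in auto)
    moreover have "simple_integral (approx f n) u \<bullet> u = (LINT t|\<mu> u. approx f n t)" for n
      using integral_simple(2)[OF simple_approx[OF f] D(1), of "\<lambda>x. x" n] D(1) simple_fibre[OF simple_approx[OF f]]
      by (simp add: simple_integral_def inner_sum_left E_inner_self)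
    ultimately show "(\<lambda>n. simple_integral (approx f n) u \<bullet> u) \<longlonglongrightarrow> (LINT t|\<mu> u. f t)" by simp
  qed
qed

text \<open>A continuous projection commuting with simple integrals can be moved onto the integrand
  or onto the vector. The first version computes scalar measures of values, the second truncates
  vectors within the domain.\<close>

lemma E_spectral_integral:
  assumes f: "f \<in> borel_measurable borel" and uw: "(u, w) \<in> spectral_integral H E f" and B: "B \<in> sets borel"
  shows "(u, E B w) \<in> spectral_integral H E (\<lambda>t. indicator B t * f t)"
    and "(E B u, E B w) \<in> spectral_integral H E f"
proof -
  note D = spectral_integralD[OF uw]
  have w: "(\<lambda>n. simple_integral (approx f n) u) \<longlonglongrightarrow> w"
    using uw by (simp add: spectral_integral_iff f)
  have "(\<lambda>n. E B (simple_integral (approx f n) u)) \<longlonglongrightarrow> E B w"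
    using B D w by (intro E_tendsto simple_integral_mem simple_approx f)
  then show "(E B u, E B w) \<in> spectral_integral H E f"
    using B D(1) by (simp add: spectral_integral_iff f E_simple_integral simple_approx E_mem)
  have meas: "f \<in> borel_measurable (\<mu> u)" "approx f n \<in> borel_measurable (\<mu> u)" for n
    using f simple_measurable[OF simple_approx[OF f]] by auto
  have ind: "(indicator B t * x)\<^sup>2 = x\<^sup>2 * indicator B t" for t x :: real
    by (auto simp: indicator_def)
  show "(u, E B w) \<in> spectral_integral H E (\<lambda>t. indicator B t * f t)"
  proof (rule spectral_integralI)
    show "(\<lambda>t. indicator B t * f t) \<in> borel_measurable borel" using f B by simp
    show "integrable (\<mu> u) (\<lambda>t. (indicator B t * f t)\<^sup>2)"
      using D(3) B by (simp add: ind integrable_real_mult_indicator)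
    show "simple_function borel (\<lambda>t. indicator B t * approx f n t)" for n
      using B by (intro simple_function_mult simple_function_indicator simple_approx f) auto
    show "(\<lambda>n. LINT t|\<mu> u. (indicator B t * approx f n t - indicator B t * f t)\<^sup>2) \<longlonglongrightarrow> 0"
    proof (rule tendsto_sandwich[OF _ _ tendsto_const tendsto_approx_L2[OF f D(1,3)]])
      show "\<forall>\<^sub>F n in sequentially. (LINT t|\<mu> u. (indicator B t * approx f n t - indicator B t * f t)\<^sup>2)
          \<le> (LINT t|\<mu> u. (approx f n t - f t)\<^sup>2)"
      proof (intro always_eventually allI integral_mono')
        show "integrable (\<mu> u) (\<lambda>t. (approx f n t - f t)\<^sup>2)" for n
          using integral_simple(1)[OF simple_approx[OF f] D(1), of power2] D(3) meas
          by (intro integrable_diff_square) auto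
      qed (auto simp: indicator_def)
    qed simp
    show "(\<lambda>n. simple_integral (\<lambda>t. indicator B t * approx f n t) u) \<longlonglongrightarrow> E B w"
      using \<open>(\<lambda>n. E B (simple_integral (approx f n) u)) \<longlonglongrightarrow> E B w\<close> D(1) B f
      by (simp add: E_simple_integral simple_approx)
  qed fact
qed

section \<open>Change of measure and composition of integrals\<close>

text \<open>\<open>E B w\<close> is the integral of \<open>f\<close> cut off to \<open>B\<close>,
  and the norm formula evaluates its square as the integral of f^2 over \<open>B\<close>.\<close>

lemma scalar_measure_spectral_integral:
  assumes f: "f \<in> borel_measurable borel" and uw: "(u, w) \<in> spectral_integral H E f"
  shows "\<mu> w = density (\<mu> u) (\<lambda>t. ennreal ((f t)\<^sup>2))"
proof (rule measure_eqI)
  note D = spectral_integralD[OF uw]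
  fix B assume "B \<in> sets (\<mu> w)"
  then have B: "B \<in> sets borel" by simp
  note * = E_spectral_integral(1)[OF f uw B]
  have ind: "(indicator B t * x)\<^sup>2 = x\<^sup>2 * indicator B t" for t x :: real
    by (auto simp: indicator_def)
  have "emeasure (\<mu> w) B = ennreal (LINT t|\<mu> u. (indicator B t * f t)\<^sup>2)"
    using D B f norm_spectral_integral[OF _ *] by (simp add: emeasure_\<mu>)
  also have "\<dots> = (\<integral>\<^sup>+ t. ennreal ((indicator B t * f t)\<^sup>2) \<partial>\<mu> u)"
    using spectral_integralD(3)[OF *] by (simp add: nn_integral_eq_integral)
  also have "\<dots> = emeasure (density (\<mu> u) (\<lambda>t. ennreal ((f t)\<^sup>2))) B"
    using f B by (subst emeasure_density) (auto simp: ind ennreal_mult' ennreal_indicator)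
  finally show "emeasure (\<mu> w) B = emeasure (density (\<mu> u) (\<lambda>t. ennreal ((f t)\<^sup>2))) B" .
qed simp

lemma spectral_integral_add_fun:
  assumes f: "f \<in> borel_measurable borel" and g: "g \<in> borel_measurable borel"
    and uw: "(u, w) \<in> spectral_integral H E f" and uz: "(u, z) \<in> spectral_integral H E g"
  shows "(u, w + z) \<in> spectral_integral H E (\<lambda>t. f t + g t)"
proof (rule spectral_integralI)
  note D = spectral_integralD[OF uw] spectral_integralD[OF uz]
  have meas: "h \<in> borel_measurable (\<mu> u)" "approx h n \<in> borel_measurable (\<mu> u)"
    if "h \<in> borel_measurable borel" for h n
    using that simple_measurable[OF simple_approx[OF that]] by auto
  have int: "integrable (\<mu> u) (\<lambda>t. (approx h n t - h t)\<^sup>2)"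
    if "h \<in> borel_measurable borel" "integrable (\<mu> u) (\<lambda>t. (h t)\<^sup>2)" for h n
    using integral_simple(1)[OF simple_approx[OF that(1)] D(1), of power2] that(2) meas[OF that(1)]
    by (intro integrable_diff_square) auto
  show "(\<lambda>t. f t + g t) \<in> borel_measurable borel" using f g by simp
  show "integrable (\<mu> u) (\<lambda>t. (f t + g t)\<^sup>2)"
    using integrable_diff_square[of "\<lambda>t. - g t" "\<mu> u" f] f g D by simp
  show "simple_function borel (\<lambda>t. approx f n t + approx g n t)" for n
    by (intro simple_function_add simple_approx f g)
  show "(\<lambda>n. LINT t|\<mu> u. ((approx f n t + approx g n t) - (f t + g t))\<^sup>2) \<longlonglongrightarrow> 0"
  proof (rule tendsto_sandwich[OF _ _ tendsto_const])
    show "(\<lambda>n. 2 * (LINT t|\<mu> u. (approx f n t - f t)\<^sup>2) + 2 * (LINT t|\<mu> u. (approx g n t - g t)\<^sup>2)) \<longlonglongrightarrow> 0"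
      using tendsto_add[OF tendsto_mult[OF tendsto_const tendsto_approx_L2[OF f D(1,3)]]
          tendsto_mult[OF tendsto_const tendsto_approx_L2[OF g D(1,6)]], of 2 2] by simp
    show "\<forall>\<^sub>F n in sequentially. (LINT t|\<mu> u. ((approx f n t + approx g n t) - (f t + g t))\<^sup>2)
        \<le> 2 * (LINT t|\<mu> u. (approx f n t - f t)\<^sup>2) + 2 * (LINT t|\<mu> u. (approx g n t - g t)\<^sup>2)"
    proof (intro always_eventually allI)
      fix n
      have "(LINT t|\<mu> u. ((approx f n t + approx g n t) - (f t + g t))\<^sup>2)
          \<le> (LINT t|\<mu> u. 2 * (approx f n t - f t)\<^sup>2 + 2 * (approx g n t - g t)\<^sup>2)"
      proof (rule integral_mono')
        show "integrable (\<mu> u) (\<lambda>t. 2 * (approx f n t - f t)\<^sup>2 + 2 * (approx g n t - g t)\<^sup>2)"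
          using int f g D by simp
        fix t
        have "0 \<le> ((approx f n t - f t) - (approx g n t - g t))\<^sup>2" by simp
        then show "((approx f n t + approx g n t) - (f t + g t))\<^sup>2 \<le> 2 * (approx f n t - f t)\<^sup>2 + 2 * (approx g n t - g t)\<^sup>2"
          by (simp add: power2_eq_square algebra_simps)
      qed simp
      also have "\<dots> = 2 * (LINT t|\<mu> u. (approx f n t - f t)\<^sup>2) + 2 * (LINT t|\<mu> u. (approx g n t - g t)\<^sup>2)"
        using int f g D by simp
      finally show "(LINT t|\<mu> u. ((approx f n t + approx g n t) - (f t + g t))\<^sup>2)
        \<le> 2 * (LINT t|\<mu> u. (approx f n t - f t)\<^sup>2) + 2 * (LINT t|\<mu> u. (approx g n t - g t)\<^sup>2)" .
    qed
  qed simp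
  show "(\<lambda>n. simple_integral (\<lambda>t. approx f n t + approx g n t) u) \<longlonglongrightarrow> w + z"
    using uw uz f g by (auto simp: spectral_integral_iff simple_integral_add simple_approx intro: tendsto_add)
  show "u \<in> H" by fact
qed

lemma spectral_integral_scale_fun:
  assumes f: "f \<in> borel_measurable borel" and uw: "(u, w) \<in> spectral_integral H E f"
  shows "(u, c *\<^sub>R w) \<in> spectral_integral H E (\<lambda>t. c * f t)"
proof (rule spectral_integralI)
  note D = spectral_integralD[OF uw]
  show "integrable (\<mu> u) (\<lambda>t. (c * f t)\<^sup>2)" using D by (simp add: power_mult_distrib)
  show "simple_function borel (\<lambda>t. c * approx f n t)" for n
    by (intro simple_function_mult simple_approx f) auto
  have "(LINT t|\<mu> u. (c * approx f n t - c * f t)\<^sup>2) = c\<^sup>2 * (LINT t|\<mu> u. (approx f n t - f t)\<^sup>2)" for n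
    by (simp flip: right_diff_distrib add: power_mult_distrib)
  then show "(\<lambda>n. LINT t|\<mu> u. (c * approx f n t - c * f t)\<^sup>2) \<longlonglongrightarrow> 0"
    using tendsto_mult[OF tendsto_const tendsto_approx_L2[OF f D(1,3)], of "c\<^sup>2"] by simp
  show "(\<lambda>n. simple_integral (\<lambda>t. c * approx f n t) u) \<longlonglongrightarrow> c *\<^sub>R w"
    using uw by (auto simp: spectral_integral_iff[OF f] simple_integral_scale simple_approx f intro: tendsto_scaleR)
qed (use f spectral_integralD[OF uw] in auto)

lemma spectral_integral_simple:
  assumes g: "simple_function borel g" and u: "u \<in> H"
  shows "(u, simple_integral g u) \<in> spectral_integral H E g"
  using integral_simple(1)[OF g u, of power2] borel_measurable_simple_function[OF g] g u
  by (intro spectral_integralI[where g="\<lambda>n. g"]) auto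

text \<open>The composition rule for a simple outer function, assembled from indicators by linearity
  in the integrand.\<close>

lemma spectral_integral_mult_simple:
  assumes f: "f \<in> borel_measurable borel" and uw: "(u, w) \<in> spectral_integral H E f" and g: "simple_function borel g"
  shows "(u, simple_integral g w) \<in> spectral_integral H E (\<lambda>t. g t * f t)"
proof -
  note D = spectral_integralD[OF uw]
  have 0: "(u, 0) \<in> spectral_integral H E (\<lambda>t. 0)"
    using spectral_integral_scale_fun[OF f uw, of 0] by simp
  have "(u, \<Sum>c\<in>C. c *\<^sub>R E (g -` {c}) w) \<in> spectral_integral H E (\<lambda>t. \<Sum>c\<in>C. c * (indicator (g -` {c}) t * f t))"
    if "finite C" for C
    using that
  proof induction
    case (insert c C)
    have "(u, c *\<^sub>R E (g -` {c}) w) \<in> spectral_integral H E (\<lambda>t. c * (indicator (g -` {c}) t * f t))"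
      using f g uw by (intro spectral_integral_scale_fun E_spectral_integral borel_measurable_times
          borel_measurable_indicator simple_fibre)
    from spectral_integral_add_fun[OF _ _ this insert(3)] show ?case
      using insert f simple_fibre[OF g] by simp
  qed (simp add: 0)
  from this[OF simple_range[OF g]]
  have "(u, simple_integral g w) \<in> spectral_integral H E (\<lambda>t. \<Sum>c\<in>range g. c * (indicator (g -` {c}) t * f t))"
    by (simp add: simple_integral_def)
  moreover have "(\<Sum>c\<in>range g. c * (indicator (g -` {c}) t * f t)) = g t * f t" for t
  proof -
    have "(\<Sum>c\<in>range g. c * (indicator (g -` {c}) t * f t)) = (\<Sum>c\<in>range g. if c = g t then c * f t else 0)"
      by (intro sum.cong) (auto simp: indicator_def)
    then show ?thesis using simple_range[OF g] by simp
  qed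
  ultimately show ?thesis by simp
qed

text \<open>The density formula for \<open>\<mu> w\<close> shows that both sides impose the same
  integrability condition. The values agree because the integral of \<open>approx h n\<close> at
  \<open>w\<close> differs from that of h f at \<open>u\<close> by a vector whose squared norm is
  the integral of (approx h n - h)^2 against \<open>\<mu> w\<close>, which tends to 0.\<close>

theorem spectral_integral_comp:
  assumes f: "f \<in> borel_measurable borel" and h: "h \<in> borel_measurable borel"
    and uw: "(u, w) \<in> spectral_integral H E f"
  shows "(w, z) \<in> spectral_integral H E h \<longleftrightarrow> (u, z) \<in> spectral_integral H E (\<lambda>t. h t * f t)"
proof -
  note D = spectral_integralD[OF uw]
  have hf: "(\<lambda>t. h t * f t) \<in> borel_measurable borel" using f h by simp
  have change: "integrable (\<mu> w) k \<longleftrightarrow> integrable (\<mu> u) (\<lambda>t. (f t)\<^sup>2 * k t)"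
       "(LINT t|\<mu> w. k t) = (LINT t|\<mu> u. (f t)\<^sup>2 * k t)"
    if "k \<in> borel_measurable borel" for k
    using that f by (simp_all add: scalar_measure_spectral_integral[OF f uw] integrable_density integral_density)
  have iff: "integrable (\<mu> w) (\<lambda>t. (h t)\<^sup>2) \<longleftrightarrow> integrable (\<mu> u) (\<lambda>t. (h t * f t)\<^sup>2)"
    using h by (subst change) (auto simp: power_mult_distrib mult.commute)
  have value_eq: "z = z'"
    if z: "(w, z) \<in> spectral_integral H E h" and z': "(u, z') \<in> spectral_integral H E (\<lambda>t. h t * f t)" for z z'
  proof -
    note Dz = spectral_integralD[OF z]
    have "(norm (simple_integral (approx h n) w - z'))\<^sup>2 = (LINT t|\<mu> w. (approx h n t - h t)\<^sup>2)" for n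
    proof -
      have meas: "approx h n \<in> borel_measurable borel"
        using borel_measurable_simple_function[OF simple_approx[OF h]] .
      have "(u, simple_integral (approx h n) w + (- 1) *\<^sub>R z')
          \<in> spectral_integral H E (\<lambda>t. approx h n t * f t + (- 1) * (h t * f t))"
        using f h meas
        by (intro spectral_integral_add_fun spectral_integral_mult_simple spectral_integral_scale_fun uw z' simple_approx) auto
      then have "(norm (simple_integral (approx h n) w - z'))\<^sup>2 = (LINT t|\<mu> u. (approx h n t * f t + (- 1) * (h t * f t))\<^sup>2)"
        using f h meas by (subst norm_spectral_integral[symmetric]) (auto simp: algebra_simps)
      also have "\<dots> = (LINT t|\<mu> u. (f t)\<^sup>2 * (approx h n t - h t)\<^sup>2)"
        by (intro Bochner_Integration.integral_cong) (auto simp: power2_eq_square algebra_simps)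
      also have "\<dots> = (LINT t|\<mu> w. (approx h n t - h t)\<^sup>2)"
        using meas h by (simp add: change)
      finally show ?thesis .
    qed
    then have "(\<lambda>n. (norm (simple_integral (approx h n) w - z'))\<^sup>2) \<longlonglongrightarrow> 0"
      using tendsto_approx_L2[OF h Dz(1,3)] by simp
    then have "(\<lambda>n. simple_integral (approx h n) w - z') \<longlonglongrightarrow> 0" by (simp add: tendsto_norm_zero_iff)
    then have "(\<lambda>n. simple_integral (approx h n) w) \<longlonglongrightarrow> z'" by (simp add: LIM_zero_iff)
    then show ?thesis using z by (auto simp: spectral_integral_iff h intro: LIMSEQ_unique)
  qed
  show ?thesis
  proof
    assume z: "(w, z) \<in> spectral_integral H E h"
    then obtain z' where "(u, z') \<in> spectral_integral H E (\<lambda>t. h t * f t)"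
      using spectral_integral_ex[OF hf D(1)] spectral_integralD(3) iff by blast
    then show "(u, z) \<in> spectral_integral H E (\<lambda>t. h t * f t)" using value_eq[OF z] by blast
  next
    assume z: "(u, z) \<in> spectral_integral H E (\<lambda>t. h t * f t)"
    then obtain z' where "(w, z') \<in> spectral_integral H E h"
      using spectral_integral_ex[OF h D(2)] spectral_integralD(3) iff by blast
    then show "(w, z) \<in> spectral_integral H E h" using value_eq[OF _ z] by blast
  qed
qed

lemma spectral_integral_cong_AE:
  assumes "f \<in> borel_measurable borel" "g \<in> borel_measurable borel" "AE t in \<mu> u. f t = g t"
  shows "(u, w) \<in> spectral_integral H E f \<longleftrightarrow> (u, w) \<in> spectral_integral H E g"
proof -
  have "integrable (\<mu> u) (\<lambda>t. (f t)\<^sup>2) \<longleftrightarrow> integrable (\<mu> u) (\<lambda>t. (g t)\<^sup>2)"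
    using assms by (intro integrable_cong_AE) auto
  moreover have "(LINT t|\<mu> u. (h t - f t)\<^sup>2) = (LINT t|\<mu> u. (h t - g t)\<^sup>2)" if "simple_function borel h" for h
    using assms simple_measurable[OF that] by (intro integral_cong_AE) auto
  ultimately show ?thesis unfolding spectral_integral_def by (auto cong: conj_cong)
qed

section \<open>Truncation to bounded sets\<close>

lemma spectral_integral_on_bounded:
  assumes f: "f \<in> borel_measurable borel" and B: "B \<in> sets borel" and u: "u \<in> H"
    and bound: "\<And>t. t \<in> B \<Longrightarrow> \<bar>f t\<bar> \<le> C"
  shows "\<exists>w. (E B u, w) \<in> spectral_integral H E f"
proof (rule spectral_integral_ex[OF f E_mem[OF B u]])
  interpret finite_measure "\<mu> (E B u)" using B u by (intro finite_measure_\<mu> E_mem)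
  have "emeasure (\<mu> (E B u)) (- B) = 0" using B u by (simp add: emeasure_\<mu>_E)
  then have "AE t in \<mu> (E B u). t \<in> B"
    using B by (intro AE_I[of _ _ "- B"]) auto
  then have bd: "AE t in \<mu> (E B u). norm ((f t)\<^sup>2) \<le> C\<^sup>2"
    by eventually_elim (use bound in \<open>auto intro!: abs_le_square_iff[THEN iffD1] order_trans[OF bound abs_ge_self]\<close>)
  show "integrable (\<mu> (E B u)) (\<lambda>t. (f t)\<^sup>2)"
    by (rule integrable_const_bound[OF bd]) (use f in auto)
qed

lemma E_exhaustion_tendsto:
  assumes u: "u \<in> H" shows "(\<lambda>n. E {- real n..real n} u) \<longlonglongrightarrow> u"
proof -
  interpret finite_measure "\<mu> u" using u by (rule finite_measure_\<mu>)
  have "(\<lambda>n. measure (\<mu> u) (- {- real n..real n})) \<longlonglongrightarrow> measure (\<mu> u) (\<Inter>n. - {- real n..real n})"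
    by (intro finite_Lim_measure_decseq) (auto simp: decseq_def)
  also have "(\<Inter>n. - {- real n..real n}) = {}"
  proof safe
    fix t assume "t \<in> (\<Inter>n. - {- real n..real n})"
    moreover obtain n where "\<bar>t\<bar> \<le> real n" using real_arch_simple by blast
    then have "- real n \<le> t" "t \<le> real n" by auto
    ultimately show "t \<in> {}" by auto
  qed
  finally have "(\<lambda>n. measure (\<mu> u) (- {- real n..real n})) \<longlonglongrightarrow> 0" by simp
  moreover have "measure (\<mu> u) (- {- real n..real n}) = (norm (E {- real n..real n} u - u))\<^sup>2" for n
  proof -
    have "E {- real n..real n} u + E (- {- real n..real n}) u = u"
      using E_Un[of "{- real n..real n}" "- {- real n..real n}" u] u by (simp add: E_UNIV)
    then have "E {- real n..real n} u - u = - E (- {- real n..real n}) u" by (simp add: algebra_simps)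
    then show ?thesis using u by (simp add: measure_\<mu>)
  qed
  ultimately have "(\<lambda>n. E {- real n..real n} u - u) \<longlonglongrightarrow> 0" by (simp add: tendsto_norm_zero_iff)
  then show ?thesis by (simp add: LIM_zero_iff)
qed

end

section \<open>The square root of the operator of a coercive form\<close>

lemma powr_half_square: "1 \<le> (t::real) \<Longrightarrow> (t powr (1/2))\<^sup>2 = t"
  by (simp add: powr_half_sqrt)

lemma powr_half_mult:
  assumes "1 \<le> (t::real)" shows "t powr (1/2) * t powr (-1/2) = 1" "t powr (-1/2) * t powr (1/2) = 1"
proof -
  show "t powr (1/2) * t powr (-1/2) = 1" using assms by (subst powr_add[symmetric]) simp
  then show "t powr (-1/2) * t powr (1/2) = 1" by (simp only: mult.commute)
qed

lemma measurable_powr: "(\<lambda>t. t powr c) \<in> (borel_measurable borel :: (real \<Rightarrow> real) set)"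
  by measurable

text \<open>\<open>dense\<close> is density of \<open>V\<close> in \<open>H\<close> expressed
  through the orthogonal complement. The coercivity constant is 1 because the fractional form
  contains the L2 inner product as a summand.\<close>

locale coercive_form = hilbert_form V a
  for V :: "'h::{real_inner,banach} set" and a +
  fixes H :: "'h set"
  assumes closed_H: "closed H" and subspace_H: "subspace H" and V_subset: "V \<subseteq> H"
    and coercive: "u \<in> V \<Longrightarrow> u \<bullet> u \<le> a u u"
    and dense: "\<lbrakk>f \<in> H; \<And>v. v \<in> V \<Longrightarrow> f \<bullet> v = 0\<rbrakk> \<Longrightarrow> f = 0"
begin

abbreviation "A \<equiv> form_operator H V a"

lemma A_iff: "(u, f) \<in> A \<longleftrightarrow> u \<in> V \<and> f \<in> H \<and> (\<forall>v\<in>V. a u v = f \<bullet> v)"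
  by (simp add: form_operator_def)

text \<open>Coercivity bounds the functional v |-> f . v by the form, and
  \<open>Riesz_representation\<close> for the form represents it.\<close>

lemma A_surj:
  assumes f: "f \<in> H" shows "\<exists>u. (u, f) \<in> A"
proof -
  have "(f \<bullet> u)\<^sup>2 \<le> (f \<bullet> f) * a u u" if "u \<in> V" for u
    using Cauchy_Schwarz_ineq[of f u] mult_left_mono[OF coercive[OF that], of "f \<bullet> f"] by simp
  then have "\<exists>w\<in>V. \<forall>v\<in>V. a w v = f \<bullet> v"
    by (intro Riesz_representation[where C="f \<bullet> f"]) (auto simp: inner_add_right)
  then show ?thesis using f by (auto simp: A_iff)
qed


lemma tendsto_if_form_tendsto:
  assumes "\<And>n. X n \<in> V" "x \<in> V" "(\<lambda>n::nat. a (X n - x) (X n - x)) \<longlonglongrightarrow> 0"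
  shows "X \<longlonglongrightarrow> x"
proof -
  have "(\<lambda>n. (norm (X n - x))\<^sup>2) \<longlonglongrightarrow> 0"
  proof (rule tendsto_sandwich[OF _ _ tendsto_const assms(3)])
    show "\<forall>\<^sub>F n in sequentially. (norm (X n - x))\<^sup>2 \<le> a (X n - x) (X n - x)"
      using assms unfolding power2_norm_eq_inner by (intro always_eventually allI coercive mem)
  qed simp
  then have "(\<lambda>n. X n - x) \<longlonglongrightarrow> 0" by (simp add: tendsto_norm_zero_iff)
  then show ?thesis by (simp add: LIM_zero_iff)
qed

end

text \<open>\<open>E\<close> is any resolution of the form operator, so the results apply to
  whichever one \<open>spectral_resolution\<close> selects.\<close>

locale resolved_form = coercive_form V a H + projection_valued_measure H E
  for V a and H :: "'h::{real_inner,banach} set" and E +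
  assumes resolution: "spectral_integral H E (\<lambda>t. t) = form_operator H V a"
begin

abbreviation "T \<equiv> spectral_integral H E (\<lambda>t. t powr (1/2))"
abbreviation "R \<equiv> spectral_integral H E (\<lambda>t. t powr (-1/2))"

lemma E_exhaustion_A:
  assumes "u \<in> H" shows "\<exists>f. (E {- real n..real n} u, f) \<in> A"
proof -
  have "(\<lambda>t. t) \<in> (borel_measurable borel :: (real \<Rightarrow> real) set)" by (rule measurable_ident_sets[OF refl])
  moreover have "\<bar>t\<bar> \<le> real n" if "t \<in> {- real n..real n}" for t using that by auto
  moreover have "{- real n..real n} \<in> sets borel" by simp
  ultimately show ?thesis
    unfolding resolution[symmetric] using assms by (intro spectral_integral_on_bounded)
qed

text \<open>For u = E {..<1} v, coercivity says that the integral of t against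
  \<open>\<mu> u\<close> is at least the total mass, while t < 1 holds almost everywhere. Both are
  possible only for mass zero.\<close>

lemma E_below_one_A:
  assumes "(v, w) \<in> A" shows "E {..<1} v = 0"
proof -
  let ?u = "E {..<1} v" and ?f = "E {..<1} w"
  have uf: "(?u, ?f) \<in> spectral_integral H E (\<lambda>t. t)"
    using assms by (intro E_spectral_integral(2)) (auto simp: resolution)
  note D = spectral_integralD[OF uf]
  have v: "v \<in> H" using assms V_subset by (auto simp: A_iff)
  interpret finite_measure "\<mu> ?u" using D(1) by (rule finite_measure_\<mu>)
  have int: "integrable (\<mu> ?u) (\<lambda>t. t)" and inner: "?f \<bullet> ?u = (LINT t|\<mu> ?u. t)"
    by (rule inner_spectral_integral[OF _ uf]; simp)+
  have "emeasure (\<mu> ?u) {1..} = 0" 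
  proof -
    have "{1..} \<inter> {..<1::real} = {}" by auto
    then show ?thesis using v by (simp add: emeasure_\<mu>_E)
  qed
  then have lt: "AE t in \<mu> ?u. t < 1" by (intro AE_I[of _ _ "{1..}"]) auto
  have "?u \<bullet> ?u \<le> ?f \<bullet> ?u" using uf coercive[of ?u] by (auto simp: resolution A_iff)
  moreover have "?u \<bullet> ?u = measure (\<mu> ?u) UNIV"
    using D(1) by (simp add: measure_\<mu> E_UNIV power2_norm_eq_inner)
  ultimately have "(LINT t|\<mu> ?u. 1 - t) \<le> 0"
    using int by (simp add: inner)
  moreover have "0 \<le> (LINT t|\<mu> ?u. 1 - t)" using lt by (intro integral_nonneg_AE) auto
  ultimately have "AE t in \<mu> ?u. 1 - t = 0"
    using int lt by (subst integral_nonneg_eq_0_iff_AE[symmetric]) auto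
  with lt have "AE t in \<mu> ?u. False" by eventually_elim simp
  then have "emeasure (\<mu> ?u) UNIV = 0" by (simp add: AE_iff_null null_sets_def)
  then show ?thesis using D(1) by (simp add: emeasure_\<mu> E_UNIV)
qed

text \<open>\<open>E_below_one_A\<close> reaches only the domain of \<open>A\<close>. The
  truncations to [-n, n] lie there and converge to \<open>u\<close>, and \<open>E {..<1}\<close> is
  continuous.\<close>

lemma AE_ge_one:
  assumes u: "u \<in> H" shows "AE t in \<mu> u. 1 \<le> t"
proof -
  have "E {..<1} (E {- real n..real n} u) = 0" for n
    using E_exhaustion_A[OF u, of n] E_below_one_A by blast
  then have "(\<lambda>n. 0) \<longlonglongrightarrow> E {..<1} u"
    using E_tendsto[OF _ _ u E_exhaustion_tendsto[OF u], of "{..<1}"] u by (simp add: E_mem)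
  then have "E {..<1} u = 0" by (simp add: LIMSEQ_const_iff)
  then have "emeasure (\<mu> u) {..<1} = 0" using u by (simp add: emeasure_\<mu>)
  then show ?thesis by (intro AE_I[of _ _ "{..<1}"]) auto
qed

lemma T_unique: "(u, w) \<in> T \<Longrightarrow> (u, w') \<in> T \<Longrightarrow> w = w'"
  by (rule spectral_integral_unique[OF measurable_powr])

lemma R_unique: "(u, w) \<in> R \<Longrightarrow> (u, w') \<in> R \<Longrightarrow> w = w'"
  by (rule spectral_integral_unique[OF measurable_powr])

lemma spectral_integral_one: "u \<in> H \<Longrightarrow> (u, u) \<in> spectral_integral H E (\<lambda>t. 1)"
  using spectral_integral_simple[of "\<lambda>t. 1" u] by (simp add: simple_integral_def vimage_def E_UNIV)

lemma T_of_A: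
  assumes uf: "(u, f) \<in> A" and uw: "(u, w) \<in> T" shows "(norm w)\<^sup>2 = a u u"
proof -
  have uf': "(u, f) \<in> spectral_integral H E (\<lambda>t. t)" using uf by (simp add: resolution)
  have u: "u \<in> H" using uw by (rule spectral_integralD)
  have "(norm w)\<^sup>2 = (LINT t|\<mu> u. (t powr (1/2))\<^sup>2)"
    by (rule norm_spectral_integral[OF measurable_powr uw])
  also have "\<dots> = (LINT t|\<mu> u. t)"
    using AE_ge_one[OF u] by (intro integral_cong_AE) (auto elim!: eventually_mono simp: powr_half_square)
  also have "\<dots> = f \<bullet> u" by (rule inner_spectral_integral(2)[OF measurable_ident_sets[OF refl] uf', symmetric])
  also have "\<dots> = a u u" using uf by (auto simp: A_iff)
  finally show ?thesis .
qed

text \<open>Square integrability of t^(1/2) amounts to integrability of t, which on a finite measure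
  follows from the square integrability of t.\<close>

lemma A_in_dom_T:
  assumes uf: "(u, f) \<in> A" shows "\<exists>w. (u, w) \<in> T"
proof (rule spectral_integral_ex[OF measurable_powr])
  have uf': "(u, f) \<in> spectral_integral H E (\<lambda>t. t)" using uf by (simp add: resolution)
  show u: "u \<in> H" using uf' by (rule spectral_integralD)
  have "integrable (\<mu> u) (\<lambda>t. (t powr (1/2))\<^sup>2) \<longleftrightarrow> integrable (\<mu> u) (\<lambda>t. t)"
    using AE_ge_one[OF u] by (intro integrable_cong_AE) (auto elim!: eventually_mono simp: powr_half_square)
  then show "integrable (\<mu> u) (\<lambda>t. (t powr (1/2))\<^sup>2)" using inner_spectral_integral(1)[OF measurable_ident_sets[OF refl] uf'] by blast
qed

text \<open>The truncations \<open>E [-n, n] u\<close> lie in the domain of \<open>A\<close>, where \<open>\<parallel>T u\<parallel>\<^sup>2 = a u u\<close> is known, and form a Cauchy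
  sequence for \<open>a\<close>.\<close>

lemma T_dom:
  assumes uw: "(u, w) \<in> T" shows "u \<in> V" "(norm w)\<^sup>2 = a u u"
proof -
  define X where "X n = E {- real n..real n} u" for n
  define Y where "Y n = E {- real n..real n} w" for n
  note D = spectral_integralD[OF uw]
  have XY: "(X n, Y n) \<in> T" for n
    unfolding X_def Y_def by (intro E_spectral_integral(2) measurable_powr uw) auto
  have "\<forall>n. \<exists>f. (X n, f) \<in> A" unfolding X_def using E_exhaustion_A[OF D(1)] by blast
  then obtain F where F: "\<And>n. (X n, F n) \<in> A" by metis
  then have XV: "X n \<in> V" for n by (auto simp: A_iff)
  have X: "X \<longlonglongrightarrow> u" and Y: "Y \<longlonglongrightarrow> w"
    unfolding X_def Y_def using E_exhaustion_tendsto D by auto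
  have diff: "a (X m - X n) (X m - X n) = (norm (Y m - Y n))\<^sup>2" for m n
  proof (rule T_of_A[symmetric])
    show "(X m - X n, F m - F n) \<in> A"
      unfolding resolution[symmetric]
      by (rule spectral_integral_diff) (use F in \<open>auto simp: resolution\<close>)
    show "(X m - X n, Y m - Y n) \<in> T" by (rule spectral_integral_diff[OF measurable_powr XY XY])
  qed
  have "\<exists>x\<in>V. (\<lambda>n. a (X n - x) (X n - x)) \<longlonglongrightarrow> 0"
  proof (rule complete[OF XV])
    fix e :: real assume "e > 0"
    then have "sqrt e > 0" by simp
    then obtain N where N: "\<And>m n. m \<ge> N \<Longrightarrow> n \<ge> N \<Longrightarrow> dist (Y m) (Y n) < sqrt e"
      using metric_CauchyD[OF LIMSEQ_imp_Cauchy[OF Y]] by meson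
    have "(norm (Y m - Y n))\<^sup>2 < e" if "m \<ge> N" "n \<ge> N" for m n
      using N[OF that] \<open>e > 0\<close> power_strict_mono[of "norm (Y m - Y n)" "sqrt e" 2] by (simp add: dist_norm)
    then show "\<exists>N. \<forall>m\<ge>N. \<forall>n\<ge>N. a (X m - X n) (X m - X n) < e" unfolding diff by blast
  qed
  then obtain x where x: "x \<in> V" "(\<lambda>n. a (X n - x) (X n - x)) \<longlonglongrightarrow> 0" by blast
  \<comment> \<open>By coercivity, convergence in the form implies convergence in norm, which
    identifies the form limit with the norm limit \<open>u\<close>.\<close>
  have "x = u" using tendsto_if_form_tendsto[OF XV x] X by (rule LIMSEQ_unique)
  with x show "u \<in> V" by simp
  have "(\<lambda>n. a (X n) (X n)) \<longlonglongrightarrow> a u u"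
    using tendsto_form_diag[OF XV x] by (simp add: \<open>x = u\<close>)
  moreover have "a (X n) (X n) = (norm (Y n))\<^sup>2" for n using T_of_A[OF F XY] by simp
  ultimately have "(\<lambda>n. (norm (Y n))\<^sup>2) \<longlonglongrightarrow> a u u" by simp
  moreover have "(\<lambda>n. (norm (Y n))\<^sup>2) \<longlonglongrightarrow> (norm w)\<^sup>2" by (intro tendsto_intros Y)
  ultimately show "(norm w)\<^sup>2 = a u u" by (rule LIMSEQ_unique[symmetric])
qed

text \<open>Polarisation of the norm identity in \<open>T_dom\<close>.\<close>

lemma T_inner:
  assumes "(u, w) \<in> T" "(v, z) \<in> T" shows "w \<bullet> z = a u v"
proof -
  have "(w + z) \<bullet> (w + z) = a (u + v) (u + v)"
    using T_dom(2)[OF spectral_integral_add[OF measurable_powr assms]] by (simp add: power2_norm_eq_inner)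
  then show ?thesis
    using T_dom[OF assms(1)] T_dom[OF assms(2)] sym[of u v]
    by (simp add: power2_norm_eq_inner inner_add_left inner_add_right bilinear mem inner_commute)
qed

text \<open>The composition rule turns the two powers into their product, and this product equals 1
  on t >= 1, where every scalar measure is concentrated.\<close>

lemma R_iff_T: "(z, u) \<in> R \<longleftrightarrow> (u, z) \<in> T"
proof
  assume zu: "(z, u) \<in> R"
  then have z: "z \<in> H" by (rule spectral_integralD)
  have "(z, z) \<in> spectral_integral H E (\<lambda>t. t powr (1/2) * t powr (-1/2)) \<longleftrightarrow> (z, z) \<in> spectral_integral H E (\<lambda>t. 1)"
    using AE_ge_one[OF z] by (intro spectral_integral_cong_AE measurable_powr borel_measurable_times borel_measurable_const)
       (auto elim!: eventually_mono simp only: powr_half_mult)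
  then show "(u, z) \<in> T"
    using spectral_integral_comp[OF measurable_powr measurable_powr zu] spectral_integral_one[OF z] by simp
next
  assume uz: "(u, z) \<in> T"
  then have u: "u \<in> H" by (rule spectral_integralD)
  have "(u, u) \<in> spectral_integral H E (\<lambda>t. t powr (-1/2) * t powr (1/2)) \<longleftrightarrow> (u, u) \<in> spectral_integral H E (\<lambda>t. 1)"
    using AE_ge_one[OF u] by (intro spectral_integral_cong_AE measurable_powr borel_measurable_times borel_measurable_const)
       (auto elim!: eventually_mono simp only: powr_half_mult)
  then show "(z, u) \<in> R"
    using spectral_integral_comp[OF measurable_powr measurable_powr uz] spectral_integral_one[OF u] by simp
qed

text \<open>On t >= 1 the function t^(-1/2) is bounded by 1, and the scalar measure is
  finite.\<close>

lemma R_total: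
  assumes z: "z \<in> H" shows "\<exists>u. (z, u) \<in> R"
proof (rule spectral_integral_ex[OF measurable_powr z])
  interpret finite_measure "\<mu> z" using z by (rule finite_measure_\<mu>)
  show "integrable (\<mu> z) (\<lambda>t. (t powr (-1/2))\<^sup>2)"
  proof (rule integrable_const_bound)
    show "AE t in \<mu> z. norm ((t powr (-1/2))\<^sup>2) \<le> 1"
      using AE_ge_one[OF z]
    proof eventually_elim
      fix t :: real assume "1 \<le> t"
      then have "t powr (-1/2) \<le> t powr 0" by (intro powr_mono) auto
      then show "norm ((t powr (-1/2))\<^sup>2) \<le> 1" using \<open>1 \<le> t\<close> by (simp add: power_le_one)
    qed
  qed simp
qed

lemma T_total:
  assumes v: "v \<in> V" shows "\<exists>z. (v, z) \<in> T"
proof -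
  interpret H: hilbert_form H "(\<bullet>)" using closed_H subspace_H by (rule hilbert_form_inner)
  obtain r where r: "\<And>z. z \<in> H \<Longrightarrow> (z, r z) \<in> R" using R_total by metis
  have rT: "(r z, z) \<in> T" if "z \<in> H" for z using r[OF that] by (simp only: R_iff_T)
  have rV: "r z \<in> V" if "z \<in> H" for z using T_dom(1)[OF rT[OF that]] .
  have "\<exists>w\<in>H. \<forall>z\<in>H. w \<bullet> z = a (r z) v"
  proof (rule H.Riesz_representation)
    show "0 \<le> a v v" using v by (rule nonneg)
    fix y z assume yz: "y \<in> H" "z \<in> H"
    have "r (y + z) = r y + r z"
      using yz by (intro R_unique[OF r spectral_integral_add[OF measurable_powr r r]] H.add_mem)
    then show "a (r (y + z)) v = a (r y) v + a (r z) v" using yz rV v by (simp add: add_left)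
  next
    fix c z assume z: "z \<in> H"
    have "r (c *\<^sub>R z) = c *\<^sub>R r z"
      using z by (intro R_unique[OF r spectral_integral_scale[OF measurable_powr r]] H.scale_mem)
    then show "a (r (c *\<^sub>R z)) v = c * a (r z) v" using z rV v by (simp add: scale_left)
  next
    fix z assume z: "z \<in> H"
    show "(a (r z) v)\<^sup>2 \<le> a v v * (z \<bullet> z)"
      using Cauchy_Schwarz[OF rV[OF z] v] T_dom(2)[OF rT[OF z]] by (simp add: power2_norm_eq_inner mult.commute)
  qed
  then obtain z0 where z0: "z0 \<in> H" "\<And>z. z \<in> H \<Longrightarrow> z0 \<bullet> z = a (r z) v" by blast
  have d: "v - r z0 \<in> V" using v rV z0 by (intro mem)
  \<comment> \<open>The defect d = v - r z0 is tested against its own preimage \<open>x\<close>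
    under \<open>A\<close>: d . d = a x d. Since x = r y for some \<open>y\<close>, both
    \<open>a x v\<close> and \<open>a x (r z0)\<close> equal y . z0.\<close>
  obtain x where x: "(x, v - r z0) \<in> A" using A_surj d V_subset by blast
  then obtain y where y: "(x, y) \<in> T" using A_in_dom_T by blast
  then have "y \<in> H" and "r y = x" using spectral_integralD(2) R_unique r R_iff_T by blast+
  have xV: "x \<in> V" using x by (simp add: A_iff)
  have "(v - r z0) \<bullet> (v - r z0) = a x (v - r z0)" using x d by (simp add: A_iff)
  also have "\<dots> = a x v - a x (r z0)" using v rV z0 xV by (simp add: diff_right)
  also have "\<dots> = 0"
    using T_inner[OF y rT[OF z0(1)]] z0(2)[OF \<open>y \<in> H\<close>] \<open>r y = x\<close> by (simp add: inner_commute)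
  finally have "v = r z0" by simp
  then show ?thesis using rT[OF z0(1)] by auto
qed

theorem square_root_isometry:
  "single_valued T \<and> Domain T = V \<and>
   isometric_isomorphism V (\<lambda>u. sqrt (a u u)) H norm (op_app T) \<and>
   R = T\<inverse> \<and> single_valued R \<and> Domain R = H \<and>
   bounded_linear_between H norm V (\<lambda>u. sqrt (a u u)) (op_app R) \<and>
   (\<forall>u\<in>V. op_app R (op_app T u) = u) \<and>
   (\<forall>z\<in>H. op_app T (op_app R z) = z) \<and>
   (\<forall>z\<in>H. \<exists>!u. u \<in> V \<and> z = op_app T u) \<and>
   (\<forall>u\<in>V. \<forall>v\<in>V. op_app T u \<bullet> op_app T v = a u v)"
proof -
  have appT: "op_app T u = w" if "(u, w) \<in> T" for u w
    unfolding op_app_def using that T_unique by blast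
  have appR: "op_app R u = w" if "(u, w) \<in> R" for u w
    unfolding op_app_def using that R_unique by blast
  have Tapp: "(u, op_app T u) \<in> T" if "u \<in> V" for u using T_total[OF that] appT by auto
  have Rapp: "(z, op_app R z) \<in> R" if "z \<in> H" for z using R_total[OF that] appR by auto
  have T_H: "op_app T u \<in> H" if "u \<in> V" for u using Tapp[OF that] by (rule spectral_integralD)
  have R_V: "op_app R z \<in> V" if "z \<in> H" for z using Rapp[OF that] unfolding R_iff_T by (rule T_dom(1))
  have RT: "op_app R (op_app T u) = u" if "u \<in> V" for u using Tapp[OF that] by (intro appR) (simp only: R_iff_T)
  have TR: "op_app T (op_app R z) = z" if "z \<in> H" for z using Rapp[OF that] by (intro appT) (simp only: R_iff_T)
  have inner: "op_app T u \<bullet> op_app T v = a u v" if "u \<in> V" "v \<in> V" for u v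
    using that by (intro T_inner Tapp)
  have norm: "norm (op_app T u) = sqrt (a u u)" if "u \<in> V" for u
    using inner[OF that that] by (simp add: norm_eq_sqrt_inner)
  have linT: "linear_between V H (op_app T)"
    unfolding linear_between_def
    using T_H appT[OF spectral_integral_add[OF measurable_powr Tapp Tapp]] appT[OF spectral_integral_scale[OF measurable_powr Tapp]] by auto
  have linR: "linear_between H V (op_app R)"
    unfolding linear_between_def
    using R_V appR[OF spectral_integral_add[OF measurable_powr Rapp Rapp]] appR[OF spectral_integral_scale[OF measurable_powr Rapp]] by auto
  have "bij_betw (op_app T) V H"
    by (rule bij_betw_byWitness[of _ "op_app R"]) (use RT TR T_H R_V in auto)
  moreover have "sqrt (a (op_app R z) (op_app R z)) \<le> 1 * norm z" if "z \<in> H" for z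
    using norm[OF R_V[OF that]] TR[OF that] by simp
  moreover have "\<exists>!u. u \<in> V \<and> z = op_app T u" if "z \<in> H" for z
    using RT TR[OF that] R_V[OF that] by metis
  moreover have "Domain T = V" using T_total T_dom(1) by blast
  moreover have "Domain R = H" using R_total spectral_integralD(1) by blast
  moreover have "single_valued T" "single_valued R"
    using T_unique R_unique by (auto simp: single_valued_def)
  moreover have "R = T\<inverse>" using R_iff_T by auto
  ultimately show ?thesis
    using linT linR norm inner RT TR unfolding isometric_isomorphism_def bounded_linear_between_def by blast
qed

end

section \<open>Spectral resolution of a compactly embedded form\<close>

text \<open>Compactness of the embedding of \<open>V\<close> is expressed by finitely many functionals controlling the norm up to \<open>\<epsilon> a\<close>.\<close>

locale compact_form = coercive_form V a H
  for V a and H :: "'h::{real_inner,banach} set" +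
  assumes compactness: "e > 0 \<Longrightarrow> \<exists>F. finite F \<and> (\<forall>w\<in>V. w \<bullet> w \<le> (\<Sum>\<phi>\<in>F. (\<phi> \<bullet> w)\<^sup>2) + e * a w w)"
begin

lemma a_diff_le: "u \<in> V \<Longrightarrow> v \<in> V \<Longrightarrow> a (u - v) (u - v) \<le> 2 * a u u + 2 * a v v"
  using parallelogram[of u v] nonneg[of "u + v"] by (simp add: add_mem)

lemma form_eigenvector:
  assumes e: "(e, c *\<^sub>R e) \<in> A" and u: "u \<in> V" shows "a u e = c * (u \<bullet> e)"
proof -
  have "e \<in> V" and "a e u = (c *\<^sub>R e) \<bullet> u" using e u by (simp_all only: A_iff)
  then show ?thesis using sym[OF u] by (simp add: inner_commute)
qed

text \<open>Taking 1 / (j + 1) for the parameter in \<open>compactness\<close> involves countably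
  many functionals altogether. A diagonal subsequence makes all of them converge; differences of its
  terms then have small functional part, while their form values stay below 4 C.\<close>

lemma convergent_subsequence:
  fixes X :: "nat \<Rightarrow> 'h"
  assumes X: "\<And>n. X n \<in> V" and C: "\<And>n. a (X n) (X n) \<le> C"
  shows "\<exists>r. strict_mono r \<and> convergent (X \<circ> r)"
proof -
  have "\<forall>j. \<exists>F. finite F \<and> (\<forall>w\<in>V. w \<bullet> w \<le> (\<Sum>\<phi>\<in>F. (\<phi> \<bullet> w)\<^sup>2) + inverse (real (Suc j)) * a w w)"
    by (intro allI compactness) simp
  then obtain F where F: "\<And>j. finite (F j)"
      "\<And>j w. w \<in> V \<Longrightarrow> w \<bullet> w \<le> (\<Sum>\<phi>\<in>F j. (\<phi> \<bullet> w)\<^sup>2) + inverse (real (Suc j)) * a w w" by metis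
  \<comment> \<open>The additional \<open>0\<close> keeps the set nonempty, so that a sequence can
    enumerate it.\<close>
  define \<Phi> where "\<Phi> = insert 0 (\<Union>j. F j)"
  have "countable \<Phi>" unfolding \<Phi>_def using F(1) by (auto intro: countable_finite)
  moreover have "\<Phi> \<noteq> {}" by (simp add: \<Phi>_def)
  ultimately obtain \<phi> :: "nat \<Rightarrow> 'h" where \<phi>: "range \<phi> = \<Phi>"
    using range_from_nat_into[of \<Phi>] by metis
  interpret subseqs "\<lambda>k s. convergent (\<lambda>n. \<phi> k \<bullet> X (s n))"
  proof
    fix k and s :: "nat \<Rightarrow> nat"
    have "bounded (range (\<lambda>n. \<phi> k \<bullet> X (s n)))"
    proof (rule boundedI)
      fix y assume "y \<in> range (\<lambda>n. \<phi> k \<bullet> X (s n))"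
      then obtain n where y: "y = \<phi> k \<bullet> X (s n)" by auto
      have "\<bar>y\<bar> \<le> norm (\<phi> k) * norm (X (s n))" unfolding y by (rule Cauchy_Schwarz_ineq2)
      also have "\<dots> \<le> norm (\<phi> k) * sqrt C"
        using coercive[OF X, of "s n"] C[of "s n"]
        by (intro mult_left_mono) (auto simp: norm_eq_sqrt_inner)
      finally show "norm y \<le> norm (\<phi> k) * sqrt C" by simp
    qed
    then obtain l r where r: "strict_mono r" "((\<lambda>n. \<phi> k \<bullet> X (s n)) \<circ> r) \<longlonglongrightarrow> l"
      by (meson bounded_imp_convergent_subsequence)
    then have "convergent (\<lambda>n. \<phi> k \<bullet> X ((s \<circ> r) n))"
      unfolding convergent_def o_def by blast
    then show "\<exists>r'. strict_mono r' \<and> convergent (\<lambda>n. \<phi> k \<bullet> X ((s \<circ> r') n))"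
      using r(1) by blast
  qed
  have conv: "convergent (\<lambda>n. \<phi> k \<bullet> X (diagseq n))" for k
  proof -
    \<comment> \<open>From index k + 1 on, the diagonal sequence is a subsequence of a stage at
      which the k-th functional converges; the finitely many earlier terms do not affect
      convergence.\<close>
    have "convergent (\<lambda>n. \<phi> k \<bullet> X ((diagseq \<circ> (+) (Suc k)) n))"
    proof (rule diagseq_holds)
      fix r s :: "nat \<Rightarrow> nat" and n
      assume "strict_mono r" "convergent (\<lambda>i. \<phi> n \<bullet> X (s i))"
      then show "convergent (\<lambda>i. \<phi> n \<bullet> X ((s \<circ> r) i))"
        using convergent_subseq_convergent[of "\<lambda>i. \<phi> n \<bullet> X (s i)" r] by (simp add: o_def)
    qed
    then have "convergent (\<lambda>n. \<phi> k \<bullet> X (diagseq (n + Suc k)))" by (simp add: o_def add.commute)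
    then show ?thesis
      by (subst (asm) convergent_ignore_initial_segment[of "\<lambda>n. \<phi> k \<bullet> X (diagseq n)"])
  qed
  define Y where "Y n = X (diagseq n)" for n
  have YV: "Y n \<in> V" for n using X by (simp add: Y_def)
  have C0: "0 \<le> C" using nonneg[OF X] C[of 0] by (meson order_trans)
  have "Cauchy Y"
  proof (rule metric_CauchyI)
    fix e :: real assume e: "e > 0"
    \<comment> \<open>With this bound the form part is at most 4 C e^2 / (8 C + 2) <= e^2 / 2, and
      the denominator stays positive for C = 0. The functional part gets the other half, as 2 (e^2 /
      8) + 2 (e^2 / 8).\<close>
    then have "e\<^sup>2 / (8 * C + 2) > 0" using C0 by simp
    then obtain j where j: "inverse (real (Suc j)) < e\<^sup>2 / (8 * C + 2)" using reals_Archimedean by blast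
    define S where "S n = (\<Sum>f\<in>F j. (f \<bullet> Y n - lim (\<lambda>n. f \<bullet> Y n))\<^sup>2)" for n
    have "(\<lambda>n. (f \<bullet> Y n - lim (\<lambda>n. f \<bullet> Y n))\<^sup>2) \<longlonglongrightarrow> 0" if "f \<in> F j" for f
    proof -
      have "f \<in> \<Phi>" using that by (auto simp: \<Phi>_def)
      then obtain k where "f = \<phi> k" using \<phi> by auto
      then have "convergent (\<lambda>n. f \<bullet> Y n)" using conv by (simp add: Y_def)
      then have "(\<lambda>n. f \<bullet> Y n - lim (\<lambda>n. f \<bullet> Y n)) \<longlonglongrightarrow> 0"
        by (simp add: LIM_zero_iff convergent_LIMSEQ_iff)
      then show ?thesis by simp
    qed
    then have "S \<longlonglongrightarrow> 0" unfolding S_def by (rule tendsto_null_sum)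
    then have "\<forall>\<^sub>F n in sequentially. S n < e\<^sup>2 / 8" using e by (intro order_tendstoD(2)) auto
    then obtain N where N: "\<And>n. n \<ge> N \<Longrightarrow> S n < e\<^sup>2 / 8" by (auto simp: eventually_sequentially)
    have "dist (Y m) (Y n) < e" if mn: "m \<ge> N" "n \<ge> N" for m n
    proof -
      let ?d = "Y m - Y n"
      have "(\<Sum>f\<in>F j. (f \<bullet> ?d)\<^sup>2) \<le> (\<Sum>f\<in>F j. 2 * (f \<bullet> Y m - lim (\<lambda>n. f \<bullet> Y n))\<^sup>2 + 2 * (f \<bullet> Y n - lim (\<lambda>n. f \<bullet> Y n))\<^sup>2)"
      proof (rule sum_mono)
        fix f
        have "(x - y)\<^sup>2 \<le> 2 * (x - l)\<^sup>2 + 2 * (y - l)\<^sup>2" for x y l :: real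
        proof -
          have "0 \<le> ((x - l) + (y - l))\<^sup>2" by simp
          then show ?thesis by (simp add: power2_eq_square algebra_simps)
        qed
        then show "(f \<bullet> ?d)\<^sup>2 \<le> 2 * (f \<bullet> Y m - lim (\<lambda>n. f \<bullet> Y n))\<^sup>2 + 2 * (f \<bullet> Y n - lim (\<lambda>n. f \<bullet> Y n))\<^sup>2"
          by (simp add: inner_diff_right)
      qed
      also have "\<dots> = 2 * S m + 2 * S n" by (simp add: S_def sum.distrib sum_distrib_left)
      finally have 1: "(\<Sum>f\<in>F j. (f \<bullet> ?d)\<^sup>2) < e\<^sup>2 / 2" using N[OF mn(1)] N[OF mn(2)] by linarith
      have "a ?d ?d \<le> 4 * C" using a_diff_le[OF YV YV, of m n] C[of "diagseq m"] C[of "diagseq n"] by (simp add: Y_def)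
      then have "inverse (real (Suc j)) * a ?d ?d \<le> e\<^sup>2 / (8 * C + 2) * (4 * C)"
        using j C0 nonneg[OF diff_mem[OF YV YV]] by (intro mult_mono) auto
      also have "\<dots> \<le> e\<^sup>2 / 2" using C0 by (simp add: field_simps)
      finally have "?d \<bullet> ?d < e\<^sup>2" using 1 F(2)[OF diff_mem[OF YV YV], of m n j] by linarith
      then have "(norm ?d)\<^sup>2 < e\<^sup>2" by (simp add: power2_norm_eq_inner)
      then show ?thesis using e by (simp add: dist_norm power_less_imp_less_base)
    qed
    then show "\<exists>M. \<forall>m\<ge>M. \<forall>n\<ge>M. dist (Y m) (Y n) < e" by blast
  qed
  then have "convergent (X \<circ> diagseq)" by (simp add: Cauchy_convergent_iff Y_def[abs_def] o_def)
  then show ?thesis using subseq_diagseq by blast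
qed

text \<open>The minimiser of the Rayleigh quotient on the complement of \<open>S\<close> is an eigenvector.\<close>

lemma eigenvector_orthogonal_to:
  assumes S: "\<And>e. e \<in> S \<Longrightarrow> e \<in> V \<and> norm e = 1 \<and> (e, a e e *\<^sub>R e) \<in> A"
    and v: "v \<in> V" "v \<noteq> 0" "\<And>e. e \<in> S \<Longrightarrow> v \<bullet> e = 0"
  shows "\<exists>u\<in>V. norm u = 1 \<and> (\<forall>e\<in>S. u \<bullet> e = 0) \<and> (u, a u u *\<^sub>R u) \<in> A"
proof -
  define M where "M = {w \<in> V. \<forall>e\<in>S. w \<bullet> e = 0}"
  have M_mem: "u + w \<in> M" "u - w \<in> M" "c *\<^sub>R u \<in> M" if "u \<in> M" "w \<in> M" for u w c
    using that by (auto simp: M_def mem inner_add_left inner_diff_left)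
  have MV: "w \<in> V" if "w \<in> M" for w using that by (simp add: M_def)
  define N where "N = {w \<in> M. norm w = 1}"
  \<comment> \<open>The infimum of the Rayleigh quotient on \<open>M\<close>, which will be the
    eigenvalue; the given \<open>v\<close> ensures that it is taken over a nonempty set.\<close>
  define m where "m = (INF w\<in>N. a w w)"
  have "v /\<^sub>R norm v \<in> N" using v by (auto simp: N_def M_def mem)
  then have N_ne: "N \<noteq> {}" by auto
  have bdd: "bdd_below ((\<lambda>w. a w w) ` N)" by (rule bdd_belowI2[of _ 0]) (auto simp: N_def MV nonneg)
  have m_le: "m * (w \<bullet> w) \<le> a w w" if w: "w \<in> M" for w
  proof (cases "w = 0")
    case True then show ?thesis using nonneg[OF MV[OF w]] by simp
  next
    case False
    then have "w /\<^sub>R norm w \<in> N" using w M_mem by (auto simp: N_def)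
    then have "m \<le> a (w /\<^sub>R norm w) (w /\<^sub>R norm w)" unfolding m_def by (rule cINF_lower[OF bdd])
    also have "\<dots> = a w w / (norm w)\<^sup>2" using w by (simp add: scale_left scale_right MV mem power2_eq_square field_simps)
    finally show ?thesis using False by (simp add: power2_norm_eq_inner field_simps)
  qed
  have "\<exists>w\<in>N. a w w < m + inverse (real (Suc n))" for n
  proof (rule ccontr)
    assume "\<not> ?thesis"
    then have "m + inverse (real (Suc n)) \<le> m"
      unfolding m_def using N_ne by (intro cINF_greatest) (auto simp: not_less m_def)
    then show False by simp
  qed
  then obtain X where X: "\<And>n. X n \<in> N" "\<And>n. a (X n) (X n) < m + inverse (real (Suc n))" by metis
  have XM: "X n \<in> M" and Xn: "norm (X n) = 1" for n using X(1)[of n] by (auto simp: N_def)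
  have "a (X n) (X n) \<le> m + 1" for n
    using X(2)[of n] by (smt (verit) inverse_le_1_iff of_nat_Suc of_nat_0_le_iff)
  then obtain r where r: "strict_mono r" "convergent (X \<circ> r)"
    using convergent_subsequence[of X "m + 1", OF MV[OF XM]] by blast
  define Y where "Y n = X (r n)" for n
  obtain y where y: "Y \<longlonglongrightarrow> y" using r(2) unfolding convergent_def Y_def[abs_def] o_def by blast
  have YV: "Y n \<in> V" and YM: "Y n \<in> M" and Yn: "norm (Y n) = 1" for n by (simp_all add: Y_def XM Xn MV)
  have Ylt: "a (Y n) (Y n) < m + inverse (real (Suc n))" for n
  proof -
    have "inverse (real (Suc (r n))) \<le> inverse (real (Suc n))"
      using seq_suble[OF r(1)] by (intro le_imp_inverse_le) auto
    then show ?thesis using X(2)[of "r n"] unfolding Y_def by linarith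
  qed
  have m0: "0 \<le> m" unfolding m_def using N_ne by (intro cINF_greatest) (auto simp: N_def MV nonneg)
  \<comment> \<open>Unit vectors satisfy |Y i + Y j|^2 = 4 - |Y i - Y j|^2, and the form on sums is
    at least \<open>m\<close> times this. The parallelogram law thus upgrades norm convergence of a
    minimising sequence to convergence in the form.\<close>
  have diff: "a (Y i - Y j) (Y i - Y j) \<le> 2 * inverse (real (Suc i)) + 2 * inverse (real (Suc j)) + m * (norm (Y i - Y j))\<^sup>2" for i j
  proof -
    have nsum: "(Y i + Y j) \<bullet> (Y i + Y j) = 4 - (norm (Y i - Y j))\<^sup>2"
      using Yn[of i] Yn[of j]
      by (simp add: power2_norm_eq_inner norm_eq_1 inner_add_left inner_add_right inner_diff_left inner_diff_right inner_commute)
    have "m * (4 - (norm (Y i - Y j))\<^sup>2) \<le> a (Y i + Y j) (Y i + Y j)"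
      using m_le[OF M_mem(1)[OF YM YM], of i j] unfolding nsum .
    then have lb: "4 * m - m * (norm (Y i - Y j))\<^sup>2 \<le> a (Y i + Y j) (Y i + Y j)" by (simp add: algebra_simps)
    have "p \<le> 2 * d + 2 * e + k" if "p = 2 * b + 2 * c - q" "4 * m - k \<le> q" "b < m + d" "c < m + e"
      for b c d e p q k :: real using that by linarith
    from this[OF parallelogram[OF YV YV] lb Ylt Ylt] show ?thesis .
  qed
  have "\<exists>u\<in>V. (\<lambda>n. a (Y n - u) (Y n - u)) \<longlonglongrightarrow> 0"
  proof (rule complete[OF YV])
    fix e :: real assume e: "e > 0"
    have "\<forall>\<^sub>F n in sequentially. inverse (real (Suc n)) < e / 8"
      using e by (intro order_tendstoD(2)[OF LIMSEQ_inverse_real_of_nat]) auto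
    then obtain N1 where N1: "\<And>n. n \<ge> N1 \<Longrightarrow> inverse (real (Suc n)) < e / 8" by (auto simp: eventually_sequentially)
    define d where "d = sqrt (e / (2 * m + 2))"
    have "d > 0" using e m0 by (simp add: d_def)
    then obtain N2 where N2: "\<And>i j. i \<ge> N2 \<Longrightarrow> j \<ge> N2 \<Longrightarrow> dist (Y i) (Y j) < d"
      using metric_CauchyD[OF LIMSEQ_imp_Cauchy[OF y]] by meson
    have "a (Y i - Y j) (Y i - Y j) < e" if "i \<ge> max N1 N2" "j \<ge> max N1 N2" for i j
    proof -
      have "(norm (Y i - Y j))\<^sup>2 \<le> d\<^sup>2" using N2[of i j] that by (intro power_mono) (auto simp: dist_norm)
      then have "m * (norm (Y i - Y j))\<^sup>2 \<le> m * (e / (2 * m + 2))"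
        using m0 e by (intro mult_left_mono) (auto simp: d_def)
      also have "\<dots> \<le> e / 2" using m0 e by (simp add: field_simps)
      finally show ?thesis using diff[of i j] N1[of i] N1[of j] that by linarith
    qed
    then show "\<exists>N. \<forall>i\<ge>N. \<forall>j\<ge>N. a (Y i - Y j) (Y i - Y j) < e" by blast
  qed
  then obtain u where u: "u \<in> V" "(\<lambda>n. a (Y n - u) (Y n - u)) \<longlonglongrightarrow> 0" by blast
  have Yu: "Y \<longlonglongrightarrow> u" by (rule tendsto_if_form_tendsto[OF YV u])
  have "u \<bullet> e = 0" if "e \<in> S" for e
  proof -
    have "(\<lambda>n. Y n \<bullet> e) \<longlonglongrightarrow> u \<bullet> e" by (intro tendsto_intros Yu)
    moreover have "Y n \<bullet> e = 0" for n using YM[of n] that by (simp add: M_def)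
    ultimately show ?thesis by (simp add: LIMSEQ_const_iff)
  qed
  then have uM: "u \<in> M" using u by (simp add: M_def)
  have "(\<lambda>n. norm (Y n)) \<longlonglongrightarrow> norm u" by (intro tendsto_intros Yu)
  then have nu: "norm u = 1" by (simp add: Yn LIMSEQ_const_iff)
  then have uu: "u \<bullet> u = 1" by (simp add: norm_eq_1)
  have auu: "a u u = m"
  proof (rule antisym)
    have "(\<lambda>n. m + inverse (real (Suc n))) \<longlonglongrightarrow> m + 0"
      by (intro tendsto_intros LIMSEQ_inverse_real_of_nat)
    then show "a u u \<le> m"
      using tendsto_form_diag[OF YV u] Ylt less_imp_le by (intro LIMSEQ_le[of _ _ _ m]) auto
    show "m \<le> a u u" using m_le[OF uM] uu by simp
  qed
  \<comment> \<open>First variation of a w w - m |w|^2, which is nonnegative on \<open>M\<close> and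
    vanishes at \<open>u\<close>.\<close>
  have form_u: "a u w = m * (u \<bullet> w)" if w: "w \<in> M" for w
  proof -
    have "0 \<le> 2 * t * (a u w - m * (u \<bullet> w)) + t\<^sup>2 * (a w w - m * (w \<bullet> w))" for t
    proof -
      have "m * ((u + t *\<^sub>R w) \<bullet> (u + t *\<^sub>R w)) \<le> a (u + t *\<^sub>R w) (u + t *\<^sub>R w)"
        using uM w by (intro m_le M_mem)
      then have "m * (1 + 2 * t * (u \<bullet> w) + t\<^sup>2 * (w \<bullet> w)) \<le> m + 2 * t * a u w + t\<^sup>2 * a w w"
        using u w MV uu auu
        by (simp add: quadratic inner_add_left inner_add_right inner_commute power2_eq_square algebra_simps)
      then show ?thesis by (simp add: algebra_simps)
    qed
    then have "a u w - m * (u \<bullet> w) = 0" by (rule linear_part_zero)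
    then show ?thesis by simp
  qed
  \<comment> \<open>The eigenvalue equation is so far known only against \<open>M\<close>. The
    solution u' of A u' = m u satisfies it against all of \<open>V\<close> and turns out to lie in
    \<open>M\<close> too, so u - u' is \<open>a\<close>-orthogonal to itself and u = u'.\<close>
  have "m *\<^sub>R u \<in> H" using u V_subset mem(3) by blast
  then obtain u' where u': "(u', m *\<^sub>R u) \<in> A" using A_surj by blast
  then have u'V: "u' \<in> V" and u'a: "\<And>w. w \<in> V \<Longrightarrow> a u' w = m * (u \<bullet> w)" by (auto simp: A_iff)
  have "u' \<bullet> e = 0" if e: "e \<in> S" for e
  proof -
    have "a e e * (u' \<bullet> e) = a u' e" using form_eigenvector[of e "a e e" u'] S[OF e] u'V by simp
    also have "\<dots> = 0" using u'a[of e] S[OF e] uM e by (simp add: M_def)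
    finally have "a e e * (u' \<bullet> e) = 0" .
    moreover have "a e e \<ge> 1" using coercive[of e] S[OF e] by (simp add: norm_eq_1)
    ultimately show ?thesis by simp
  qed
  then have "u - u' \<in> M" using uM u'V by (auto simp: M_def mem inner_diff_left)
  then have "a (u - u') (u - u') = 0"
    using form_u u'a MV u u'V by (simp add: diff_left)
  then have "u = u'" using coercive[of "u - u'"] inner_ge_zero[of "u - u'"] u u'V
    by (metis diff_mem eq_iff_diff_eq_0 inner_eq_zero_iff order_antisym)
  then have "(u, a u u *\<^sub>R u) \<in> A" using u' auu by simp
  then show ?thesis using u(1) nu uM by (auto simp: M_def)
qed

text \<open>Zorn's lemma gives a maximal orthonormal set of eigenvectors, and a nonzero vector of
  \<open>V\<close> orthogonal to it would produce another one. For \<open>f\<close> in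
  \<open>H\<close> orthogonal to the set, the solution of A u = f is orthogonal too, because
  eigenvalues are nonzero; hence it is 0, and \<open>dense\<close> gives f = 0.\<close>

lemma eigenbasis:
  "\<exists>S. (\<forall>e\<in>S. e \<in> V \<and> norm e = 1 \<and> (e, a e e *\<^sub>R e) \<in> A) \<and> pairwise orthogonal S \<and>
     (\<forall>f\<in>H. (\<forall>e\<in>S. f \<bullet> e = 0) \<longrightarrow> f = 0)"
proof -
  define P where "P = {S. (\<forall>e\<in>S. e \<in> V \<and> norm e = 1 \<and> (e, a e e *\<^sub>R e) \<in> A) \<and> pairwise orthogonal S}"
  have "\<exists>S\<in>P. \<forall>X\<in>P. S \<subseteq> X \<longrightarrow> X = S"
  proof (rule subset_Zorn_nonempty)
    show "P \<noteq> {}" by (auto simp: P_def intro!: exI[of _ "{}"])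
    fix C assume C: "C \<noteq> {}" "subset.chain P C"
    have "pairwise orthogonal (\<Union>C)"
    proof (rule pairwiseI)
      fix x y assume "x \<in> \<Union>C" "y \<in> \<Union>C" "x \<noteq> y"
      then obtain X Y where XY: "X \<in> C" "Y \<in> C" "x \<in> X" "y \<in> Y" by blast
      then have "X \<subseteq> Y \<or> Y \<subseteq> X" using C(2) by (simp add: subset_chain_def)
      then obtain X where "X \<in> C" "x \<in> X" "y \<in> X" using XY by blast
      then show "orthogonal x y" using C(2) \<open>x \<noteq> y\<close> by (auto simp: P_def subset_chain_def pairwise_def)
    qed
    moreover have "e \<in> V \<and> norm e = 1 \<and> (e, a e e *\<^sub>R e) \<in> A" if "e \<in> \<Union>C" for e
      using C(2) that unfolding P_def subset_chain_def by blast
    ultimately show "\<Union>C \<in> P" by (simp add: P_def)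
  qed
  then obtain S where "S \<in> P" and max: "\<And>X. X \<in> P \<Longrightarrow> S \<subseteq> X \<Longrightarrow> X = S" by blast
  then have S: "\<And>e. e \<in> S \<Longrightarrow> e \<in> V \<and> norm e = 1 \<and> (e, a e e *\<^sub>R e) \<in> A" and orth: "pairwise orthogonal S"
    by (auto simp: P_def)
  have V0: "v = 0" if v: "v \<in> V" "\<And>e. e \<in> S \<Longrightarrow> v \<bullet> e = 0" for v
  proof (rule ccontr)
    assume "v \<noteq> 0"
    then obtain u where u: "u \<in> V" "norm u = 1" "\<forall>e\<in>S. u \<bullet> e = 0" "(u, a u u *\<^sub>R u) \<in> A"
      using eigenvector_orthogonal_to[OF S v(1) _ v(2)] by blast
    then have "insert u S \<in> P"
      using S orth by (auto simp: P_def pairwise_insert orthogonal_def inner_commute)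
    then have "u \<in> S" using max by blast
    then have "u \<bullet> u = 0" using u(3) by blast
    then show False using u(2) by simp
  qed
  have "f = 0" if f: "f \<in> H" "\<forall>e\<in>S. f \<bullet> e = 0" for f
  proof -
    obtain u where "(u, f) \<in> A" using A_surj[OF f(1)] by blast
    then have u: "u \<in> V" and uf: "\<And>v. v \<in> V \<Longrightarrow> a u v = f \<bullet> v" by (auto simp: A_iff)
    have "u \<bullet> e = 0" if e: "e \<in> S" for e
    proof -
      have "a e e * (u \<bullet> e) = a u e" using form_eigenvector[of e "a e e" u] S[OF e] u by simp
      also have "\<dots> = 0" using uf[of e] S[OF e] f(2) e by simp
      finally have "a e e * (u \<bullet> e) = 0" .
      moreover have "a e e \<ge> 1" using coercive[of e] S[OF e] by (simp add: norm_eq_1)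
      ultimately show ?thesis by simp
    qed
    then have "u = 0" by (rule V0[OF u])
    then show "f = 0" using uf by (intro dense[OF f(1)]) (simp add: zero_left)
  qed
  with S orth show ?thesis by (intro exI[of _ S] conjI ballI impI) auto
qed

end

section \<open>Diagonal spectral measures\<close>

locale orthonormal_basis =
  fixes H S :: "'h::{real_inner,banach} set"
  assumes closed_H: "closed H" and subspace_H: "subspace H" and S_subset: "S \<subseteq> H"
    and norm_S: "e \<in> S \<Longrightarrow> norm e = 1" and orthogonal_S: "pairwise orthogonal S"
    and total_S: "\<lbrakk>f \<in> H; \<And>e. e \<in> S \<Longrightarrow> f \<bullet> e = 0\<rbrakk> \<Longrightarrow> f = 0"
begin

lemma inner_S: "e \<in> S \<Longrightarrow> d \<in> S \<Longrightarrow> e \<bullet> d = (if e = d then 1 else 0)"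
  using orthogonal_S norm_S[of e] by (auto simp: pairwise_def orthogonal_def norm_eq_1)

lemma eqI: "\<lbrakk>u \<in> H; v \<in> H; \<And>e. e \<in> S \<Longrightarrow> u \<bullet> e = v \<bullet> e\<rbrakk> \<Longrightarrow> u = v"
  using total_S[of "u - v"] subspace_diff[OF subspace_H] by (simp add: inner_diff_left)

lemma norm_sum_S:
  assumes "finite F" "F \<subseteq> S" shows "(norm (\<Sum>e\<in>F. c e *\<^sub>R e))\<^sup>2 = (\<Sum>e\<in>F. (c e)\<^sup>2)"
proof -
  have "(norm (\<Sum>e\<in>F. c e *\<^sub>R e))\<^sup>2 = (\<Sum>e\<in>F. \<Sum>d\<in>F. c e * c d * (e \<bullet> d))"
    by (simp add: power2_norm_eq_inner inner_sum_left inner_sum_right sum_distrib_left mult.assoc)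
       (simp add: inner_commute)
  also have "\<dots> = (\<Sum>e\<in>F. \<Sum>d\<in>F. if e = d then (c e)\<^sup>2 else 0)"
    using assms by (intro sum.cong refl) (auto simp: inner_S subset_iff power2_eq_square)
  finally show ?thesis using assms(1) by simp
qed

lemma Bessel:
  assumes "finite F" "F \<subseteq> S" shows "(\<Sum>e\<in>F. (u \<bullet> e)\<^sup>2) \<le> u \<bullet> u"
proof -
  let ?p = "\<Sum>e\<in>F. (u \<bullet> e) *\<^sub>R e"
  have "?p \<bullet> u = (\<Sum>e\<in>F. (u \<bullet> e)\<^sup>2)" by (simp add: inner_sum_left power2_eq_square inner_commute[of u])
  moreover have "?p \<bullet> ?p = (\<Sum>e\<in>F. (u \<bullet> e)\<^sup>2)" using norm_sum_S[OF assms, of "(\<bullet>) u"] by (simp add: power2_norm_eq_inner)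
  moreover have "0 \<le> (u - ?p) \<bullet> (u - ?p)" by simp
  ultimately show ?thesis by (simp add: inner_diff_left inner_diff_right inner_commute)
qed

text \<open>For \<open>D\<close> inside \<open>S\<close>, the orthogonal projection onto the closed
  span of \<open>D\<close>. The summation is unordered because the basis from Zorn's lemma comes
  without an enumeration.\<close>

definition proj :: "'h set \<Rightarrow> 'h \<Rightarrow> 'h" where "proj D u = (\<Sum>\<^sub>\<infinity>e\<in>D. (u \<bullet> e) *\<^sub>R e)"

text \<open>Bessel's inequality bounds the finite sums of squared coefficients. A finite set nearly
  attaining their supremum leaves, by Pythagoras, only remainders of small norm, so the net of
  partial sums is Cauchy.\<close>

lemma has_sum_proj:
  assumes D: "D \<subseteq> S" shows "((\<lambda>e. (u \<bullet> e) *\<^sub>R e) has_sum proj D u) D"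
proof -
  let ?f = "\<lambda>e. (u \<bullet> e) *\<^sub>R e" and ?s = "\<lambda>F. \<Sum>e\<in>F. (u \<bullet> e)\<^sup>2"
  define s where "s = (SUP F\<in>{F. finite F \<and> F \<subseteq> D}. ?s F)"
  have bdd: "bdd_above (?s ` {F. finite F \<and> F \<subseteq> D})"
    using Bessel D by (intro bdd_aboveI2[of _ _ "u \<bullet> u"]) auto
  have "cauchy_filter (filtermap (sum ?f) (finite_subsets_at_top D))"
    unfolding cauchy_filter_metric_filtermap
  proof (intro allI impI)
    fix e :: real assume e: "e > 0"
    have "\<exists>F\<in>{F. finite F \<and> F \<subseteq> D}. s - (e/2)\<^sup>2 < ?s F"
      using e bdd unfolding s_def by (subst less_cSUP_iff[symmetric]) auto
    then obtain F0 where F0: "finite F0" "F0 \<subseteq> D" "s - (e/2)\<^sup>2 < ?s F0" by blast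
    have near: "dist (sum ?f F) (sum ?f F0) < e / 2" if F: "finite F" "F0 \<subseteq> F" "F \<subseteq> D" for F
    proof -
      have "?s F0 + ?s (F - F0) = ?s F" using F by (metis add.commute sum.subset_diff)
      moreover have "?s F \<le> s" unfolding s_def using F by (intro cSUP_upper bdd) auto
      moreover have "(norm (sum ?f (F - F0)))\<^sup>2 = ?s (F - F0)" using F D by (intro norm_sum_S) auto
      ultimately have "(norm (sum ?f (F - F0)))\<^sup>2 < (e/2)\<^sup>2" using F0(3) by linarith
      then have "norm (sum ?f (F - F0)) < e / 2" 
        by (rule power_less_imp_less_base) (use e in simp)
      moreover have "sum ?f F - sum ?f F0 = sum ?f (F - F0)" using F by (simp add: sum_diff)
      ultimately show ?thesis by (simp add: dist_norm)
    qed
    show "\<exists>P. eventually P (finite_subsets_at_top D) \<and> (\<forall>F G. P F \<and> P G \<longrightarrow> dist (sum ?f F) (sum ?f G) < e)"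
    proof (intro exI[of _ "\<lambda>F. finite F \<and> F0 \<subseteq> F \<and> F \<subseteq> D"] conjI allI impI)
      show "eventually (\<lambda>F. finite F \<and> F0 \<subseteq> F \<and> F \<subseteq> D) (finite_subsets_at_top D)"
        using F0 by (auto simp: eventually_finite_subsets_at_top)
      fix F G assume "(finite F \<and> F0 \<subseteq> F \<and> F \<subseteq> D) \<and> finite G \<and> F0 \<subseteq> G \<and> G \<subseteq> D"
      then have "dist (sum ?f F) (sum ?f F0) < e / 2" "dist (sum ?f G) (sum ?f F0) < e / 2"
        by (blast intro: near)+
      then show "dist (sum ?f F) (sum ?f G) < e" by (rule dist_triangle_half_l)
    qed
  qed
  then have "convergent_filter (filtermap (sum ?f) (finite_subsets_at_top D))" by (rule cauchy_filter_convergent)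
  then have "?f summable_on D" by (simp only: convergent_filter_iff summable_on_def has_sum_def filterlim_def)
  then show ?thesis unfolding proj_def by (rule has_sum_infsum)
qed

lemma proj_mem:
  assumes D: "D \<subseteq> S" shows "proj D u \<in> H"
proof (rule Lim_in_closed_set[OF closed_H])
  show "(sum (\<lambda>e. (u \<bullet> e) *\<^sub>R e) \<longlongrightarrow> proj D u) (finite_subsets_at_top D)"
    using has_sum_proj[OF D] by (simp add: has_sum_def)
  show "\<forall>\<^sub>F F in finite_subsets_at_top D. (\<Sum>e\<in>F. (u \<bullet> e) *\<^sub>R e) \<in> H"
    using D S_subset subspace_H
    by (intro eventually_finite_subsets_at_top_weakI subspace_sum subspace_scale) auto
qed simp

lemma proj_inner: "D \<subseteq> S \<Longrightarrow> ((\<lambda>e. (u \<bullet> e) * (e \<bullet> v)) has_sum (proj D u \<bullet> v)) D"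
  using has_sum_bounded_linear[OF bounded_linear_inner_left has_sum_proj] by simp

lemma proj_coeff:
  assumes D: "D \<subseteq> S" and e: "e \<in> S" shows "proj D u \<bullet> e = (if e \<in> D then u \<bullet> e else 0)"
proof (rule has_sum_unique[OF proj_inner[OF D]])
  show "((\<lambda>d. (u \<bullet> d) * (d \<bullet> e)) has_sum (if e \<in> D then u \<bullet> e else 0)) D"
    using D e by (intro has_sum_finite_neutralI[where B="D \<inter> {e}"]) (auto simp: inner_S subset_iff)
qed

text \<open>The coefficients along \<open>S\<close> determine a vector of \<open>H\<close>, so most
  algebraic laws are checked on coefficients. Countable additivity regroups one unordered sum, each
  basis vector being paired with the unique index \<open>n\<close> for which its value
  \<open>ev e\<close> lies in \<open>B n\<close>.\<close>

theorem diagonal_spectral_measure: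
  "spectral_measure H (\<lambda>B. proj {e \<in> S. ev e \<in> B})"
proof -
  let ?D = "\<lambda>B. {e \<in> S. ev e \<in> B}"
  have D: "?D B \<subseteq> S" for B by auto
  note mem = proj_mem[OF D] proj_mem[OF subset_refl] subspace_add[OF subspace_H] subspace_scale[OF subspace_H]
  show ?thesis
    unfolding spectral_measure_def
  proof (intro conjI ballI allI impI)
    fix B u assume u: "u \<in> H"
    show "proj (?D B) u \<in> H" by (rule mem)
    show "proj (?D B) (proj (?D B) u) = proj (?D B) u" by (rule eqI) (auto simp: mem proj_coeff)
    show "proj (?D B) (c *\<^sub>R u) = c *\<^sub>R proj (?D B) u" for c
      by (rule eqI) (auto simp: mem proj_coeff)
    fix v assume v: "v \<in> H"
    show "proj (?D B) (u + v) = proj (?D B) u + proj (?D B) v"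
      by (rule eqI) (auto simp: mem proj_coeff inner_add_left)
    have "((\<lambda>e. (u \<bullet> e) * (e \<bullet> v)) has_sum (v \<bullet> u - v \<bullet> u + proj (?D B) v \<bullet> u)) (?D B)"
      using proj_inner[OF D, of v u B] by (simp add: inner_commute mult.commute)
    then show "proj (?D B) u \<bullet> v = u \<bullet> proj (?D B) v"
      using has_sum_unique[OF proj_inner[OF D, of u v B]] by (simp add: inner_commute)
  next
    fix u assume "u \<in> H"
    then show "proj (?D UNIV) u = u" by (intro eqI) (auto simp: mem proj_coeff)
  next
    fix B :: "nat \<Rightarrow> real set" and u :: 'h assume disj: "disjoint_family B"
    let ?f = "\<lambda>e. (u \<bullet> e) *\<^sub>R e"
    have "((\<lambda>p. ?f (snd p)) has_sum proj (?D (\<Union>n. B n)) u) (Sigma UNIV (\<lambda>n. ?D (B n)))"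
    proof -
      have "inj_on snd (Sigma UNIV (\<lambda>n. ?D (B n)))"
      proof (rule inj_onI)
        fix p q assume p: "p \<in> Sigma UNIV (\<lambda>n. ?D (B n))" and q: "q \<in> Sigma UNIV (\<lambda>n. ?D (B n))" and eq: "snd p = snd q"
        then have "ev (snd p) \<in> B (fst p) \<inter> B (fst q)" by auto
        then have "fst p = fst q" using disj unfolding disjoint_family_on_def by blast
        then show "p = q" using eq by (simp add: prod_eq_iff)
      qed
      moreover have "snd ` (Sigma UNIV (\<lambda>n. ?D (B n))) = ?D (\<Union>n. B n)" by force
      ultimately show ?thesis
        using has_sum_proj[OF D, of u "\<Union>n. B n"] has_sum_reindex[of snd "Sigma UNIV (\<lambda>n. ?D (B n))" ?f]
        by (simp add: o_def)
    qed
    then have "((\<lambda>n. proj (?D (B n)) u) has_sum proj (?D (\<Union>n. B n)) u) UNIV"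
      by (rule has_sum_SigmaD) (use has_sum_proj[OF D] in simp)
    then show "(\<lambda>n. proj (?D (B n)) u) sums proj (?D (\<Union>n. B n)) u" by (rule has_sum_imp_sums)
  qed
qed

end

context compact_form
begin

text \<open>\<open>E B\<close> projects onto the eigenvectors with eigenvalue in \<open>B\<close>.
  Both \<open>A\<close> and the spectral integral of t multiply the coefficient along
  \<open>e\<close> by its eigenvalue, so only the domains have to be compared: truncation and Fatou
  give one inclusion, surjectivity of \<open>A\<close> the other.\<close>

theorem spectral_resolution_exists:
  "\<exists>E. spectral_measure H E \<and> spectral_integral H E (\<lambda>t. t) = A"
proof -
  obtain S where S': "(\<forall>e\<in>S. e \<in> V \<and> norm e = 1 \<and> (e, a e e *\<^sub>R e) \<in> A) \<and> pairwise orthogonal S \<and>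
     (\<forall>f\<in>H. (\<forall>e\<in>S. f \<bullet> e = 0) \<longrightarrow> f = 0)"
    using eigenbasis by (elim exE) (rule that)
  then have S: "\<And>e. e \<in> S \<Longrightarrow> e \<in> V \<and> norm e = 1 \<and> (e, a e e *\<^sub>R e) \<in> A" by (elim conjE) (rule bspec)
  define ev where "ev e = a e e" for e
  interpret B: orthonormal_basis H S
    by unfold_locales (use closed_H subspace_H S' V_subset in \<open>blast+\<close>)
  define E where "E = (\<lambda>B. B.proj {e \<in> S. ev e \<in> B})"
  have SM: "spectral_measure H E" unfolding E_def by (rule B.diagonal_spectral_measure)
  interpret P: projection_valued_measure H E
    using closed_H subspace_H SM by unfold_locales
  have SH: "e \<in> H" if "e \<in> S" for e using that B.S_subset by auto
  have E_e: "E B e = (if ev e \<in> B then e else 0)" if e: "e \<in> S" for B e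
    unfolding E_def using e SH[OF e] subspace_0[OF subspace_H]
    by (intro B.eqI B.proj_mem) (auto simp: B.proj_coeff B.inner_S)
  have id: "(\<lambda>t. t) \<in> (borel_measurable borel :: (real \<Rightarrow> real) set)" by (rule measurable_ident_sets[OF refl])
  have SI_e: "(e, ev e *\<^sub>R e) \<in> spectral_integral H E (\<lambda>t. t)" if e: "e \<in> S" for e
  proof -
    have "P.simple_integral (approx (\<lambda>t. t) n) e = approx (\<lambda>t. t) n (ev e) *\<^sub>R e" for n
    proof -
      let ?g = "approx (\<lambda>t. t) n"
      have "P.simple_integral ?g e = (\<Sum>c\<in>range ?g. if c = ?g (ev e) then c *\<^sub>R e else 0)"
        unfolding P.simple_integral_def using e by (intro sum.cong refl) (auto simp: E_e)
      then show ?thesis using simple_range[OF simple_approx[OF id], of n] by simp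
    qed
    then show ?thesis
      unfolding P.spectral_integral_iff[OF id] using SH[OF e] approx_tendsto[OF id]
      by (auto intro: tendsto_scaleR)
  qed
  have coeff: "w \<bullet> e = ev e * (u \<bullet> e)" if "(u, w) \<in> spectral_integral H E (\<lambda>t. t)" "e \<in> S" for u w e
    using P.spectral_integral_sym[OF id that(1) SI_e[OF that(2)]] by simp
  have coeff_A: "f \<bullet> e = ev e * (u \<bullet> e)" if uf: "(u, f) \<in> A" and e: "e \<in> S" for u f e
  proof -
    have "u \<in> V" and "a u e = f \<bullet> e" using uf S[OF e] by (simp_all only: A_iff)
    then show ?thesis using form_eigenvector[of e "a e e" u] S[OF e] by (simp add: ev_def)
  qed
  have A_SI: "(u, f) \<in> spectral_integral H E (\<lambda>t. t)" if uf: "(u, f) \<in> A" for u f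
  proof -
    have u: "u \<in> H" and f: "f \<in> H" using uf V_subset by (auto simp: A_iff)
    let ?B = "\<lambda>n. {- real n..real n}"
    \<comment> \<open>The truncated integral of t at \<open>u\<close> has the same coefficients as
      the projection of \<open>f\<close>, whence the bound by |f|^2 uniformly in
      \<open>n\<close>.\<close>
    have bound: "(\<integral>\<^sup>+ t. ennreal ((t * indicator (?B n) t)\<^sup>2) \<partial>P.\<mu> u) \<le> ennreal ((norm f)\<^sup>2)" for n
    proof -
      obtain w where w: "(E (?B n) u, w) \<in> spectral_integral H E (\<lambda>t. t)"
        using P.spectral_integral_on_bounded[OF id _ u, of "?B n" "real n"] by (auto simp: abs_le_iff)
      have "w = E (?B n) f"
      proof (rule B.eqI)
        fix e assume e: "e \<in> S"
        have "w \<bullet> e = ev e * (u \<bullet> E (?B n) e)" using coeff[OF w e] u SH[OF e] by (simp add: P.E_sym)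
        also have "\<dots> = f \<bullet> E (?B n) e" using coeff_A[OF uf e] by (simp add: E_e[OF e])
        also have "\<dots> = E (?B n) f \<bullet> e" using f SH[OF e] by (simp add: P.E_sym)
        finally show "w \<bullet> e = E (?B n) f \<bullet> e" .
      qed (use P.spectral_integralD(2)[OF w] f in \<open>auto simp: P.E_mem\<close>)
      have "(u, E (?B n) u) \<in> spectral_integral H E (indicator (?B n))"
      proof -
        have "P.simple_integral (\<lambda>t. 1) u = u"
          using u by (simp add: P.simple_integral_def vimage_def P.E_UNIV)
        then have "P.simple_integral (indicator (?B n)) u = E (?B n) u"
          using P.E_simple_integral(1)[of "\<lambda>t. 1" u "?B n"] u by simp
        then show ?thesis using P.spectral_integral_simple[of "indicator (?B n)" u] u by simp
      qed
      then have uw: "(u, w) \<in> spectral_integral H E (\<lambda>t. t * indicator (?B n) t)"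
        by (subst P.spectral_integral_comp[OF _ id, symmetric]) (use w in auto)
      have "(\<integral>\<^sup>+ t. ennreal ((t * indicator (?B n) t)\<^sup>2) \<partial>P.\<mu> u) = ennreal ((norm w)\<^sup>2)"
        using P.norm_spectral_integral[OF _ uw] P.spectral_integralD(3)[OF uw]
        by (simp add: nn_integral_eq_integral)
      then show ?thesis
        using P.E_norm_le[of "?B n" f] f \<open>w = _\<close> by (simp add: power_mono)
    qed
    have "integrable (P.\<mu> u) (\<lambda>t. t\<^sup>2)"
    proof (rule integrableI_nonneg)
      have "(\<integral>\<^sup>+ t. ennreal (t\<^sup>2) \<partial>P.\<mu> u) = (\<integral>\<^sup>+ t. liminf (\<lambda>n. ennreal ((t * indicator (?B n) t)\<^sup>2)) \<partial>P.\<mu> u)"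
      proof (rule nn_integral_cong)
        fix t :: real
        obtain N where N: "\<bar>t\<bar> \<le> real N" using real_arch_simple by blast
        have "\<forall>\<^sub>F n in sequentially. ennreal ((t * indicator (?B n) t)\<^sup>2) = ennreal (t\<^sup>2)"
          using eventually_ge_at_top[of N]
        proof eventually_elim
          fix n assume "N \<le> n"
          then have "\<bar>t\<bar> \<le> real n" using N by linarith
          then show "ennreal ((t * indicator (?B n) t)\<^sup>2) = ennreal (t\<^sup>2)" by (simp add: abs_le_iff)
        qed
        then have "(\<lambda>n. ennreal ((t * indicator (?B n) t)\<^sup>2)) \<longlonglongrightarrow> ennreal (t\<^sup>2)" by (rule tendsto_eventually)
        then show "ennreal (t\<^sup>2) = liminf (\<lambda>n. ennreal ((t * indicator (?B n) t)\<^sup>2))"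
          by (intro lim_imp_Liminf[symmetric]) auto
      qed
      also have "\<dots> \<le> liminf (\<lambda>n. \<integral>\<^sup>+ t. ennreal ((t * indicator (?B n) t)\<^sup>2) \<partial>P.\<mu> u)"
        by (intro nn_integral_liminf) measurable
      also have "\<dots> \<le> liminf (\<lambda>n. ennreal ((norm f)\<^sup>2))"
        by (intro Liminf_mono always_eventually allI bound)
      also have "\<dots> = ennreal ((norm f)\<^sup>2)" by (simp add: Liminf_const)
      finally show "(\<integral>\<^sup>+ t. ennreal (t\<^sup>2) \<partial>P.\<mu> u) < \<infinity>" by (simp add: le_less_trans)
    qed auto
    then obtain w where w: "(u, w) \<in> spectral_integral H E (\<lambda>t. t)" using P.spectral_integral_ex[OF id u] by blast
    have "w = f"
      using coeff[OF w] coeff_A[OF uf] P.spectral_integralD(2)[OF w] f by (intro B.eqI) auto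
    then show ?thesis using w by simp
  qed
  have "(u, w) \<in> A" if uw: "(u, w) \<in> spectral_integral H E (\<lambda>t. t)" for u w
  proof -
    obtain u' where u': "(u', w) \<in> A" using A_surj P.spectral_integralD(2)[OF uw] by blast
    have "u = u'"
    proof (rule B.eqI)
      show "u \<in> H" "u' \<in> H" using P.spectral_integralD(1) uw A_SI[OF u'] by blast+
      fix e assume e: "e \<in> S"
      \<comment> \<open>Nonzero eigenvalues can be cancelled, so the common image determines the
        coefficients of \<open>u\<close> and u'.\<close>
      have "ev e \<ge> 1" using coercive[of e] S[OF e] by (simp add: ev_def norm_eq_1)
      then show "u \<bullet> e = u' \<bullet> e" using coeff[OF uw e] coeff_A[OF u' e] by simp
    qed
    then show ?thesis using u' by simp
  qed
  then have "spectral_integral H E (\<lambda>t. t) = A" using A_SI by auto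
  then show ?thesis using SM by blast
qed

end

section \<open>Completeness of \<open>L2\<close>\<close>

lemma L2rel_rep: "L2rel (rep_L2 u) (rep_L2 u)"
  by (rule Quotient3_rep_reflp[OF Quotient3_L2])

lemma square_integrable_rep: "square_integrable (rep_L2 u)"
  using L2rel_rep by (auto simp: L2rel_def)

lemma rep_L2_measurable [measurable]: "rep_L2 u \<in> borel_measurable borel"
  using square_integrable_rep[of u] by (simp add: square_integrable_def)

lemma abs_rep_L2: "abs_L2 (rep_L2 u) = u"
  by (rule Quotient3_abs_rep[OF Quotient3_L2])

lemma rep_abs_L2: "square_integrable f \<Longrightarrow> AE x in lborel. rep_L2 (abs_L2 f) x = f x"
  using Quotient3_rep_abs[OF Quotient3_L2, of f] by (simp add: L2rel_def)

lemma L2_eq_iff: "u = v \<longleftrightarrow> (AE x in lborel. rep_L2 u x = rep_L2 v x)"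
  using Quotient3_rel_rep[OF Quotient3_L2, of u v] by (simp add: L2rel_def square_integrable_rep)

lemma L2_eqI:
  assumes "square_integrable f" "AE x in lborel. rep_L2 u x = f x" shows "u = abs_L2 f"
  unfolding L2_eq_iff using assms(2) rep_abs_L2[OF assms(1)] by eventually_elim simp

lemma rep_add: "AE x in lborel. rep_L2 (u + v) x = rep_L2 u x + rep_L2 v x"
  using rep_abs_L2[OF square_integrable_add[OF square_integrable_rep square_integrable_rep], of u v]
    plus_L2.abs_eq[OF L2rel_rep L2rel_rep, of u v] by (simp add: abs_rep_L2)

lemma rep_diff: "AE x in lborel. rep_L2 (u - v) x = rep_L2 u x - rep_L2 v x"
  using rep_abs_L2[OF square_integrable_diff[OF square_integrable_rep square_integrable_rep], of u v]
    minus_L2.abs_eq[OF L2rel_rep L2rel_rep, of u v] by (simp add: abs_rep_L2)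

lemma rep_scale: "AE x in lborel. rep_L2 (c *\<^sub>R u) x = c * rep_L2 u x"
  using rep_abs_L2[OF square_integrable_scale[OF square_integrable_rep], of c u]
    scaleR_L2.abs_eq[OF L2rel_rep, of c u] by (simp add: abs_rep_L2)

lemma rep_zero: "AE x in lborel. rep_L2 0 x = 0"
  using rep_abs_L2[OF square_integrable_zero] by (simp add: zero_L2.abs_eq)

lemma inner_abs_L2: "square_integrable f \<Longrightarrow> square_integrable g \<Longrightarrow> abs_L2 f \<bullet> abs_L2 g = (LINT x|lborel. f x * g x)"
  by (intro inner_L2.abs_eq) (auto simp: L2rel_def)

lemma norm_square_L2: "(norm u)\<^sup>2 = (LINT x|lborel. (rep_L2 u x)\<^sup>2)"
  unfolding power2_norm_eq_inner by (simp add: inner_L2.rep_eq power2_eq_square)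

lemma nn_integral_square_L2: "(\<integral>\<^sup>+ x. ennreal ((rep_L2 u x)\<^sup>2) \<partial>lborel) = ennreal ((norm u)\<^sup>2)"
  using square_integrable_rep[of u] by (simp add: norm_square_L2 square_integrable_def nn_integral_eq_integral)

lemma nn_integral_diff_L2: "(\<integral>\<^sup>+ x. ennreal ((rep_L2 u x - rep_L2 v x)\<^sup>2) \<partial>lborel) = ennreal ((norm (u - v))\<^sup>2)"
  unfolding nn_integral_square_L2[symmetric]
  by (rule nn_integral_cong_AE) (use rep_diff[of u v] in eventually_elim, simp)

text \<open>L2 convergence is L1 convergence of the squared differences, which yields an almost
  everywhere convergent subsequence. Conditions stated pointwise, such as vanishing outside Omega,
  pass to L2 limits in this way.\<close>

lemma tendsto_L2_AE_subseq:
  fixes X :: "nat \<Rightarrow> 'a::euclidean_space L2"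
  assumes "X \<longlonglongrightarrow> x"
  shows "\<exists>r. strict_mono r \<and> (AE y in lborel. (\<lambda>n. rep_L2 (X (r n)) y) \<longlonglongrightarrow> rep_L2 x y)"
proof -
  have int: "integrable lborel (\<lambda>y. (rep_L2 (X n) y - rep_L2 x y)\<^sup>2)" for n
    using square_integrable_diff[OF square_integrable_rep square_integrable_rep, of "X n" x]
    by (simp add: square_integrable_def)
  have "(LINT y|lborel. norm ((rep_L2 (X n) y - rep_L2 x y)\<^sup>2)) = (norm (X n - x))\<^sup>2" for n
    unfolding norm_square_L2 real_norm_def abs_power2
    by (rule integral_cong_AE) (use rep_diff[of "X n" x] in \<open>auto elim: eventually_mono\<close>)
  moreover have "(\<lambda>n. (norm (X n - x))\<^sup>2) \<longlonglongrightarrow> 0"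
    using tendsto_power[OF tendsto_norm_zero[OF LIM_zero[OF assms]], of 2] by simp
  ultimately have "(\<lambda>n. LINT y|lborel. norm ((rep_L2 (X n) y - rep_L2 x y)\<^sup>2)) \<longlonglongrightarrow> 0" by simp
  from tendsto_L1_AE_subseq[OF int this] obtain r where r: "strict_mono r"
    "AE y in lborel. (\<lambda>n. (rep_L2 (X (r n)) y - rep_L2 x y)\<^sup>2) \<longlonglongrightarrow> 0" by blast
  from r(2) have "AE y in lborel. (\<lambda>n. rep_L2 (X (r n)) y) \<longlonglongrightarrow> rep_L2 x y"
    by eventually_elim (simp add: LIM_zero_iff)
  then show ?thesis using r(1) by blast
qed

lemma Cauchy_fast_subsequence:
  fixes X :: "nat \<Rightarrow> 'a::metric_space"
  assumes "Cauchy X"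
  shows "\<exists>r. strict_mono r \<and> (\<forall>n. \<forall>m\<ge>n. dist (X (r m)) (X (r n)) < (1/2) ^ n)"
proof -
  have N: "\<exists>N. \<forall>i\<ge>N. \<forall>j\<ge>N. dist (X i) (X j) < (1/2) ^ n" for n
    using metric_CauchyD[OF assms, of "(1/2) ^ n"] by auto
  have "\<exists>r. \<forall>n. (\<forall>i\<ge>r n. \<forall>j\<ge>r n. dist (X i) (X j) < (1/2) ^ n) \<and> r n < r (Suc n)"
  proof (rule dependent_nat_choice)
    show "\<exists>k. \<forall>i\<ge>k. \<forall>j\<ge>k. dist (X i) (X j) < (1/2) ^ 0" by (rule N)
    fix k n
    obtain N' where "\<forall>i\<ge>N'. \<forall>j\<ge>N'. dist (X i) (X j) < (1/2) ^ Suc n" using N by blast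
    then show "\<exists>y. (\<forall>i\<ge>y. \<forall>j\<ge>y. dist (X i) (X j) < (1/2) ^ Suc n) \<and> k < y"
      by (intro exI[of _ "max N' (Suc k)"]) auto
  qed
  then obtain r where r: "\<And>n i j. i \<ge> r n \<Longrightarrow> j \<ge> r n \<Longrightarrow> dist (X i) (X j) < (1/2) ^ n" "\<And>n. r n < r (Suc n)" by blast
  have "strict_mono r" using r(2) by (simp add: strict_mono_Suc_iff)
  moreover have "dist (X (r m)) (X (r n)) < (1/2) ^ n" if "m \<ge> n" for m n
    using r(1) \<open>strict_mono r\<close> that by (simp add: strict_mono_less_eq)
  ultimately show ?thesis by blast
qed

text \<open>Weighting the squared increments by \<open>2 ^ n\<close> makes their sum integrable, hence the increments are almost
  everywhere bounded by a geometric sequence.\<close>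

lemma L2_AE_convergent:
  fixes X :: "nat \<Rightarrow> 'a::euclidean_space L2"
  assumes X: "\<And>n. norm (X (Suc n) - X n) \<le> (1/2) ^ n"
  shows "AE x in lborel. convergent (\<lambda>n. rep_L2 (X n) x)"
proof -
  define d where "d n x = rep_L2 (X (Suc n)) x - rep_L2 (X n) x" for n x
  have d_meas [measurable]: "d n \<in> borel_measurable borel" for n unfolding d_def[abs_def] by measurable
  have "(\<integral>\<^sup>+ x. (\<Sum>n. ennreal (2 ^ n * (d n x)\<^sup>2)) \<partial>lborel) = (\<Sum>n. \<integral>\<^sup>+ x. ennreal (2 ^ n * (d n x)\<^sup>2) \<partial>lborel)"
    by (rule nn_integral_suminf) measurable
  also have "\<dots> \<le> (\<Sum>n. ennreal ((1/2) ^ n))"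
  proof (rule suminf_le)
    fix n
    have "(\<integral>\<^sup>+ x. ennreal (2 ^ n * (d n x)\<^sup>2) \<partial>lborel) = ennreal (2 ^ n) * (\<integral>\<^sup>+ x. ennreal ((d n x)\<^sup>2) \<partial>lborel)"
      by (subst nn_integral_cmult[symmetric]) (auto simp: ennreal_mult)
    also have "\<dots> = ennreal (2 ^ n * (norm (X (Suc n) - X n))\<^sup>2)"
      by (simp add: d_def nn_integral_diff_L2 ennreal_mult)
    also have "\<dots> \<le> ennreal (2 ^ n * ((1/2) ^ n)\<^sup>2)"
      using X by (intro ennreal_leI mult_left_mono power_mono) auto
    also have "2 ^ n * ((1/2) ^ n)\<^sup>2 = ((1/2) ^ n :: real)"
      by (simp add: power2_eq_square field_simps flip: power_mult_distrib)
    finally show "(\<integral>\<^sup>+ x. ennreal (2 ^ n * (d n x)\<^sup>2) \<partial>lborel) \<le> ennreal ((1/2) ^ n)" .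
  qed auto
  also have "\<dots> = ennreal (\<Sum>n. (1/2) ^ n)" by (intro suminf_ennreal_eq summable_sums) auto
  finally have "(\<integral>\<^sup>+ x. (\<Sum>n. ennreal (2 ^ n * (d n x)\<^sup>2)) \<partial>lborel) < \<infinity>" by (simp add: le_less_trans)
  then have "AE x in lborel. (\<Sum>n. ennreal (2 ^ n * (d n x)\<^sup>2)) \<noteq> \<infinity>"
    by (intro nn_integral_PInf_AE) auto
  then show ?thesis
  proof eventually_elim
    fix x assume "(\<Sum>n. ennreal (2 ^ n * (d n x)\<^sup>2)) \<noteq> \<infinity>"
    then have "summable (\<lambda>n. 2 ^ n * (d n x)\<^sup>2)" by (intro summable_suminf_not_top) auto
    then have "Bseq (\<lambda>n. 2 ^ n * (d n x)\<^sup>2)" using convergent_imp_Bseq convergentI summable_LIMSEQ_zero by blast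
    then obtain C where C: "C > 0" "\<And>n. norm (2 ^ n * (d n x)\<^sup>2) \<le> C" by (auto elim: BseqE)
    have "summable (\<lambda>n. d n x)"
    proof (rule summable_comparison_test)
      have "norm (d n x) \<le> sqrt C * (1 / sqrt 2) ^ n" for n
      proof -
        have "\<bar>d n x\<bar> = sqrt ((d n x)\<^sup>2)" by simp
        also have "\<dots> \<le> sqrt (C * (1/2) ^ n)" using C(2)[of n] by (intro real_sqrt_le_mono) (simp add: field_simps)
        also have "\<dots> = sqrt C * (1 / sqrt 2) ^ n" by (simp add: real_sqrt_mult real_sqrt_power real_sqrt_divide)
        finally show ?thesis by simp
      qed
      then show "\<exists>N. \<forall>n\<ge>N. norm (d n x) \<le> sqrt C * (1 / sqrt 2) ^ n" by blast
      show "summable (\<lambda>n. sqrt C * (1 / sqrt 2) ^ n)" by (intro summable_mult summable_geometric) simp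
    qed
    then have "convergent (\<lambda>n. (\<Sum>k<n. d k x))" by (simp add: summable_iff_convergent)
    moreover have "(\<Sum>k<n. d k x) = rep_L2 (X n) x - rep_L2 (X 0) x" for n
      unfolding d_def by (rule sum_lessThan_telescope)
    ultimately show "convergent (\<lambda>n. rep_L2 (X n) x)" by (simp add: convergent_diff_const_right_iff)
  qed
qed

text \<open>Riesz-Fischer: the limit is formed pointwise along a fast subsequence, Fatou shows that
  it is also the L2 limit, and a Cauchy sequence follows its convergent subsequence.\<close>

instance L2 :: (euclidean_space) banach
proof
  fix X :: "nat \<Rightarrow> 'a L2" assume C: "Cauchy X"
  then obtain r where r: "strict_mono r" "\<And>m n. n \<le> m \<Longrightarrow> dist (X (r m)) (X (r n)) < (1/2) ^ n"
    using Cauchy_fast_subsequence by blast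
  define Y where "Y n = X (r n)" for n
  have Y: "norm (Y m - Y n) \<le> (1/2) ^ n" if "n \<le> m" for m n
    using r(2)[OF that] by (simp add: Y_def dist_norm)
  have "AE x in lborel. convergent (\<lambda>n. rep_L2 (Y n) x)" by (rule L2_AE_convergent) (simp add: Y)
  then have lim: "AE x in lborel. (\<lambda>n. rep_L2 (Y n) x) \<longlonglongrightarrow> lim (\<lambda>n. rep_L2 (Y n) x)"
    by eventually_elim (simp add: convergent_LIMSEQ_iff)
  \<comment> \<open>Where the sequence diverges, \<open>lim\<close> takes an arbitrary default
    value; this happens on a null set only, and \<open>F\<close> is Borel all the same.\<close>
  define F where "F x = lim (\<lambda>n. rep_L2 (Y n) x)" for x
  have F_meas [measurable]: "F \<in> borel_measurable borel"
    unfolding F_def[abs_def] by (rule borel_measurable_lim_metric) measurable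
  have Fatou: "(\<integral>\<^sup>+ x. ennreal ((F x - rep_L2 (Y m) x)\<^sup>2) \<partial>lborel) \<le> ennreal (((1/2) ^ m)\<^sup>2)" for m
  proof -
    have "(\<integral>\<^sup>+ x. ennreal ((F x - rep_L2 (Y m) x)\<^sup>2) \<partial>lborel)
        = (\<integral>\<^sup>+ x. liminf (\<lambda>n. ennreal ((rep_L2 (Y n) x - rep_L2 (Y m) x)\<^sup>2)) \<partial>lborel)"
    proof (rule nn_integral_cong_AE, use lim in eventually_elim)
      fix x assume "(\<lambda>n. rep_L2 (Y n) x) \<longlonglongrightarrow> lim (\<lambda>n. rep_L2 (Y n) x)"
      then have "(\<lambda>n. ennreal ((rep_L2 (Y n) x - rep_L2 (Y m) x)\<^sup>2)) \<longlonglongrightarrow> ennreal ((F x - rep_L2 (Y m) x)\<^sup>2)"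
        unfolding F_def by (intro tendsto_ennrealI tendsto_intros)
      then show "ennreal ((F x - rep_L2 (Y m) x)\<^sup>2) = liminf (\<lambda>n. ennreal ((rep_L2 (Y n) x - rep_L2 (Y m) x)\<^sup>2))"
        by (intro lim_imp_Liminf[symmetric]) auto
    qed
    also have "\<dots> \<le> liminf (\<lambda>n. \<integral>\<^sup>+ x. ennreal ((rep_L2 (Y n) x - rep_L2 (Y m) x)\<^sup>2) \<partial>lborel)"
      by (rule nn_integral_liminf) measurable
    also have "\<dots> \<le> liminf (\<lambda>n. ennreal (((1/2) ^ m)\<^sup>2))"
    proof (rule Liminf_mono)
      show "\<forall>\<^sub>F n in sequentially. (\<integral>\<^sup>+ x. ennreal ((rep_L2 (Y n) x - rep_L2 (Y m) x)\<^sup>2) \<partial>lborel) \<le> ennreal (((1/2) ^ m)\<^sup>2)"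
        using eventually_ge_at_top[of m]
        by eventually_elim (unfold nn_integral_diff_L2, intro ennreal_leI power_mono Y, auto)
    qed
    also have "\<dots> = ennreal (((1/2) ^ m)\<^sup>2)" by (simp add: Liminf_const)
    finally show ?thesis .
  qed
  have "square_integrable (\<lambda>x. F x - rep_L2 (Y 0) x)"
    unfolding square_integrable_def
    by (auto intro!: integrableI_nonneg le_less_trans[OF Fatou])
  from square_integrable_add[OF this square_integrable_rep[of "Y 0"]] have F: "square_integrable F" by simp
  have "norm (Y m - abs_L2 F) \<le> (1/2) ^ m" for m
  proof -
    have "ennreal ((norm (abs_L2 F - Y m))\<^sup>2) = (\<integral>\<^sup>+ x. ennreal ((F x - rep_L2 (Y m) x)\<^sup>2) \<partial>lborel)"
      unfolding nn_integral_diff_L2[symmetric]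
      by (rule nn_integral_cong_AE) (use rep_abs_L2[OF F] in eventually_elim, simp)
    also note Fatou
    finally have "(norm (abs_L2 F - Y m))\<^sup>2 \<le> ((1/2) ^ m)\<^sup>2" by simp
    then have "norm (abs_L2 F - Y m) \<le> (1/2) ^ m" by (rule power2_le_imp_le) simp
    then show ?thesis by (simp add: norm_minus_commute)
  qed
  then have "(\<lambda>m. norm (Y m - abs_L2 F)) \<longlonglongrightarrow> 0"
    by (intro tendsto_sandwich[OF _ _ tendsto_const LIMSEQ_realpow_zero[of "1/2"]]) auto
  then have "(X \<circ> r) \<longlonglongrightarrow> abs_L2 F"
    by (simp add: Y_def o_def tendsto_norm_zero_iff LIM_zero_iff)
  then have "X \<longlonglongrightarrow> abs_L2 F" by (rule Cauchy_converges_subseq[OF C r(1)])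
  then show "convergent X" by (rule convergentI)
qed

lemma subspace_L2_on: "subspace (L2_on \<Omega>)"
proof (rule subspaceI)
  show "0 \<in> L2_on \<Omega>" unfolding L2_on_def using rep_zero by (auto elim: eventually_mono)
  show "u + v \<in> L2_on \<Omega>" if "u \<in> L2_on \<Omega>" "v \<in> L2_on \<Omega>" for u v
    using that rep_add[of u v] unfolding L2_on_def mem_Collect_eq by eventually_elim simp
  show "c *\<^sub>R u \<in> L2_on \<Omega>" if "u \<in> L2_on \<Omega>" for c u
    using that rep_scale[of c u] unfolding L2_on_def mem_Collect_eq by eventually_elim simp
qed

lemma closed_L2_on: "closed (L2_on \<Omega>)"
  unfolding closed_sequential_limits
proof (intro allI impI, elim conjE)
  fix X :: "nat \<Rightarrow> 'a L2" and x assume X: "\<forall>n. X n \<in> L2_on \<Omega>" and lim: "X \<longlonglongrightarrow> x"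
  from tendsto_L2_AE_subseq[OF lim] obtain r where
    r: "AE y in lborel. (\<lambda>n. rep_L2 (X (r n)) y) \<longlonglongrightarrow> rep_L2 x y" by blast
  have "AE y in lborel. \<forall>n. y \<notin> \<Omega> \<longrightarrow> rep_L2 (X (r n)) y = 0"
    using X unfolding AE_all_countable by (auto simp: L2_on_def)
  with r have "AE y in lborel. y \<notin> \<Omega> \<longrightarrow> rep_L2 x y = 0"
    by eventually_elim (auto simp: LIMSEQ_const_iff)
  then show "x \<in> L2_on \<Omega>" by (simp add: L2_on_def)
qed

section \<open>The fractional form as a closed form\<close>

text \<open>The \<open>H\<^sup>s\<close>-seminorm of \<open>u\<close> is the \<open>L2\<close> norm of its difference quotient on the product space.\<close>

definition diff_quot :: "real \<Rightarrow> 'a::euclidean_space L2 \<Rightarrow> 'a \<times> 'a \<Rightarrow> real" where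
  "diff_quot s u = (\<lambda>(x, y). (rep_L2 u x - rep_L2 u y) / norm (x - y) powr ((real DIM('a) + 2 * s) / 2))"

lemma diff_quot_mult:
  "diff_quot s u (x, y) * diff_quot s v (x, y)
    = (rep_L2 u x - rep_L2 u y) * (rep_L2 v x - rep_L2 v y) / norm (x - y) powr (real DIM('a) + 2 * s)"
  for u v :: "'a::euclidean_space L2"
proof -
  have "norm (x - y) powr ((real DIM('a) + 2 * s) / 2) * norm (x - y) powr ((real DIM('a) + 2 * s) / 2)
      = norm (x - y) powr (real DIM('a) + 2 * s)"
    by (subst powr_add[symmetric]) simp
  then show ?thesis by (simp add: diff_quot_def)
qed

lemma measurable_fst_snd_borel:
  "fst \<in> (borel :: ('a::euclidean_space \<times> 'a) measure) \<rightarrow>\<^sub>M borel"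
  "snd \<in> (borel :: ('a::euclidean_space \<times> 'a) measure) \<rightarrow>\<^sub>M borel"
  by (auto intro!: borel_measurable_continuous_onI continuous_intros)

lemma diff_quot_measurable [measurable]: "diff_quot s u \<in> borel_measurable borel"
proof -
  have [measurable]: "(\<lambda>p :: 'a \<times> 'a. rep_L2 u (fst p)) \<in> borel_measurable borel"
    by (rule measurable_compose[OF measurable_fst_snd_borel(1) rep_L2_measurable])
  have [measurable]: "(\<lambda>p :: 'a \<times> 'a. rep_L2 u (snd p)) \<in> borel_measurable borel"
    by (rule measurable_compose[OF measurable_fst_snd_borel(2) rep_L2_measurable])
  have [measurable]: "(\<lambda>p::'a \<times> 'a. norm (fst p - snd p)) \<in> borel_measurable borel"
    by (intro borel_measurable_continuous_onI continuous_intros)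
  show ?thesis unfolding diff_quot_def case_prod_beta by measurable
qed

lemma Hs_iff: "u \<in> Hs s \<longleftrightarrow> square_integrable (diff_quot s u)"
proof -
  have "(\<lambda>(x, y). (rep_L2 u x - rep_L2 u y)\<^sup>2 / norm (x - y) powr (real DIM('a) + 2 * s)) = (\<lambda>p. (diff_quot s u p)\<^sup>2)"
    unfolding power2_eq_square by (intro ext) (simp add: diff_quot_mult split: prod.split)
  then show ?thesis by (simp add: Hs_def square_integrable_def)
qed

text \<open>Representatives are fixed only almost everywhere, while a difference quotient evaluates
  them at two points. The exceptional pairs lie in two strips over a null set, which are null in the
  product.\<close>

lemma AE_lborel_prod:
  assumes "AE x in lborel. P (x :: 'a::euclidean_space)"
  shows "AE p in lborel. P (fst p) \<and> P (snd p :: 'a)"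
proof -
  from assms obtain N where N: "N \<in> null_sets lborel" "{x. \<not> P x} \<subseteq> N" by (auto simp: eventually_ae_filter)
  have "N \<times> UNIV \<union> UNIV \<times> N \<in> null_sets (lborel \<Otimes>\<^sub>M lborel :: ('a \<times> 'a) measure)"
    using N(1) by (intro null_sets.Un lborel.times_in_null_sets1 lborel.times_in_null_sets2) auto
  then have "N \<times> UNIV \<union> UNIV \<times> N \<in> null_sets (lborel :: ('a \<times> 'a) measure)" by (simp add: lborel_prod)
  then show ?thesis by (rule AE_I') (use N(2) in auto)
qed

lemma diff_quot_cong:
  fixes u v w :: "'a::euclidean_space L2"
  assumes "AE x in lborel. rep_L2 w x = c * rep_L2 u x + d * rep_L2 v x"
  shows "AE p in lborel. diff_quot s w p = c * diff_quot s u p + d * diff_quot s v p"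
  using AE_lborel_prod[OF assms]
proof eventually_elim
  fix p :: "'a \<times> 'a"
  assume "rep_L2 w (fst p) = c * rep_L2 u (fst p) + d * rep_L2 v (fst p) \<and>
    rep_L2 w (snd p) = c * rep_L2 u (snd p) + d * rep_L2 v (snd p)"
  then have "rep_L2 w (fst p) - rep_L2 w (snd p)
      = c * (rep_L2 u (fst p) - rep_L2 u (snd p)) + d * (rep_L2 v (fst p) - rep_L2 v (snd p))"
    by (simp add: right_diff_distrib)
  then show "diff_quot s w p = c * diff_quot s u p + d * diff_quot s v p"
    by (simp add: diff_quot_def case_prod_beta add_divide_distrib)
qed

lemma AE_lincomb: "AE x in lborel. rep_L2 (c *\<^sub>R u + d *\<^sub>R v) x = c * rep_L2 u x + d * rep_L2 v x"
  using rep_add[of "c *\<^sub>R u" "d *\<^sub>R v"] rep_scale[of c u] rep_scale[of d v] by eventually_elim simp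

lemma square_integrable_cong_AE:
  assumes "f \<in> borel_measurable borel" "square_integrable g" "AE x in lborel. f x = g x"
  shows "square_integrable f"
  unfolding square_integrable_def
proof
  have "integrable lborel (\<lambda>x. (f x)\<^sup>2) \<longleftrightarrow> integrable lborel (\<lambda>x. (g x)\<^sup>2)"
    using assms by (intro integrable_cong_AE) (auto simp: square_integrable_def)
  then show "integrable lborel (\<lambda>x. (f x)\<^sup>2)" using assms(2) by (simp add: square_integrable_def)
qed (use assms in simp)

text \<open>A nonlocal gradient, with values in L2 over pairs of points. It is meaningful on
  \<open>Hs s\<close> only, where the difference quotient is square integrable.\<close>

definition grad :: "real \<Rightarrow> 'a::euclidean_space L2 \<Rightarrow> ('a \<times> 'a) L2" where
  "grad s u = abs_L2 (diff_quot s u)"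

lemma Hs_lincomb:
  assumes "u \<in> Hs s" "v \<in> Hs s"
  shows "c *\<^sub>R u + d *\<^sub>R v \<in> Hs s" "grad s (c *\<^sub>R u + d *\<^sub>R v) = c *\<^sub>R grad s u + d *\<^sub>R grad s v"
proof -
  note AE = diff_quot_cong[OF AE_lincomb, of s c u d v]
  have q: "square_integrable (diff_quot s u)" "square_integrable (diff_quot s v)" using assms by (auto simp: Hs_iff)
  then have lin: "square_integrable (\<lambda>p. c * diff_quot s u p + d * diff_quot s v p)"
    by (intro square_integrable_add square_integrable_scale)
  have sq: "square_integrable (diff_quot s (c *\<^sub>R u + d *\<^sub>R v))"
    by (rule square_integrable_cong_AE[OF _ lin AE]) measurable
  then show "c *\<^sub>R u + d *\<^sub>R v \<in> Hs s" by (simp add: Hs_iff)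
  have "c *\<^sub>R grad s u + d *\<^sub>R grad s v = abs_L2 (diff_quot s (c *\<^sub>R u + d *\<^sub>R v))"
  proof (rule L2_eqI[OF sq])
    show "AE p in lborel. rep_L2 (c *\<^sub>R grad s u + d *\<^sub>R grad s v) p = diff_quot s (c *\<^sub>R u + d *\<^sub>R v) p"
      using AE_lincomb[of c "grad s u" d "grad s v"] AE rep_abs_L2[OF q(1)] rep_abs_L2[OF q(2)]
      unfolding grad_def by eventually_elim simp
  qed
  then show "grad s (c *\<^sub>R u + d *\<^sub>R v) = c *\<^sub>R grad s u + d *\<^sub>R grad s v" by (simp add: grad_def)
qed

lemma zero_Hs: "0 \<in> Hs s"
proof -
  have "AE x in lborel. rep_L2 (0 :: 'a L2) x = 0 * rep_L2 (0 :: 'a L2) x + 0 * rep_L2 (0 :: 'a L2) x"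
    using rep_zero by simp
  from diff_quot_cong[OF this, of s] have "AE p in lborel. diff_quot s (0 :: 'a L2) p = 0" by simp
  then show ?thesis unfolding Hs_iff by (rule square_integrable_cong_AE[OF diff_quot_measurable square_integrable_zero])
qed

lemma grad_add: "u \<in> Hs s \<Longrightarrow> v \<in> Hs s \<Longrightarrow> grad s (u + v) = grad s u + grad s v"
  using Hs_lincomb(2)[of u s v 1 1] by simp

lemma grad_scale: "u \<in> Hs s \<Longrightarrow> grad s (c *\<^sub>R u) = c *\<^sub>R grad s u"
  using Hs_lincomb(2)[of u s u c 0] by simp

lemma grad_diff: "u \<in> Hs s \<Longrightarrow> v \<in> Hs s \<Longrightarrow> grad s (u - v) = grad s u - grad s v"
  using Hs_lincomb(2)[of u s v 1 "-1"] by simp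

text \<open>Passing to subsequences twice makes functions and difference quotients converge almost
  everywhere together. At a fixed pair of points the quotient depends continuously on the two
  values, so the limits match.\<close>

lemma grad_closed:
  assumes X: "\<And>n. X n \<in> Hs s" "X \<longlonglongrightarrow> u" "(\<lambda>n. grad s (X n)) \<longlonglongrightarrow> w"
  shows "u \<in> Hs s" "grad s u = w"
proof -
  obtain r where r: "strict_mono r"
    "AE y in lborel. (\<lambda>n. rep_L2 (X (r n)) y) \<longlonglongrightarrow> rep_L2 u y"
    using tendsto_L2_AE_subseq[OF X(2)] by (elim exE conjE) (rule that)
  have "(\<lambda>n. grad s (X (r n))) \<longlonglongrightarrow> w" using LIMSEQ_subseq_LIMSEQ[OF X(3) r(1)] by (simp add: o_def)
  from tendsto_L2_AE_subseq[OF this] obtain q where q: "strict_mono q"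
    "AE p in lborel. (\<lambda>n. rep_L2 (grad s (X (r (q n)))) p) \<longlonglongrightarrow> rep_L2 w p"
    by (elim exE conjE) (rule that)
  have rep: "AE p in lborel. \<forall>n. rep_L2 (grad s (X n)) p = diff_quot s (X n) p"
    unfolding AE_all_countable grad_def using X(1) by (intro allI rep_abs_L2) (simp add: Hs_iff)
  have eq: "AE p in lborel. diff_quot s u p = rep_L2 w p"
    using AE_lborel_prod[OF r(2)] q(2) rep
  proof eventually_elim
    fix p :: "'a \<times> 'a"
    assume A: "(\<lambda>n. rep_L2 (X (r n)) (fst p)) \<longlonglongrightarrow> rep_L2 u (fst p) \<and> (\<lambda>n. rep_L2 (X (r n)) (snd p)) \<longlonglongrightarrow> rep_L2 u (snd p)"
      and B: "(\<lambda>n. rep_L2 (grad s (X (r (q n)))) p) \<longlonglongrightarrow> rep_L2 w p"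
      and C: "\<forall>n. rep_L2 (grad s (X n)) p = diff_quot s (X n) p"
    have "(\<lambda>n. diff_quot s (X (r n)) p) \<longlonglongrightarrow> diff_quot s u p"
      unfolding diff_quot_def case_prod_beta divide_inverse using A
      by (elim conjE) (rule tendsto_mult[OF tendsto_diff tendsto_const])
    from LIMSEQ_subseq_LIMSEQ[OF this q(1)] B C show "diff_quot s u p = rep_L2 w p"
      by (auto simp: o_def intro: LIMSEQ_unique)
  qed
  have sq: "square_integrable (diff_quot s u)"
    by (rule square_integrable_cong_AE[OF _ square_integrable_rep eq]) measurable
  then show "u \<in> Hs s" by (simp add: Hs_iff)
  have "w = abs_L2 (diff_quot s u)"
    by (rule L2_eqI[OF sq]) (use eq in \<open>auto elim: eventually_mono\<close>)
  then show "grad s u = w" by (simp add: grad_def)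
qed

lemma H0s_iff: "u \<in> H0s \<Omega> s \<longleftrightarrow> u \<in> Hs s \<and> u \<in> L2_on \<Omega>"
  by (simp add: H0s_def L2_on_def)

lemma subspace_H0s: "subspace (H0s \<Omega> s)"
proof (rule subspaceI)
  note L = subspace_L2_on[of \<Omega>]
  show "0 \<in> H0s \<Omega> s" using subspace_0[OF L] by (simp add: H0s_iff zero_Hs)
  show "u + v \<in> H0s \<Omega> s" if "u \<in> H0s \<Omega> s" "v \<in> H0s \<Omega> s" for u v
    using that subspace_add[OF L] Hs_lincomb(1)[of u s v 1 1] by (simp add: H0s_iff)
  show "c *\<^sub>R u \<in> H0s \<Omega> s" if "u \<in> H0s \<Omega> s" for c u
    using that subspace_scale[OF L] Hs_lincomb(1)[of u s u c 0] by (simp add: H0s_iff)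
qed

lemma frac_const_pos: "0 < N \<Longrightarrow> 0 < s \<Longrightarrow> s < 1 \<Longrightarrow> 0 < frac_const N s"
  unfolding frac_const_def by (intro divide_pos_pos mult_pos_pos Gamma_real_pos) auto

text \<open>As \<open>u\<close> vanishes outside \<open>\<Omega>\<close>, the integral over
  \<open>\<Omega>\<close> is the inner product over the whole space. Both terms of the form are then
  L2 inner products, one over points and one over pairs of points.\<close>

lemma frac_form_eq:
  fixes \<Omega> :: "'a::euclidean_space set"
  assumes \<Omega>: "\<Omega> \<in> sets borel" and "u \<in> H0s \<Omega> s" "v \<in> H0s \<Omega> s"
  shows "frac_form \<Omega> s u v = u \<bullet> v + frac_const (real DIM('a)) s / 2 * (grad s u \<bullet> grad s v)"
proof -
  have u0: "AE x in lborel. x \<notin> \<Omega> \<longrightarrow> rep_L2 u x = 0" using assms(2) by (simp add: H0s_def)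
  have "(LINT x:\<Omega>|lborel. rep_L2 u x * rep_L2 v x) = u \<bullet> v"
    unfolding set_lebesgue_integral_def inner_L2.rep_eq
  proof (rule integral_cong_AE)
    show "AE x in lborel. indicator \<Omega> x *\<^sub>R (rep_L2 u x * rep_L2 v x) = rep_L2 u x * rep_L2 v x"
      using u0 by eventually_elim (auto simp: indicator_def)
  qed (use \<Omega> in measurable)
  moreover have "(LINT (x, y)|(lborel :: ('a \<times> 'a) measure).
      (rep_L2 u x - rep_L2 u y) * (rep_L2 v x - rep_L2 v y) / norm (x - y) powr (real DIM('a) + 2 * s)) = grad s u \<bullet> grad s v"
  proof -
    have "(\<lambda>(x, y). (rep_L2 u x - rep_L2 u y) * (rep_L2 v x - rep_L2 v y) / norm (x - y) powr (real DIM('a) + 2 * s))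
        = (\<lambda>p. diff_quot s u p * diff_quot s v p)"
      by (intro ext) (simp add: diff_quot_mult split: prod.split)
    then show ?thesis using assms by (simp add: grad_def inner_abs_L2 H0s_iff Hs_iff)
  qed
  ultimately show ?thesis by (simp add: frac_form_def)
qed

text \<open>A Cauchy sequence for the form is Cauchy in L2 together with its images under
  \<open>grad\<close>. Completeness of L2 over points and over pairs provides two limits, which
  \<open>grad_closed\<close> relates, and the support condition survives because
  \<open>L2_on \<Omega>\<close> is closed.\<close>

lemma hilbert_form_frac_form:
  fixes \<Omega> :: "'a::euclidean_space set"
  assumes \<Omega>: "\<Omega> \<in> sets borel" and s: "0 < s" "s < 1"
  shows "hilbert_form (H0s \<Omega> s) (frac_form \<Omega> s)"
proof -
  define c where "c = frac_const (real DIM('a)) s / 2"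
  have c: "c > 0" unfolding c_def using frac_const_pos[of "real DIM('a)" s] s by simp
  have form: "frac_form \<Omega> s u v = u \<bullet> v + c * (grad s u \<bullet> grad s v)" if "u \<in> H0s \<Omega> s" "v \<in> H0s \<Omega> s" for u v
    using frac_form_eq[OF \<Omega> that] by (simp add: c_def)
  note V = subspace_H0s[of \<Omega> s]
  note mem = subspace_add[OF V] subspace_diff[OF V] subspace_scale[OF V]
  have Hs: "u \<in> Hs s" if "u \<in> H0s \<Omega> s" for u using that by (simp add: H0s_iff)
  show ?thesis
  proof
    show "subspace (H0s \<Omega> s)" by (rule V)
    show "frac_form \<Omega> s (u + v) w = frac_form \<Omega> s u w + frac_form \<Omega> s v w"
      if "u \<in> H0s \<Omega> s" "v \<in> H0s \<Omega> s" "w \<in> H0s \<Omega> s" for u v w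
      using that by (simp add: form mem grad_add Hs inner_add_left algebra_simps)
    show "frac_form \<Omega> s (d *\<^sub>R u) v = d * frac_form \<Omega> s u v" if "u \<in> H0s \<Omega> s" "v \<in> H0s \<Omega> s" for d u v
      using that by (simp add: form mem grad_scale Hs algebra_simps)
    show "frac_form \<Omega> s u v = frac_form \<Omega> s v u" if "u \<in> H0s \<Omega> s" "v \<in> H0s \<Omega> s" for u v
      using that by (simp add: form inner_commute)
    show "0 \<le> frac_form \<Omega> s u u" if "u \<in> H0s \<Omega> s" for u
      using that c by (simp add: form)
    fix X :: "nat \<Rightarrow> 'a L2"
    assume X: "\<And>n. X n \<in> H0s \<Omega> s"
      and Cau: "\<And>e. e > 0 \<Longrightarrow> \<exists>N. \<forall>m\<ge>N. \<forall>n\<ge>N. frac_form \<Omega> s (X m - X n) (X m - X n) < e"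
    have eq: "frac_form \<Omega> s (X m - X n) (X m - X n) = (norm (X m - X n))\<^sup>2 + c * (norm (grad s (X m) - grad s (X n)))\<^sup>2" for m n
      using X by (simp add: form mem grad_diff Hs power2_norm_eq_inner)
    have small: "\<exists>N. \<forall>m\<ge>N. \<forall>n\<ge>N. dist (X m) (X n) < e \<and> dist (grad s (X m)) (grad s (X n)) < e" if e: "e > 0" for e :: real
    proof -
      have "min (e\<^sup>2) (c * e\<^sup>2) > 0" using e c by simp
      then obtain N where N: "\<And>m n. m \<ge> N \<Longrightarrow> n \<ge> N \<Longrightarrow> frac_form \<Omega> s (X m - X n) (X m - X n) < min (e\<^sup>2) (c * e\<^sup>2)"
        using Cau by meson
      have "dist (X m) (X n) < e \<and> dist (grad s (X m)) (grad s (X n)) < e" if "m \<ge> N" "n \<ge> N" for m n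
      proof -
        have "0 \<le> c * (norm (grad s (X m) - grad s (X n)))\<^sup>2" using c by simp
        then have "(norm (X m - X n))\<^sup>2 < e\<^sup>2" using N[OF that] unfolding eq by linarith
        moreover have "c * (norm (grad s (X m) - grad s (X n)))\<^sup>2 < c * e\<^sup>2"
          using N[OF that] zero_le_power2[of "norm (X m - X n)"] unfolding eq by linarith
        then have "(norm (grad s (X m) - grad s (X n)))\<^sup>2 < e\<^sup>2" using c by simp
        ultimately show ?thesis using e by (auto simp: dist_norm intro: power_less_imp_less_base)
      qed
      then show ?thesis by blast
    qed
    have "Cauchy X" by (rule metric_CauchyI) (use small in meson)
    then obtain u where u: "X \<longlonglongrightarrow> u" by (auto simp: Cauchy_convergent_iff convergent_def)
    have "Cauchy (\<lambda>n. grad s (X n))" by (rule metric_CauchyI) (use small in meson)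
    then obtain w where w: "(\<lambda>n. grad s (X n)) \<longlonglongrightarrow> w" by (auto simp: Cauchy_convergent_iff convergent_def)
    note cl = grad_closed[OF Hs[OF X] u w]
    have "u \<in> L2_on \<Omega>"
      using closed_sequentially[OF closed_L2_on _ u] X by (simp add: H0s_iff)
    then have uV: "u \<in> H0s \<Omega> s" using cl by (simp add: H0s_iff)
    have "(\<lambda>n. (norm (X n - u))\<^sup>2 + c * (norm (grad s (X n) - grad s u))\<^sup>2) \<longlonglongrightarrow> (norm (u - u))\<^sup>2 + c * (norm (w - grad s u))\<^sup>2"
      by (intro tendsto_intros u w)
    moreover have "frac_form \<Omega> s (X n - u) (X n - u) = (norm (X n - u))\<^sup>2 + c * (norm (grad s (X n) - grad s u))\<^sup>2" for n
      using X uV by (simp add: form mem grad_diff Hs power2_norm_eq_inner)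
    ultimately show "\<exists>x\<in>H0s \<Omega> s. (\<lambda>n. frac_form \<Omega> s (X n - x) (X n - x)) \<longlonglongrightarrow> 0"
      using uV cl by (intro bexI[of _ u]) auto
  qed
qed

section \<open>Density of the fractional Sobolev space\<close>

lemma le_suminf_ennreal: "f j \<le> (\<Sum>i. f i)" for f :: "nat \<Rightarrow> ennreal"
  using sum_le_suminf[of f "{j}"] by simp

lemma suminf_ennreal_geometric_less_top:
  assumes "\<bar>q\<bar> < 1" "\<And>j. f j = ennreal (C * q ^ j)" "0 \<le> C" "0 \<le> q"
  shows "(\<Sum>j. f j) < top"
proof -
  have "(\<lambda>j. C * q ^ j) sums (C * (1 / (1 - q)))"
    using assms by (intro sums_mult geometric_sums) simp
  then have "(\<Sum>j. ennreal (C * q ^ j)) = ennreal (C * (1 / (1 - q)))"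
    using assms by (intro suminf_ennreal_eq) auto
  then show ?thesis by (simp add: assms(2))
qed

text \<open>Dyadic annuli: the \<open>j\<close>-th annulus contributes \<open>2 ^ (-j (2 - 2 s))\<close> inside the unit ball and \<open>2 ^ (-2 s j)\<close>
  outside, up to constants.\<close>

lemma kernel_integral_finite:
  fixes s L :: real
  assumes s: "0 < s" "s < 1" and L: "0 \<le> L"
  shows "(\<integral>\<^sup>+ z. ennreal ((min 1 (L * norm z))\<^sup>2 / norm z powr (real DIM('a) + 2 * s))
    \<partial>(lborel :: 'a::euclidean_space measure)) < top"
proof -
  define N where "N = real DIM('a)"
  define p where "p = N + 2 * s"
  have p: "p > 0" using s by (simp add: p_def N_def add_nonneg_pos)
  define V where "V = unit_ball_vol N"
  have V: "V \<ge> 0" by (simp add: V_def N_def)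
  \<comment> \<open>On the annulus 2^(-j-1) < |z| <= 2^(-j) the numerator is at most L^2 2^(-2j) and
    1 / |z|^p at most 2^((j+1)p), which gives \<open>\<alpha> j\<close>; on 2^j <= |z| < 2^(j+1) the
    bounds are 1 and 2^(-jp), which gives \<open>\<beta> j\<close>. Each is charged to the full
    outer ball. The ratios 2^(2s-2) and 2^(-2s) are below 1 by s < 1 and s > 0 respectively.\<close>
  define \<alpha> where "\<alpha> j = L\<^sup>2 * 2 powr (- 2 * real j) * 2 powr ((real j + 1) * p)" for j :: nat
  define \<beta> where "\<beta> j = 2 powr (- real j * p)" for j :: nat
  define S1 where "S1 z = (\<Sum>j. ennreal (\<alpha> j) * indicator (cball 0 (2 powr (- real j))) z)" for z :: 'a
  define S2 where "S2 z = (\<Sum>j. ennreal (\<beta> j) * indicator (cball 0 (2 powr (real j + 1))) z)" for z :: 'a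
  have \<alpha>0: "0 \<le> \<alpha> j" and \<beta>0: "0 \<le> \<beta> j" for j by (auto simp: \<alpha>_def \<beta>_def)
  have vol: "emeasure lborel (cball (0::'a) (2 powr x)) = ennreal (V * 2 powr (N * x))" for x
    by (simp add: emeasure_cball V_def N_def powr_powr mult.commute flip: powr_realpow)
  have [measurable]: "cball (0::'a) d \<in> sets borel" for d by simp
  have [measurable]: "(\<lambda>z::'a. ennreal c * indicator (cball 0 d) z) \<in> borel_measurable borel" for c d
    by measurable
  have bound: "ennreal ((min 1 (L * norm z))\<^sup>2 / norm z powr p) \<le> S1 z + S2 z" for z :: 'a
  proof (cases "z = 0")
    case False
    define l where "l = log 2 (norm z)"
    have nz: "norm z = 2 powr l" using False by (simp add: l_def)
    have nzp: "norm z powr p = 2 powr (l * p)" by (simp add: nz powr_powr)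
    show ?thesis
    proof (cases "l \<le> 0")
      case True
      define j where "j = nat \<lfloor>- l\<rfloor>"
      have "real j = of_int \<lfloor>- l\<rfloor>" using True by (simp add: j_def)
      then have j: "real j \<le> - l" "- l < real j + 1" by linarith+
      have z: "norm z \<le> 2 powr (- real j)" using j by (simp add: nz)
      have "(min 1 (L * norm z))\<^sup>2 \<le> (L * 2 powr (- real j))\<^sup>2"
        using L z by (intro power_mono) (auto simp: min_le_iff_disj intro!: mult_left_mono)
      also have "\<dots> = L\<^sup>2 * 2 powr (- 2 * real j)"
        by (simp add: power_mult_distrib power2_eq_square flip: powr_add)
      finally have "(min 1 (L * norm z))\<^sup>2 * inverse (norm z powr p) \<le> (L\<^sup>2 * 2 powr (- 2 * real j)) * 2 powr ((real j + 1) * p)"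
      proof (rule mult_mono)
        have "- l * p \<le> (real j + 1) * p" using j p by (intro mult_right_mono) auto
        then show "inverse (norm z powr p) \<le> 2 powr ((real j + 1) * p)"
          unfolding nzp powr_minus[symmetric] by simp
      qed auto
      then have "ennreal ((min 1 (L * norm z))\<^sup>2 / norm z powr p) \<le> ennreal (\<alpha> j) * indicator (cball 0 (2 powr (- real j))) z"
        using z by (simp add: \<alpha>_def divide_inverse ennreal_leI)
      also have "\<dots> \<le> S1 z" unfolding S1_def by (rule le_suminf_ennreal)
      also have "\<dots> \<le> S1 z + S2 z" by simp
      finally show ?thesis .
    next
      case l: False
      define j where "j = nat \<lfloor>l\<rfloor>"
      have "real j = of_int \<lfloor>l\<rfloor>" using l by (simp add: j_def)
      then have j: "real j \<le> l" "l < real j + 1" by linarith+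
      have z: "norm z \<le> 2 powr (real j + 1)" using j by (simp add: nz)
      have "(min 1 (L * norm z))\<^sup>2 \<le> 1" using L by (intro power_le_one) auto
      moreover have "inverse (norm z powr p) \<le> 2 powr (- real j * p)"
        unfolding nzp powr_minus[symmetric] using j p by (simp add: mult_right_mono)
      ultimately have "(min 1 (L * norm z))\<^sup>2 * inverse (norm z powr p) \<le> 1 * 2 powr (- real j * p)"
        by (intro mult_mono) auto
      then have "ennreal ((min 1 (L * norm z))\<^sup>2 / norm z powr p) \<le> ennreal (\<beta> j) * indicator (cball 0 (2 powr (real j + 1))) z"
        using z by (simp add: \<beta>_def divide_inverse ennreal_leI)
      also have "\<dots> \<le> S2 z" unfolding S2_def by (rule le_suminf_ennreal)
      also have "\<dots> \<le> S1 z + S2 z" by simp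
      finally show ?thesis .
    qed
  qed simp
  have "integral\<^sup>N lborel S1 = (\<Sum>j. ennreal (\<alpha> j) * ennreal (V * 2 powr (N * (- real j))))"
    unfolding S1_def by (subst nn_integral_suminf) (auto simp: nn_integral_cmult_indicator vol)
  also have "\<dots> < top"
  proof (rule suminf_ennreal_geometric_less_top)
    show "\<bar>2 powr (2 * s - 2)\<bar> < (1::real)" using s by (simp add: powr_less_one)
    fix j
    have "\<alpha> j * (V * 2 powr (N * (- real j))) = L\<^sup>2 * V * (2 powr (- 2 * real j) * 2 powr ((real j + 1) * p) * 2 powr (N * (- real j)))"
      by (simp add: \<alpha>_def)
    also have "2 powr (- 2 * real j) * 2 powr ((real j + 1) * p) * 2 powr (N * (- real j)) = 2 powr p * (2 powr (2 * s - 2)) ^ j"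
      by (simp add: p_def powr_powr algebra_simps flip: powr_add powr_realpow)
    finally have eq: "\<alpha> j * (V * 2 powr (N * (- real j))) = L\<^sup>2 * V * (2 powr p * (2 powr (2 * s - 2)) ^ j)" .
    show "ennreal (\<alpha> j) * ennreal (V * 2 powr (N * (- real j))) = ennreal (L\<^sup>2 * V * 2 powr p * (2 powr (2 * s - 2)) ^ j)"
      unfolding ennreal_mult'[OF \<alpha>0, symmetric] eq by (simp only: mult.assoc)
  qed (use V in auto)
  finally have 1: "integral\<^sup>N lborel S1 < top" .
  have "integral\<^sup>N lborel S2 = (\<Sum>j. ennreal (\<beta> j) * ennreal (V * 2 powr (N * (real j + 1))))"
    unfolding S2_def by (subst nn_integral_suminf) (auto simp: nn_integral_cmult_indicator vol)
  also have "\<dots> < top"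
  proof (rule suminf_ennreal_geometric_less_top)
    show "\<bar>2 powr (- 2 * s)\<bar> < (1::real)" using s by (simp add: powr_less_one)
    fix j
    have "\<beta> j * (V * 2 powr (N * (real j + 1))) = V * (2 powr (- real j * p) * 2 powr (N * (real j + 1)))"
      by (simp add: \<beta>_def)
    also have "2 powr (- real j * p) * 2 powr (N * (real j + 1)) = 2 powr N * (2 powr (- 2 * s)) ^ j"
      by (simp add: p_def powr_powr algebra_simps flip: powr_add powr_realpow)
    finally have eq: "\<beta> j * (V * 2 powr (N * (real j + 1))) = V * (2 powr N * (2 powr (- 2 * s)) ^ j)" .
    show "ennreal (\<beta> j) * ennreal (V * 2 powr (N * (real j + 1))) = ennreal (V * 2 powr N * (2 powr (- 2 * s)) ^ j)"
      unfolding ennreal_mult'[OF \<beta>0, symmetric] eq by (simp only: mult.assoc)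
  qed (use V in auto)
  finally have 2: "integral\<^sup>N lborel S2 < top" .
  have [measurable]: "S1 \<in> borel_measurable borel" "S2 \<in> borel_measurable borel"
    unfolding S1_def[abs_def] S2_def[abs_def] by measurable
  have "(\<integral>\<^sup>+ z. ennreal ((min 1 (L * norm z))\<^sup>2 / norm z powr p) \<partial>(lborel :: 'a measure)) \<le> (\<integral>\<^sup>+ z. S1 z + S2 z \<partial>lborel)"
    by (intro nn_integral_mono bound)
  also have "\<dots> = integral\<^sup>N lborel S1 + integral\<^sup>N lborel S2" by (rule nn_integral_add) measurable
  also have "\<dots> < top" using 1 2 by simp
  finally show ?thesis by (simp add: p_def N_def)
qed

lemma nn_integral_translate:
  fixes f :: "'a::euclidean_space \<Rightarrow> ennreal"
  assumes [measurable]: "f \<in> borel_measurable borel"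
  shows "(\<integral>\<^sup>+ x. f (x - y) \<partial>lborel) = integral\<^sup>N lborel f"
proof -
  have "(\<integral>\<^sup>+ x. f (x - y) \<partial>lborel) = integral\<^sup>N (distr lborel borel ((+) (- y))) f"
    by (subst nn_integral_distr) auto
  then show ?thesis by (simp add: lborel_distr_plus)
qed

text \<open>The squared quotient at (x, y) is at most min(1, L |x - y|)^2 / |x - y|^p, and it
  vanishes unless \<open>x\<close> or \<open>y\<close> lies in the supporting ball. Tonelli and
  translation invariance bound its integral by twice the kernel integral times the volume of the
  ball.\<close>

lemma Lipschitz_bump_in_Hs:
  fixes \<phi> :: "'a::euclidean_space \<Rightarrow> real"
  assumes s: "0 < s" "s < 1" and L: "0 \<le> L"
    and range: "\<And>x. 0 \<le> \<phi> x \<and> \<phi> x \<le> 1" and Lip: "\<And>x y. \<bar>\<phi> x - \<phi> y\<bar> \<le> L * norm (x - y)"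
    and supp: "\<And>x. x \<notin> cball 0 r \<Longrightarrow> \<phi> x = 0" and r: "0 \<le> r"
  shows "square_integrable \<phi>" "abs_L2 \<phi> \<in> Hs s"
proof -
  define p where "p = real DIM('a) + 2 * s"
  define B where "B = cball (0::'a) r"
  have Bfin: "emeasure lborel B < top" using r by (simp add: B_def emeasure_cball)
  have "continuous_on UNIV \<phi>"
  proof (rule continuous_onI)
    fix x and e :: real assume e: "e > 0"
    have "dist (\<phi> y) (\<phi> x) \<le> e" if "dist y x < e / (L + 1)" for y
    proof -
      have "\<bar>\<phi> y - \<phi> x\<bar> \<le> L * norm (y - x)" by (rule Lip)
      also have "\<dots> \<le> (L + 1) * (e / (L + 1))" using that L by (intro mult_mono) (auto simp: dist_norm)
      also have "\<dots> = e" using L by simp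
      finally show ?thesis by (simp add: dist_norm)
    qed
    then show "\<exists>d>0. \<forall>y\<in>UNIV. dist y x < d \<longrightarrow> dist (\<phi> y) (\<phi> x) \<le> e"
      using e L by (intro exI[of _ "e / (L + 1)"]) auto
  qed
  then have \<phi>_meas [measurable]: "\<phi> \<in> borel_measurable borel" by (rule borel_measurable_continuous_onI)
  show sq: "square_integrable \<phi>"
    unfolding square_integrable_def
  proof
    show "integrable lborel (\<lambda>x. (\<phi> x)\<^sup>2)"
    proof (rule Bochner_Integration.integrable_bound)
      show "integrable lborel (indicator B :: 'a \<Rightarrow> real)" using Bfin by (intro integrable_real_indicator) (auto simp: B_def)
      show "AE x in lborel. norm ((\<phi> x)\<^sup>2) \<le> norm (indicator B x :: real)"
        using range supp by (intro always_eventually allI) (auto simp: B_def indicator_def power_le_one)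
    qed measurable
  qed measurable
  define k where "k z = ennreal ((min 1 (L * norm z))\<^sup>2 / norm z powr p)" for z :: 'a
  have k_meas [measurable]: "k \<in> borel_measurable borel" unfolding k_def[abs_def] by measurable
  have k_int: "integral\<^sup>N lborel k < top" unfolding k_def p_def by (rule kernel_integral_finite[OF s L])
  define Q where "Q x y = (\<phi> x - \<phi> y) / norm (x - y) powr (p / 2)" for x y :: 'a
  have powr_sq: "(t powr (p / 2))\<^sup>2 = t powr p" for t
    by (simp add: power2_eq_square flip: powr_add)
  have Q_bound: "ennreal ((Q x y)\<^sup>2) \<le> indicator B x * k (y - x) + indicator B y * k (x - y)" for x y
  proof -
    have "(Q x y)\<^sup>2 = (\<phi> x - \<phi> y)\<^sup>2 / norm (x - y) powr p" by (simp add: Q_def power_divide powr_sq)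
    also have "\<dots> \<le> (min 1 (L * norm (x - y)))\<^sup>2 / norm (x - y) powr p"
    proof (rule divide_right_mono)
      have "\<bar>\<phi> x - \<phi> y\<bar> \<le> min 1 (L * norm (x - y))" using Lip[of x y] range[of x] range[of y] by auto
      from power_mono[OF this, of 2] show "(\<phi> x - \<phi> y)\<^sup>2 \<le> (min 1 (L * norm (x - y)))\<^sup>2" by simp
    qed simp
    finally have 1: "ennreal ((Q x y)\<^sup>2) \<le> k (x - y)" unfolding k_def by (rule ennreal_leI)
    have 2: "k (y - x) = k (x - y)" by (simp add: k_def norm_minus_commute)
    show ?thesis
    proof (cases "x \<in> B \<or> y \<in> B")
      case True
      then have "k (x - y) \<le> indicator B x * k (y - x) + indicator B y * k (x - y)"
        by (auto simp: 2 indicator_def)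
      with 1 show ?thesis by (rule order_trans)
    next
      case False
      then have "Q x y = 0" using supp by (simp add: Q_def B_def)
      then show ?thesis by simp
    qed
  qed
  have [measurable]: "B \<in> sets borel" by (simp add: B_def)
  have [measurable]: "(\<lambda>(x, y). Q x y) \<in> borel_measurable (borel \<Otimes>\<^sub>M borel)" unfolding Q_def by measurable
  have "(\<integral>\<^sup>+ q. ennreal ((case_prod Q q)\<^sup>2) \<partial>lborel) = (\<integral>\<^sup>+ q. ennreal ((case_prod Q q)\<^sup>2) \<partial>(lborel \<Otimes>\<^sub>M lborel))"
    by (simp add: lborel_prod)
  also have "\<dots> \<le> (\<integral>\<^sup>+ q. indicator B (fst q) * k (snd q - fst q) + indicator B (snd q) * k (fst q - snd q) \<partial>(lborel \<Otimes>\<^sub>M lborel))"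
    by (intro nn_integral_mono) (auto simp: Q_bound split: prod.split)
  also have "\<dots> = (\<integral>\<^sup>+ q. indicator B (fst q) * k (snd q - fst q) \<partial>(lborel \<Otimes>\<^sub>M lborel))
      + (\<integral>\<^sup>+ q. indicator B (snd q) * k (fst q - snd q) \<partial>(lborel \<Otimes>\<^sub>M lborel))"
    by (rule nn_integral_add) measurable
  also have "(\<integral>\<^sup>+ q. indicator B (fst q) * k (snd q - fst q) \<partial>(lborel \<Otimes>\<^sub>M lborel)) = integral\<^sup>N lborel k * emeasure lborel B"
  proof -
    have "(\<integral>\<^sup>+ q. indicator B (fst q) * k (snd q - fst q) \<partial>(lborel \<Otimes>\<^sub>M lborel))
        = (\<integral>\<^sup>+ x. \<integral>\<^sup>+ y. indicator B x * k (y - x) \<partial>lborel \<partial>lborel)"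
      by (subst lborel.nn_integral_fst[symmetric]) auto
    also have "\<dots> = (\<integral>\<^sup>+ x. integral\<^sup>N lborel k * indicator B x \<partial>lborel)"
      by (simp add: nn_integral_cmult nn_integral_translate mult.commute)
    also have "\<dots> = integral\<^sup>N lborel k * emeasure lborel B" by (rule nn_integral_cmult_indicator) simp
    finally show ?thesis .
  qed
  also have "(\<integral>\<^sup>+ q. indicator B (snd q) * k (fst q - snd q) \<partial>(lborel \<Otimes>\<^sub>M lborel)) = integral\<^sup>N lborel k * emeasure lborel B"
  proof -
    have "(\<integral>\<^sup>+ q. indicator B (snd q) * k (fst q - snd q) \<partial>(lborel \<Otimes>\<^sub>M lborel))
        = (\<integral>\<^sup>+ y. \<integral>\<^sup>+ x. indicator B y * k (x - y) \<partial>lborel \<partial>lborel)"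
      by (subst lborel_pair.nn_integral_snd[symmetric]) auto
    also have "\<dots> = (\<integral>\<^sup>+ x. integral\<^sup>N lborel k * indicator B x \<partial>lborel)"
      by (simp add: nn_integral_cmult nn_integral_translate mult.commute)
    also have "\<dots> = integral\<^sup>N lborel k * emeasure lborel B" by (rule nn_integral_cmult_indicator) simp
    finally show ?thesis .
  qed
  also have "integral\<^sup>N lborel k * emeasure lborel B + integral\<^sup>N lborel k * emeasure lborel B < top"
    using k_int Bfin by (simp add: ennreal_mult_less_top)
  finally have fin: "(\<integral>\<^sup>+ q. ennreal ((case_prod Q q)\<^sup>2) \<partial>lborel) < top" .
  have Q_meas: "case_prod Q \<in> borel_measurable borel"
    using \<open>(\<lambda>(x, y). Q x y) \<in> borel_measurable (borel \<Otimes>\<^sub>M borel)\<close> by (simp add: borel_prod)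
  have "square_integrable (case_prod Q)"
    unfolding square_integrable_def using Q_meas fin by (auto intro!: integrableI_nonneg)
  moreover have "AE q in lborel. diff_quot s (abs_L2 \<phi>) q = case_prod Q q"
    using AE_lborel_prod[OF rep_abs_L2[OF sq]]
    by eventually_elim (auto simp: diff_quot_def Q_def p_def split: prod.split)
  ultimately show "abs_L2 \<phi> \<in> Hs s"
    unfolding Hs_iff by (rule square_integrable_cong_AE[OF diff_quot_measurable])
qed

text \<open>By inner regularity, the part of \<open>\<Omega>\<close> where f > 0 has measure equal
  to the supremum over its compact subsets. Each of them is null, since a positive function has
  integral zero over it.\<close>

lemma AE_nonpos_if_compact_integrals_zero:
  fixes f :: "'a::euclidean_space \<Rightarrow> real"
  assumes [measurable]: "f \<in> borel_measurable borel" and \<Omega>: "bounded \<Omega>" "open \<Omega>"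
    and int: "\<And>K. compact K \<Longrightarrow> K \<subseteq> \<Omega> \<Longrightarrow> integrable lborel (\<lambda>x. indicator K x * f x)"
    and zero: "\<And>K. compact K \<Longrightarrow> K \<subseteq> \<Omega> \<Longrightarrow> (LINT x|lborel. indicator K x * f x) = 0"
  shows "AE x in lborel. x \<in> \<Omega> \<longrightarrow> f x \<le> 0"
proof -
  have [measurable]: "\<Omega> \<in> sets borel" using \<Omega> by simp
  define P where "P = {x \<in> space borel. f x > 0} \<inter> \<Omega>"
  have P [measurable]: "P \<in> sets borel" unfolding P_def by measurable
  \<comment> \<open>Lebesgue measure restricted to the bounded set \<open>\<Omega>\<close> is
    finite, as required for the regularity argument.\<close>
  define M where "M = density lborel (indicator \<Omega> :: 'a \<Rightarrow> ennreal)"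
  have M: "emeasure M A = emeasure lborel (\<Omega> \<inter> A)" if "A \<in> sets borel" for A
    unfolding M_def using that by (intro emeasure_restricted) auto
  have null: "emeasure lborel K = 0" if K: "compact K" "K \<subseteq> P" for K
  proof -
    have K\<Omega>: "K \<subseteq> \<Omega>" using K by (auto simp: P_def)
    have [measurable]: "K \<in> sets borel" using K by (simp add: compact_imp_closed borel_closed)
    have "AE x in lborel. 0 \<le> indicator K x * f x"
      using K by (intro always_eventually) (auto simp: P_def indicator_def less_imp_le)
    then have "AE x in lborel. indicator K x * f x = 0"
      using zero[OF K(1) K\<Omega>] int[OF K(1) K\<Omega>] integral_nonneg_eq_0_iff_AE by blast
    then have "AE x in lborel. x \<notin> K"
      by eventually_elim (use K in \<open>auto simp: P_def indicator_def split: if_splits\<close>)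
    then show ?thesis by (subst (asm) AE_iff_measurable[of K]) auto
  qed
  have "emeasure M P = (SUP K\<in>{K. K \<subseteq> P \<and> compact K}. emeasure M K)"
  proof (rule inner_regular)
    show "emeasure M (space M) \<noteq> \<infinity>"
      using emeasure_bounded_finite[OF \<Omega>(1)] M[of UNIV] by (simp add: M_def)
  qed (auto simp: M_def)
  also have "\<dots> \<le> 0"
  proof (rule SUP_least)
    fix K assume "K \<in> {K. K \<subseteq> P \<and> compact K}"
    then have K: "K \<subseteq> P" "compact K" by auto
    then have "\<Omega> \<inter> K = K" by (auto simp: P_def)
    then show "emeasure M K \<le> 0" using null K M[of K] by (simp add: compact_imp_closed borel_closed)
  qed
  finally have "emeasure lborel P = 0" using M[OF P] by (simp add: P_def Int_absorb1)
  then show ?thesis by (intro AE_I[of _ _ P]) (auto simp: P_def)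
qed

text \<open>Distance cut-offs around a compact K inside \<open>\<Omega>\<close> are Lipschitz,
  belong to H_0^s and tend to the indicator of K. Orthogonality therefore makes every integral of
  \<open>u\<close> over a compact subset of \<open>\<Omega>\<close> vanish, and the one-sided
  criterion is applied to \<open>u\<close> and -u.\<close>

lemma H0s_dense:
  fixes \<Omega> :: "'a::euclidean_space set"
  assumes \<Omega>: "bounded \<Omega>" "open \<Omega>" and s: "0 < s" "s < 1"
    and u: "u \<in> L2_on \<Omega>" and orth: "\<And>v. v \<in> H0s \<Omega> s \<Longrightarrow> u \<bullet> v = 0"
  shows "u = 0"
proof -
  define f where "f = rep_L2 u"
  have f_meas [measurable]: "f \<in> borel_measurable borel" by (simp add: f_def)
  have f: "square_integrable f" by (simp add: f_def square_integrable_rep)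
  have [measurable]: "\<Omega> \<in> sets borel" using \<Omega> by simp
  obtain r where r: "0 < r" "\<Omega> \<subseteq> cball 0 r" using \<Omega>(1) by (metis bounded_subset_ballD ball_subset_cball order_trans)
  have "square_integrable (indicator \<Omega> :: 'a \<Rightarrow> real)"
  proof -
    have "(\<lambda>x. (indicator \<Omega> x :: real)\<^sup>2) = indicator \<Omega>" by (auto simp: indicator_def)
    then show ?thesis
      using emeasure_bounded_finite[OF \<Omega>(1)] by (simp add: square_integrable_def integrable_real_indicator)
  qed
  from square_integrable_mult[OF f this] have f\<Omega>: "integrable lborel (\<lambda>x. f x * indicator \<Omega> x)" .
  have intK: "integrable lborel (\<lambda>x. indicator K x * f x)" if "K \<in> sets borel" "K \<subseteq> \<Omega>" for K
    by (rule Bochner_Integration.integrable_bound[OF f\<Omega>]) (use that in \<open>auto simp: indicator_def\<close>)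
  have zero: "(LINT x|lborel. indicator K x * f x) = 0" if K: "compact K" "K \<subseteq> \<Omega>" for K
  proof (cases "K = {}")
    case False
    obtain \<epsilon> where \<epsilon>: "\<epsilon> > 0" "(\<Union>x\<in>K. ball x \<epsilon>) \<subseteq> \<Omega>"
      using compact_subset_open_imp_ball_epsilon_subset[OF K(1) \<Omega>(2) K(2)] .
    \<comment> \<open>For n >= 1 this vanishes at distance at least \<epsilon> from
      \<open>K\<close>, hence outside \<open>\<Omega>\<close>; for n = 0 it is the constant 1, so
      the sequence is used from \<open>Suc n\<close> on.\<close>
    define \<phi> where "\<phi> n x = max 0 (1 - real n / \<epsilon> * infdist x K)" for n :: nat and x
    have supp: "\<phi> n x = 0" if "x \<notin> \<Omega>" "n \<ge> 1" for n x
    proof -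
      obtain y where y: "y \<in> K" "infdist x K = dist x y"
        using infdist_attains_inf[OF compact_imp_closed[OF K(1)] False] by metis
      then have "x \<notin> ball y \<epsilon>" using \<epsilon>(2) that(1) by blast
      then have "\<epsilon> \<le> infdist x K" using y(2) by (simp add: dist_commute)
      then have "1 * 1 \<le> real n * (infdist x K / \<epsilon>)" using that(2) \<epsilon>(1) by (intro mult_mono) auto
      then show ?thesis by (simp add: \<phi>_def)
    qed
    have range: "0 \<le> \<phi> n x \<and> \<phi> n x \<le> 1" for n x using \<epsilon>(1) by (simp add: \<phi>_def infdist_nonneg)
    have Lip: "\<bar>\<phi> n x - \<phi> n y\<bar> \<le> real n / \<epsilon> * norm (x - y)" for n x y
    proof -
      have "\<bar>\<phi> n x - \<phi> n y\<bar> \<le> \<bar>real n / \<epsilon> * infdist x K - real n / \<epsilon> * infdist y K\<bar>"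
      proof -
        have "\<bar>max 0 (1 - b) - max 0 (1 - c)\<bar> \<le> \<bar>b - c\<bar>" for b c :: real by (auto simp: max_def)
        then show ?thesis unfolding \<phi>_def .
      qed
      also have "\<dots> = real n / \<epsilon> * \<bar>infdist x K - infdist y K\<bar>"
        unfolding right_diff_distrib[symmetric] abs_mult using \<epsilon>(1) by simp
      also have "\<dots> \<le> real n / \<epsilon> * norm (x - y)"
        using infdist_triangle_abs[of x K y] \<epsilon>(1) by (intro mult_left_mono) (auto simp: dist_norm)
      finally show ?thesis .
    qed
    have out: "\<phi> (Suc n) x = 0" if "x \<notin> cball 0 r" for n x using that r(2) by (intro supp) auto
    have Ln: "0 \<le> real (Suc n) / \<epsilon>" for n using \<epsilon>(1) by simp
    note bump = Lipschitz_bump_in_Hs[OF s Ln range Lip out less_imp_le[OF r(1)]]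
    have "(LINT x|lborel. f x * \<phi> (Suc n) x) = 0" for n
    proof -
      have "abs_L2 (\<phi> (Suc n)) \<in> H0s \<Omega> s"
        unfolding H0s_iff L2_on_def using bump(2) rep_abs_L2[OF bump(1), of n] supp[of _ "Suc n"]
        by (auto elim!: eventually_mono)
      from orth[OF this] show ?thesis
        using inner_abs_L2[OF f bump(1), of n] by (simp add: f_def abs_rep_L2)
    qed
    moreover have "(\<lambda>n. LINT x|lborel. f x * \<phi> (Suc n) x) \<longlonglongrightarrow> (LINT x|lborel. f x * indicator K x)"
    proof (rule integral_dominated_convergence)
      show "integrable lborel (\<lambda>x. norm (f x * indicator \<Omega> x))" using f\<Omega> by (rule integrable_norm)
      show "(\<lambda>x. f x * indicator K x) \<in> borel_measurable lborel"
        using K by (simp add: compact_imp_closed borel_closed)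
      show "(\<lambda>x. f x * \<phi> (Suc n) x) \<in> borel_measurable lborel" for n
        using bump(1)[of n] f_meas by (simp add: square_integrable_def borel_measurable_times)
      show "AE x in lborel. (\<lambda>n. f x * \<phi> (Suc n) x) \<longlonglongrightarrow> f x * indicator K x"
      proof (intro always_eventually allI tendsto_mult tendsto_const)
        fix x
        show "(\<lambda>n. \<phi> (Suc n) x) \<longlonglongrightarrow> indicator K x"
        proof (cases "x \<in> K")
          case True
          then show ?thesis by (simp add: \<phi>_def)
        next
          case xK: False
          then have d: "infdist x K > 0" using infdist_pos_not_in_closed K(1) False by (blast intro: compact_imp_closed)
          obtain n0 where n0: "\<epsilon> / infdist x K \<le> real n0" using real_arch_simple by blast
          have "\<forall>\<^sub>F n in sequentially. \<phi> (Suc n) x = 0"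
            using eventually_ge_at_top[of n0]
          proof eventually_elim
            fix n assume "n0 \<le> n"
            then have "\<epsilon> / infdist x K \<le> real (Suc n)" using n0 by linarith
            then have "1 \<le> real (Suc n) / \<epsilon> * infdist x K" using d \<epsilon>(1) by (simp add: field_simps)
            then show "\<phi> (Suc n) x = 0" by (simp add: \<phi>_def)
          qed
          then show ?thesis using xK by (simp add: tendsto_eventually)
        qed
      qed
      show "AE x in lborel. norm (f x * \<phi> (Suc n) x) \<le> norm (f x * indicator \<Omega> x)" for n
      proof (intro always_eventually allI)
        fix x
        show "norm (f x * \<phi> (Suc n) x) \<le> norm (f x * indicator \<Omega> x)"
          using supp[of x "Suc n"] range[of "Suc n" x]
          by (cases "x \<in> \<Omega>") (auto simp: abs_mult mult_left_le)
      qed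
    qed
    ultimately have "(LINT x|lborel. f x * indicator K x) = 0" by (simp add: LIMSEQ_const_iff)
    then show ?thesis by (simp add: mult.commute)
  qed simp
  have sets: "K \<in> sets borel" if "compact K" for K :: "'a set" using that by (simp add: compact_imp_closed borel_closed)
  have "AE x in lborel. x \<in> \<Omega> \<longrightarrow> f x \<le> 0"
    by (rule AE_nonpos_if_compact_integrals_zero) (use \<Omega> intK sets zero in auto)
  moreover have "AE x in lborel. x \<in> \<Omega> \<longrightarrow> - f x \<le> 0"
    by (rule AE_nonpos_if_compact_integrals_zero) (use \<Omega> intK sets zero in auto)
  moreover have "AE x in lborel. x \<notin> \<Omega> \<longrightarrow> f x = 0" using u by (simp add: L2_on_def f_def)
  ultimately have "AE x in lborel. f x = 0" by eventually_elim auto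
  then show "u = 0" unfolding L2_eq_iff using rep_zero by eventually_elim (simp add: f_def)
qed

section \<open>Compactness of the embedding\<close>

text \<open>The fibres of \<open>grid h\<close> are the half-open cubes of side \<open>h\<close> with corners in \<open>h \<int>\<^sup>N\<close>.\<close>

definition grid :: "real \<Rightarrow> 'a::euclidean_space \<Rightarrow> 'a" where
  "grid h x = (\<Sum>i\<in>Basis. of_int \<lfloor>x \<bullet> i / h\<rfloor> *\<^sub>R i)"

lemma grid_inner: "i \<in> Basis \<Longrightarrow> grid h x \<bullet> i = of_int \<lfloor>x \<bullet> i / h\<rfloor>"
  unfolding grid_def by simp

lemma grid_eq_iff: "grid h x = grid h y \<longleftrightarrow> (\<forall>i\<in>Basis. \<lfloor>x \<bullet> i / h\<rfloor> = \<lfloor>y \<bullet> i / h\<rfloor>)"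
  by (simp add: euclidean_eq_iff[of "grid h x"] grid_inner)

lemma grid_measurable [measurable]: "grid h \<in> borel_measurable borel"
  unfolding grid_def[abs_def] by measurable

lemma finite_grid_image:
  fixes \<Omega> :: "'a::euclidean_space set"
  assumes "bounded \<Omega>" "h > 0" shows "finite (grid h ` \<Omega>)"
proof -
  obtain r where r: "\<And>x. x \<in> \<Omega> \<Longrightarrow> norm x \<le> r" using assms(1) by (auto simp: bounded_iff)
  define J where "J = {\<lfloor>- r / h\<rfloor>..\<lfloor>r / h\<rfloor>}"
  have "grid h ` \<Omega> \<subseteq> (\<lambda>k. \<Sum>i\<in>Basis. of_int (k i) *\<^sub>R i) ` (Basis \<rightarrow>\<^sub>E J)"
  proof
    fix z assume "z \<in> grid h ` \<Omega>"
    then obtain x where x: "x \<in> \<Omega>" "z = grid h x" by auto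
    have "\<lfloor>x \<bullet> i / h\<rfloor> \<in> J" if "i \<in> Basis" for i
    proof -
      have "\<bar>x \<bullet> i\<bar> \<le> r" using Basis_le_norm[OF that, of x] r[OF x(1)] by linarith
      then have "- r / h \<le> x \<bullet> i / h" "x \<bullet> i / h \<le> r / h" using assms(2)
        by (simp_all add: field_simps abs_le_iff)
      then show ?thesis unfolding J_def by (auto intro: floor_mono)
    qed
    then have "restrict (\<lambda>i. \<lfloor>x \<bullet> i / h\<rfloor>) Basis \<in> Basis \<rightarrow>\<^sub>E J" by auto
    moreover have "z = (\<Sum>i\<in>Basis. of_int (restrict (\<lambda>i. \<lfloor>x \<bullet> i / h\<rfloor>) Basis i) *\<^sub>R i)"
      unfolding x(2) grid_def by (intro sum.cong) auto
    ultimately show "z \<in> (\<lambda>k. \<Sum>i\<in>Basis. of_int (k i) *\<^sub>R i) ` (Basis \<rightarrow>\<^sub>E J)" by blast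
  qed
  moreover have "finite ((Basis :: 'a set) \<rightarrow>\<^sub>E J)" by (intro finite_PiE) (auto simp: J_def)
  ultimately show ?thesis by (meson finite_imageI finite_subset)
qed

text \<open>The estimate goes through the l1 norm, whence N h rather than sqrt N times h. This is
  the source of the factor N^(N + 2 s) in \<open>L2_norm_le_cell_averages\<close>.\<close>

lemma grid_cell_diameter:
  fixes x y :: "'a::euclidean_space"
  assumes h: "h > 0" and eq: "grid h x = grid h y"
  shows "norm (x - y) \<le> real DIM('a) * h"
proof -
  have "\<bar>(x - y) \<bullet> i\<bar> \<le> h" if i: "i \<in> Basis" for i
  proof -
    have "\<lfloor>x \<bullet> i / h\<rfloor> = \<lfloor>y \<bullet> i / h\<rfloor>" using eq i by (simp add: grid_eq_iff)
    then have "\<bar>x \<bullet> i / h - y \<bullet> i / h\<bar> \<le> 1" by linarith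
    then have "\<bar>(x \<bullet> i - y \<bullet> i) / h\<bar> \<le> 1" by (simp add: diff_divide_distrib)
    then show ?thesis using h by (simp add: inner_diff_left abs_divide)
  qed
  then have "(\<Sum>i\<in>Basis. \<bar>(x - y) \<bullet> i\<bar>) \<le> (\<Sum>i\<in>(Basis :: 'a set). h)" by (rule sum_mono)
  then show ?thesis using norm_le_l1[of "x - y"] by simp
qed

text \<open>The half-open cube is placed between an open and a closed box of the same side: the
  closed one shows that it has finite measure, the open one that its measure is at least
  h^N.\<close>

lemma grid_cell_bounds:
  fixes x0 :: "'a::euclidean_space"
  assumes h: "h > 0"
  shows "box (h *\<^sub>R grid h x0) (h *\<^sub>R grid h x0 + (\<Sum>i\<in>Basis. h *\<^sub>R i)) \<subseteq> grid h -` {grid h x0}"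
    and "grid h -` {grid h x0} \<subseteq> cbox (h *\<^sub>R grid h x0) (h *\<^sub>R grid h x0 + (\<Sum>i\<in>Basis. h *\<^sub>R i))"
proof -
  have inner: "(h *\<^sub>R grid h x0 + (\<Sum>i\<in>Basis. h *\<^sub>R i)) \<bullet> i = h * of_int \<lfloor>x0 \<bullet> i / h\<rfloor> + h"
    "(h *\<^sub>R grid h x0) \<bullet> i = h * of_int \<lfloor>x0 \<bullet> i / h\<rfloor>" if "i \<in> Basis" for i
    using that by (simp_all add: inner_add_left grid_inner)
  show "box (h *\<^sub>R grid h x0) (h *\<^sub>R grid h x0 + (\<Sum>i\<in>Basis. h *\<^sub>R i)) \<subseteq> grid h -` {grid h x0}"
  proof
    fix x assume x: "x \<in> box (h *\<^sub>R grid h x0) (h *\<^sub>R grid h x0 + (\<Sum>i\<in>Basis. h *\<^sub>R i))"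
    have "\<lfloor>x \<bullet> i / h\<rfloor> = \<lfloor>x0 \<bullet> i / h\<rfloor>" if i: "i \<in> Basis" for i
    proof (rule floor_unique)
      have "(h *\<^sub>R grid h x0) \<bullet> i < x \<bullet> i" "x \<bullet> i < (h *\<^sub>R grid h x0 + (\<Sum>i\<in>Basis. h *\<^sub>R i)) \<bullet> i"
        using x i unfolding mem_box by blast+
      then have "h * of_int \<lfloor>x0 \<bullet> i / h\<rfloor> < x \<bullet> i" "x \<bullet> i < h * of_int \<lfloor>x0 \<bullet> i / h\<rfloor> + h"
        unfolding inner[OF i] .
      then show "of_int \<lfloor>x0 \<bullet> i / h\<rfloor> \<le> x \<bullet> i / h" "x \<bullet> i / h < of_int \<lfloor>x0 \<bullet> i / h\<rfloor> + 1"
        using h by (simp_all add: field_simps)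
    qed
    then show "x \<in> grid h -` {grid h x0}" by (simp add: grid_eq_iff)
  qed
  show "grid h -` {grid h x0} \<subseteq> cbox (h *\<^sub>R grid h x0) (h *\<^sub>R grid h x0 + (\<Sum>i\<in>Basis. h *\<^sub>R i))"
  proof
    fix x assume "x \<in> grid h -` {grid h x0}"
    then have eq: "\<lfloor>x \<bullet> i / h\<rfloor> = \<lfloor>x0 \<bullet> i / h\<rfloor>" if "i \<in> Basis" for i using that by (simp add: grid_eq_iff)
    show "x \<in> cbox (h *\<^sub>R grid h x0) (h *\<^sub>R grid h x0 + (\<Sum>i\<in>Basis. h *\<^sub>R i))"
      unfolding mem_box
    proof (intro ballI)
      fix i :: 'a assume i: "i \<in> Basis"
      have "of_int \<lfloor>x0 \<bullet> i / h\<rfloor> \<le> x \<bullet> i / h" "x \<bullet> i / h \<le> of_int \<lfloor>x0 \<bullet> i / h\<rfloor> + 1"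
        unfolding eq[OF i, symmetric] by linarith+
      then show "(h *\<^sub>R grid h x0) \<bullet> i \<le> x \<bullet> i \<and> x \<bullet> i \<le> (h *\<^sub>R grid h x0 + (\<Sum>i\<in>Basis. h *\<^sub>R i)) \<bullet> i"
        unfolding inner[OF i] using h by (simp add: field_simps)
    qed
  qed
qed

lemma grid_cell_measure:
  fixes x0 :: "'a::euclidean_space"
  assumes h: "h > 0"
  shows "emeasure lborel (grid h -` {grid h x0}) < \<infinity>" "h ^ DIM('a) \<le> measure lborel (grid h -` {grid h x0})"
proof -
  let ?Q = "grid h -` {grid h x0}"
  let ?l = "h *\<^sub>R grid h x0" and ?u = "h *\<^sub>R grid h x0 + (\<Sum>i\<in>Basis. h *\<^sub>R i)"
  have Q: "?Q \<in> sets borel" using measurable_sets[OF grid_measurable, of "{grid h x0}" h] by simp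
  have "emeasure lborel ?Q \<le> emeasure lborel (cbox ?l ?u)"
    using grid_cell_bounds(2)[OF h] by (intro emeasure_mono) auto
  also have "\<dots> < \<infinity>" by (simp add: emeasure_lborel_cbox_eq)
  finally show fin: "emeasure lborel ?Q < \<infinity>" .
  have "ennreal (h ^ DIM('a)) = emeasure lborel (box ?l ?u)"
    using h by (simp add: emeasure_lborel_box_eq inner_add_left)
  also have "\<dots> \<le> emeasure lborel ?Q"
    using grid_cell_bounds(1)[OF h] Q by (intro emeasure_mono) auto
  also have "\<dots> = ennreal (measure lborel ?Q)" using fin by (simp add: emeasure_eq_ennreal_measure)
  finally show "h ^ DIM('a) \<le> measure lborel ?Q" by simp
qed

text \<open>Expanding the square in \<open>\<integral>\<^sub>Q \<integral>\<^sub>Q (g x - g y)\<^sup>2\<close>.\<close>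

lemma double_integral_difference:
  fixes g :: "'a::euclidean_space \<Rightarrow> real"
  assumes g: "square_integrable g" and Q: "Q \<in> sets borel" "emeasure lborel Q < \<infinity>"
  defines "m \<equiv> measure lborel Q"
  shows "(\<integral>\<^sup>+ p. ennreal (indicator Q (fst p) * indicator Q (snd p) * (g (fst p) - g (snd p))\<^sup>2) \<partial>lborel)
    = ennreal (2 * m * (LINT x|lborel. indicator Q x * (g x)\<^sup>2) - 2 * (LINT x|lborel. indicator Q x * g x)\<^sup>2)"
proof -
  have [measurable]: "g \<in> borel_measurable borel" using g by (simp add: square_integrable_def)
  note [measurable] = Q(1)
  define I where "I x = (indicator Q x :: real)" for x
  have I [measurable]: "I \<in> borel_measurable borel" unfolding I_def[abs_def] by measurable
  have "(\<lambda>x. (I x)\<^sup>2) = I" by (auto simp: I_def indicator_def)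
  then have sqI: "square_integrable I"
    using Q by (simp add: square_integrable_def I_def[abs_def] integrable_real_indicator)
  have int_I: "integrable lborel I" using Q by (simp add: I_def[abs_def] integrable_real_indicator)
  have LI: "(LINT x|lborel. I x) = m" by (simp add: I_def m_def)
  have int_g: "integrable lborel (\<lambda>x. I x * g x)" by (rule square_integrable_mult[OF sqI g])
  have int_g2: "integrable lborel (\<lambda>x. I x * (g x)\<^sup>2)"
  proof (rule Bochner_Integration.integrable_bound)
    show "integrable lborel (\<lambda>x. (g x)\<^sup>2)" using g by (simp add: square_integrable_def)
  qed (auto simp: I_def indicator_def)
  define a where "a = (LINT x|lborel. I x * g x)"
  define b where "b = (LINT x|lborel. I x * (g x)\<^sup>2)"
  have inner_eq: "I x * I y * (g x - g y)\<^sup>2 = I x * (I y * (g y)\<^sup>2) - 2 * I x * g x * (I y * g y) + I x * (g x)\<^sup>2 * I y" for x y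
    by (simp add: power2_eq_square algebra_simps)
  have int1: "integrable lborel (\<lambda>y. I x * I y * (g x - g y)\<^sup>2)" for x
    unfolding inner_eq using int_I int_g int_g2 by (intro Bochner_Integration.integrable_add Bochner_Integration.integrable_diff integrable_mult_right)
  have val1: "(LINT y|lborel. I x * I y * (g x - g y)\<^sup>2) = I x * b - 2 * I x * g x * a + I x * (g x)\<^sup>2 * m" for x
    unfolding inner_eq a_def b_def LI[symmetric] using int_I int_g int_g2 by simp
  have int2: "integrable lborel (\<lambda>x. I x * b - 2 * I x * g x * a + I x * (g x)\<^sup>2 * m)"
  proof -
    have "integrable lborel (\<lambda>x. b * I x - (2 * a) * (I x * g x) + m * (I x * (g x)\<^sup>2))"
      using int_I int_g int_g2 by simp
    then show ?thesis by (simp add: algebra_simps)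
  qed
  have val2: "(LINT x|lborel. I x * b - 2 * I x * g x * a + I x * (g x)\<^sup>2 * m) = 2 * m * b - 2 * a\<^sup>2"
  proof -
    have "(LINT x|lborel. I x * b - 2 * I x * g x * a + I x * (g x)\<^sup>2 * m)
        = (LINT x|lborel. b * I x - (2 * a) * (I x * g x) + m * (I x * (g x)\<^sup>2))"
      by (intro Bochner_Integration.integral_cong) auto
    also have "\<dots> = b * m - 2 * a * a + m * b"
      using int_I int_g int_g2 by (simp add: LI a_def[symmetric] b_def[symmetric])
    finally show ?thesis by (simp add: power2_eq_square)
  qed
  have nonneg1: "0 \<le> I x * I y * (g x - g y)\<^sup>2" for x y by (simp add: I_def)
  then have nonneg2: "0 \<le> I x * b - 2 * I x * g x * a + I x * (g x)\<^sup>2 * m" for x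
    unfolding val1[symmetric] by (intro Bochner_Integration.integral_nonneg)
  have meas: "(\<lambda>(x, y). ennreal (I x * I y * (g x - g y)\<^sup>2)) \<in> borel_measurable (lborel \<Otimes>\<^sub>M lborel)" by measurable
  have "(\<integral>\<^sup>+ p. ennreal (I (fst p) * I (snd p) * (g (fst p) - g (snd p))\<^sup>2) \<partial>lborel)
      = (\<integral>\<^sup>+ p. (\<lambda>(x, y). ennreal (I x * I y * (g x - g y)\<^sup>2)) p \<partial>(lborel \<Otimes>\<^sub>M lborel))"
    by (simp add: lborel_prod case_prod_beta)
  also have "\<dots> = (\<integral>\<^sup>+ x. \<integral>\<^sup>+ y. ennreal (I x * I y * (g x - g y)\<^sup>2) \<partial>lborel \<partial>lborel)"
    by (subst lborel.nn_integral_fst[OF meas, symmetric]) simp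
  also have "\<dots> = (\<integral>\<^sup>+ x. ennreal (I x * b - 2 * I x * g x * a + I x * (g x)\<^sup>2 * m) \<partial>lborel)"
    using int1 nonneg1 by (simp add: nn_integral_eq_integral val1)
  also have "\<dots> = ennreal (2 * m * b - 2 * a\<^sup>2)"
    using int2 nonneg2 by (simp add: nn_integral_eq_integral val2)
  finally show ?thesis by (simp only: I_def a_def b_def)
qed

lemma indicator_fst_snd_measurable:
  fixes Q :: "'a::euclidean_space set"
  assumes "Q \<in> sets borel"
  shows "(\<lambda>q. indicator Q (fst q) :: real) \<in> borel_measurable (borel :: ('a \<times> 'a) measure)"
    and "(\<lambda>q. indicator Q (snd q) :: real) \<in> borel_measurable (borel :: ('a \<times> 'a) measure)"
  using measurable_compose[OF measurable_fst_snd_borel(1) borel_measurable_indicator[OF assms]]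
    measurable_compose[OF measurable_fst_snd_borel(2) borel_measurable_indicator[OF assms]] by auto

text \<open>A fractional Poincare inequality on each cell Q. With p = N + 2 s, the integral of g^2
  over Q minus |Q| times the squared mean equals 1 / (2 |Q|) times the double integral of (g x - g
  y)^2, hence is at most (N h)^p / (2 |Q|) times the share of the squared seminorm in Q x Q. Since
  |Q| >= h^N, a factor h^(2 s) remains.\<close>

lemma L2_norm_le_cell_averages:
  fixes \<Omega> :: "'a::euclidean_space set"
  assumes \<Omega>: "bounded \<Omega>" and s: "0 < s" and h: "h > 0"
  shows "\<exists>F. finite F \<and> (\<forall>w\<in>H0s \<Omega> s. w \<bullet> w \<le> (\<Sum>\<phi>\<in>F. (\<phi> \<bullet> w)\<^sup>2)
      + real DIM('a) powr (real DIM('a) + 2 * s) * h powr (2 * s) * (grad s w \<bullet> grad s w))"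
proof -
  define N where "N = real DIM('a)"
  define p where "p = N + 2 * s"
  have p: "p > 0" using s by (simp add: p_def N_def add_nonneg_pos)
  define C where "C = grid h ` \<Omega>"
  have C: "finite C" unfolding C_def by (rule finite_grid_image[OF \<Omega> h])
  define Q where "Q c = grid h -` {c}" for c :: 'a
  have Q_meas [measurable]: "Q c \<in> sets borel" for c
    unfolding Q_def using measurable_sets[OF grid_measurable, of "{c}" h] by simp
  define m where "m c = measure lborel (Q c)" for c
  have Qfin: "emeasure lborel (Q c) < \<infinity>" and m_ge: "h ^ DIM('a) \<le> m c" if "c \<in> C" for c
    using that grid_cell_measure[OF h] by (auto simp: C_def Q_def m_def)
  have m_pos: "m c > 0" if "c \<in> C" for c using m_ge[OF that] h by (meson less_le_trans zero_less_power)
  \<comment> \<open>Normalised in L2, so that the squared pairing with \<open>w\<close> is the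
    squared cell integral divided by the volume of the cell.\<close>
  define f where "f c = (\<lambda>x. indicator (Q c) x / sqrt (m c))" for c
  have f: "square_integrable (f c)" if "c \<in> C" for c
  proof -
    have "(\<lambda>x. (indicator (Q c) x :: real)\<^sup>2) = indicator (Q c)" by (auto simp: indicator_def)
    then have "square_integrable (indicator (Q c) :: 'a \<Rightarrow> real)"
      using Qfin[OF that] by (simp add: square_integrable_def integrable_real_indicator)
    from square_integrable_scale[OF this, of "1 / sqrt (m c)"] show ?thesis by (simp add: f_def)
  qed
  define F where "F = (\<lambda>c. abs_L2 (f c)) ` C"
  \<comment> \<open>The functionals are collected in a set, so distinct cells must give distinct
    classes for the sum over \<open>F\<close> to equal the sum over cells.\<close>
  have inj: "inj_on (\<lambda>c. abs_L2 (f c)) C"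
  proof (rule inj_onI, rule ccontr)
    fix c d assume cd: "c \<in> C" "d \<in> C" "abs_L2 (f c) = abs_L2 (f d)" "c \<noteq> d"
    have "(LINT x|lborel. f c x * f c x) = (LINT x|lborel. f c x * f d x)"
      using cd f by (metis inner_abs_L2)
    also have "(\<lambda>x. f c x * f d x) = (\<lambda>x. 0)" using cd by (auto simp: f_def Q_def indicator_def)
    also have "(\<lambda>x. f c x * f c x) = (\<lambda>x. indicator (Q c) x / m c)"
      using m_pos[OF cd(1)] by (auto simp: f_def indicator_def)
    finally have "m c / m c = 0" by (simp add: m_def)
    then show False using m_pos[OF cd(1)] by simp
  qed
  have "w \<bullet> w \<le> (\<Sum>\<phi>\<in>F. (\<phi> \<bullet> w)\<^sup>2) + N powr p * h powr (2 * s) * (grad s w \<bullet> grad s w)"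
    if w: "w \<in> H0s \<Omega> s" for w
  proof -
    define g where "g = rep_L2 w"
    have g: "square_integrable g" by (simp add: g_def square_integrable_rep)
    have [measurable]: "g \<in> borel_measurable borel" by (simp add: g_def)
    have g0: "AE x in lborel. x \<notin> \<Omega> \<longrightarrow> g x = 0" using w by (simp add: H0s_def g_def)
    define b where "b c = (LINT x|lborel. indicator (Q c) x * (g x)\<^sup>2)" for c
    define a where "a c = (LINT x|lborel. indicator (Q c) x * g x)" for c
    \<comment> \<open>The share of the squared seminorm carried by pairs within one cell. The
      products Q c x Q c are disjoint, so the shares add up to at most the whole.\<close>
    define D where "D c = (\<integral>\<^sup>+ q. ennreal (indicator (Q c) (fst q) * indicator (Q c) (snd q) * (diff_quot s w q)\<^sup>2) \<partial>lborel)" for c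
    have int_g2: "integrable lborel (\<lambda>x. indicator (Q c) x * (g x)\<^sup>2)" for c
    proof (rule Bochner_Integration.integrable_bound)
      show "integrable lborel (\<lambda>x. (g x)\<^sup>2)" using g by (simp add: square_integrable_def)
    qed (auto simp: indicator_def)
    have sum_ind: "(\<Sum>c\<in>C. indicator (Q c) x) = (1::real)" if "x \<in> \<Omega>" for x
    proof -
      have "(\<Sum>c\<in>C. indicator (Q c) x) = (\<Sum>c\<in>C. if c = grid h x then 1 else (0::real))"
        by (intro sum.cong) (auto simp: Q_def indicator_def)
      then show ?thesis using C that by (simp add: C_def)
    qed
    have "w \<bullet> w = (LINT x|lborel. (\<Sum>c\<in>C. indicator (Q c) x * (g x)\<^sup>2))"
      unfolding inner_L2.rep_eq g_def[symmetric]
    proof (rule integral_cong_AE)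
      show "AE x in lborel. g x * g x = (\<Sum>c\<in>C. indicator (Q c) x * (g x)\<^sup>2)"
        using g0
      proof eventually_elim
        fix x assume "x \<notin> \<Omega> \<longrightarrow> g x = 0"
        then show "g x * g x = (\<Sum>c\<in>C. indicator (Q c) x * (g x)\<^sup>2)"
          using sum_ind[of x] by (cases "x \<in> \<Omega>") (simp_all add: power2_eq_square flip: sum_distrib_right)
      qed
    qed measurable
    also have "\<dots> = (\<Sum>c\<in>C. b c)" unfolding b_def using int_g2 by (intro Bochner_Integration.integral_sum)
    finally have ww: "w \<bullet> w = (\<Sum>c\<in>C. b c)" .
    have aw: "(abs_L2 (f c) \<bullet> w)\<^sup>2 = (a c)\<^sup>2 / m c" if c: "c \<in> C" for c
    proof -
      have "abs_L2 (f c) \<bullet> w = (LINT x|lborel. f c x * g x)"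
        using inner_abs_L2[OF f[OF c] g] by (simp add: g_def abs_rep_L2)
      also have "\<dots> = (LINT x|lborel. (1 / sqrt (m c)) * (indicator (Q c) x * g x))"
        by (intro Bochner_Integration.integral_cong) (auto simp: f_def)
      also have "\<dots> = (1 / sqrt (m c)) * a c" unfolding a_def by (rule Bochner_Integration.integral_mult_right_zero)
      finally show ?thesis using m_pos[OF c] by (simp add: power_mult_distrib power_divide)
    qed
    have cell: "ennreal (b c - (a c)\<^sup>2 / m c) \<le> ennreal (N powr p * h powr (2 * s)) * D c" if c: "c \<in> C" for c
    proof -
      have "ennreal (2 * m c * b c - 2 * (a c)\<^sup>2)
          = (\<integral>\<^sup>+ q. ennreal (indicator (Q c) (fst q) * indicator (Q c) (snd q) * (g (fst q) - g (snd q))\<^sup>2) \<partial>lborel)"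
        unfolding b_def a_def m_def by (rule double_integral_difference[OF g _ Qfin[OF c], symmetric]) measurable
      also have "\<dots> \<le> (\<integral>\<^sup>+ q. ennreal ((N * h) powr p) *
          ennreal (indicator (Q c) (fst q) * indicator (Q c) (snd q) * (diff_quot s w q)\<^sup>2) \<partial>lborel)"
      proof (rule nn_integral_mono)
        fix q :: "'a \<times> 'a"
        have "(g x - g y)\<^sup>2 \<le> (N * h) powr p * (diff_quot s w (x, y))\<^sup>2" if "x \<in> Q c" "y \<in> Q c" for x y
        proof (cases "x = y")
          case False
          have "norm (x - y) \<le> N * h"
            unfolding N_def by (rule grid_cell_diameter[OF h]) (use that in \<open>simp add: Q_def\<close>)
          then have le: "norm (x - y) powr p \<le> (N * h) powr p" using p by (intro powr_mono2) auto
          have "(g x - g y)\<^sup>2 = norm (x - y) powr p * (diff_quot s w (x, y))\<^sup>2"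
            using False diff_quot_mult[of s w x y w]
            by (simp add: power2_eq_square g_def p_def N_def)
          also have "\<dots> \<le> (N * h) powr p * (diff_quot s w (x, y))\<^sup>2" using le by (rule mult_right_mono) simp
          finally show ?thesis .
        qed simp
        from this[of "fst q" "snd q"]
        show "ennreal (indicator (Q c) (fst q) * indicator (Q c) (snd q) * (g (fst q) - g (snd q))\<^sup>2)
          \<le> ennreal ((N * h) powr p) * ennreal (indicator (Q c) (fst q) * indicator (Q c) (snd q) * (diff_quot s w q)\<^sup>2)"
          by (auto simp: indicator_def ennreal_mult[symmetric] intro: ennreal_leI)
      qed
      also have "\<dots> = ennreal ((N * h) powr p) * D c"
        unfolding D_def
      proof (rule nn_integral_cmult)
        note [measurable] = indicator_fst_snd_measurable[OF Q_meas]
        show "(\<lambda>q. ennreal (indicator (Q c) (fst q) * indicator (Q c) (snd q) * (diff_quot s w q)\<^sup>2)) \<in> borel_measurable lborel"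
          by measurable
      qed
      finally have le: "ennreal (2 * m c * b c - 2 * (a c)\<^sup>2) \<le> ennreal ((N * h) powr p) * D c" .
      have "ennreal (b c - (a c)\<^sup>2 / m c) = ennreal (1 / (2 * m c)) * ennreal (2 * m c * b c - 2 * (a c)\<^sup>2)"
      proof -
        have "b c - (a c)\<^sup>2 / m c = 1 / (2 * m c) * (2 * m c * b c - 2 * (a c)\<^sup>2)"
          using m_pos[OF c] by (simp add: right_diff_distrib)
        then show ?thesis using m_pos[OF c] by (simp only: ennreal_mult'[of "1 / (2 * m c)"] divide_nonneg_nonneg)
      qed
      also have "\<dots> \<le> ennreal (1 / (2 * m c)) * (ennreal ((N * h) powr p) * D c)"
        using le by (rule mult_left_mono) simp
      also have "\<dots> = ennreal (1 / (2 * m c) * (N * h) powr p) * D c"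
        using m_pos[OF c] by (subst ennreal_mult) (simp_all add: mult.assoc)
      also have "\<dots> \<le> ennreal (N powr p * h powr (2 * s)) * D c"
      proof (intro mult_right_mono ennreal_leI)
        have hN: "h ^ DIM('a) > 0" using h by simp
        have "(N * h) powr p = N powr p * (h powr N * h powr (2 * s))"
          using h by (simp add: powr_mult N_def p_def powr_add)
        then have Nh: "(N * h) powr p = N powr p * (h ^ DIM('a) * h powr (2 * s))"
          using h by (simp add: N_def powr_realpow)
        have "1 / (2 * m c) \<le> 1 / h ^ DIM('a)"
          using m_ge[OF c] hN by (intro divide_left_mono) auto
        then have "1 / (2 * m c) * (N * h) powr p \<le> 1 / h ^ DIM('a) * (N * h) powr p"
          by (rule mult_right_mono) simp
        also have "\<dots> = N powr p * h powr (2 * s)" unfolding Nh using hN by simp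
        finally show "1 / (2 * m c) * (N * h) powr p \<le> N powr p * h powr (2 * s)" .
      qed simp
      finally show ?thesis .
    qed
    have sumD: "(\<Sum>c\<in>C. D c) \<le> ennreal (grad s w \<bullet> grad s w)"
    proof -
      have wHs: "square_integrable (diff_quot s w)" using w by (simp add: H0s_iff Hs_iff)
      note [measurable] = indicator_fst_snd_measurable[OF Q_meas]
      have "(\<Sum>c\<in>C. D c) = (\<integral>\<^sup>+ q. (\<Sum>c\<in>C. ennreal (indicator (Q c) (fst q) * indicator (Q c) (snd q) * (diff_quot s w q)\<^sup>2)) \<partial>lborel)"
        unfolding D_def by (rule nn_integral_sum[symmetric]) measurable
      also have "\<dots> \<le> (\<integral>\<^sup>+ q. ennreal ((diff_quot s w q)\<^sup>2) \<partial>lborel)"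
      proof (rule nn_integral_mono)
        fix q :: "'a \<times> 'a"
        have "(\<Sum>c\<in>C. indicator (Q c) (fst q) * indicator (Q c) (snd q)) \<le> (\<Sum>c\<in>C. if c = grid h (fst q) then 1 else (0::real))"
          by (intro sum_mono) (auto simp: Q_def indicator_def)
        also have "\<dots> \<le> 1" using C by simp
        finally have "(\<Sum>c\<in>C. indicator (Q c) (fst q) * indicator (Q c) (snd q)) * (diff_quot s w q)\<^sup>2 \<le> 1 * (diff_quot s w q)\<^sup>2"
          by (rule mult_right_mono) simp
        then show "(\<Sum>c\<in>C. ennreal (indicator (Q c) (fst q) * indicator (Q c) (snd q) * (diff_quot s w q)\<^sup>2)) \<le> ennreal ((diff_quot s w q)\<^sup>2)"
          by (simp add: sum_ennreal sum_distrib_right ennreal_leI)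
      qed
      also have "\<dots> = ennreal (grad s w \<bullet> grad s w)"
        using wHs by (simp add: grad_def inner_abs_L2 square_integrable_def nn_integral_eq_integral power2_eq_square)
      finally show ?thesis .
    qed
    define K where "K = N powr p * h powr (2 * s)"
    \<comment> \<open>\<open>ennreal\<close> sends negative reals to 0, so without a sign for the
      summands only this inequality is claimed.\<close>
    have "ennreal (\<Sum>c\<in>C. b c - (a c)\<^sup>2 / m c) \<le> (\<Sum>c\<in>C. ennreal (b c - (a c)\<^sup>2 / m c))"
      using C
    proof (induction C rule: finite_induct)
      case (insert c C)
      let ?f = "\<lambda>c. b c - (a c)\<^sup>2 / m c"
      have "ennreal (?f c + (\<Sum>c\<in>C. ?f c)) \<le> ennreal (max 0 (?f c) + max 0 (\<Sum>c\<in>C. ?f c))"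
        by (intro ennreal_leI add_mono) auto
      also have "\<dots> = ennreal (?f c) + ennreal (\<Sum>c\<in>C. ?f c)" 
        by (simp add: ennreal_plus max_def ennreal_neg)
      finally show ?case using insert by (auto intro: order_trans add_left_mono)
    qed simp
    also have "\<dots> \<le> (\<Sum>c\<in>C. ennreal K * D c)" unfolding K_def by (intro sum_mono cell)
    also have "\<dots> = ennreal K * (\<Sum>c\<in>C. D c)" by (simp add: sum_distrib_left)
    also have "\<dots> \<le> ennreal K * ennreal (grad s w \<bullet> grad s w)" using sumD by (rule mult_left_mono) simp
    also have "\<dots> = ennreal (K * (grad s w \<bullet> grad s w))" by (simp add: ennreal_mult K_def)
    finally have "(\<Sum>c\<in>C. b c - (a c)\<^sup>2 / m c) \<le> K * (grad s w \<bullet> grad s w)"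
      by (simp add: ennreal_le_iff K_def)
    moreover have "(\<Sum>\<phi>\<in>F. (\<phi> \<bullet> w)\<^sup>2) = (\<Sum>c\<in>C. (a c)\<^sup>2 / m c)"
      unfolding F_def using inj by (simp add: sum.reindex aw)
    ultimately show ?thesis by (simp add: ww sum_subtractf K_def)
  qed
  then show ?thesis using C unfolding N_def p_def by (intro exI[of _ F]) (simp add: F_def)
qed

theorem compact_form_frac_form:
  fixes \<Omega> :: "'a::euclidean_space set"
  assumes \<Omega>: "bounded \<Omega>" "open \<Omega>" and s: "0 < s" "s < 1"
  shows "compact_form (H0s \<Omega> s) (frac_form \<Omega> s) (L2_on \<Omega>)"
proof -
  define N where "N = real DIM('a)"
  define c where "c = frac_const N s / 2"
  have N: "N > 0" by (simp add: N_def)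
  have c: "c > 0" unfolding c_def using frac_const_pos[OF N s] by simp
  have \<Omega>_borel: "\<Omega> \<in> sets borel" using \<Omega> by simp
  interpret hilbert_form "H0s \<Omega> s" "frac_form \<Omega> s" by (rule hilbert_form_frac_form[OF \<Omega>_borel s])
  have form: "frac_form \<Omega> s u u = u \<bullet> u + c * (grad s u \<bullet> grad s u)" if "u \<in> H0s \<Omega> s" for u
    using frac_form_eq[OF \<Omega>_borel that that] by (simp add: c_def N_def)
  show ?thesis
  proof
    show "closed (L2_on \<Omega>)" "subspace (L2_on \<Omega>)" by (rule closed_L2_on subspace_L2_on)+
    show "H0s \<Omega> s \<subseteq> L2_on \<Omega>" by (auto simp: H0s_iff)
    show "u \<bullet> u \<le> frac_form \<Omega> s u u" if "u \<in> H0s \<Omega> s" for u using c by (simp add: form[OF that])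
    show "f = 0" if "f \<in> L2_on \<Omega>" "\<And>v. v \<in> H0s \<Omega> s \<Longrightarrow> f \<bullet> v = 0" for f
      using H0s_dense[OF \<Omega> s that] .
    fix e :: real assume e: "e > 0"
    define k where "k = N powr (N + 2 * s)"
    have k: "k > 0" using N by (simp add: k_def)
    \<comment> \<open>The side is the solution of k h^(2s) = e c, so the seminorm term becomes e
      times the nonlocal part of the form.\<close>
    define h where "h = (e * c / k) powr (1 / (2 * s))"
    have h: "h > 0" using e c k by (simp add: h_def)
    have hs: "k * h powr (2 * s) = e * c" using e c k s by (simp add: h_def powr_powr)
    obtain F where F: "finite F" "\<And>w. w \<in> H0s \<Omega> s \<Longrightarrow>
        w \<bullet> w \<le> (\<Sum>\<phi>\<in>F. (\<phi> \<bullet> w)\<^sup>2) + k * h powr (2 * s) * (grad s w \<bullet> grad s w)"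
      using L2_norm_le_cell_averages[OF \<Omega>(1) s(1) h] unfolding k_def N_def by blast
    have "w \<bullet> w \<le> (\<Sum>\<phi>\<in>F. (\<phi> \<bullet> w)\<^sup>2) + e * frac_form \<Omega> s w w" if w: "w \<in> H0s \<Omega> s" for w
    proof -
      have "k * h powr (2 * s) * (grad s w \<bullet> grad s w) \<le> e * frac_form \<Omega> s w w"
        unfolding hs form[OF w] using e by (simp add: distrib_left)
      then show ?thesis using F(2)[OF w] by linarith
    qed
    then show "\<exists>F. finite F \<and> (\<forall>w\<in>H0s \<Omega> s. w \<bullet> w \<le> (\<Sum>\<phi>\<in>F. (\<phi> \<bullet> w)\<^sup>2) + e * frac_form \<Omega> s w w)"
      using F(1) by blast
  qed
qed

theorem proposition3p1:
  fixes \<Omega> :: "'a::euclidean_space set" and s :: real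
  assumes "bounded \<Omega>" and "lipschitz_domain \<Omega>" and "0 < s" and "s < 1"
  shows
   "single_valued (frac_power \<Omega> s (1/2)) \<and>
    Domain (frac_power \<Omega> s (1/2)) = H0s \<Omega> s \<and>
    isometric_isomorphism (H0s \<Omega> s) (H0s_norm \<Omega> s) (L2_on \<Omega>) norm
      (op_app (frac_power \<Omega> s (1/2))) \<and>
    frac_power \<Omega> s (-1/2) = (frac_power \<Omega> s (1/2))\<inverse> \<and>
    single_valued (frac_power \<Omega> s (-1/2)) \<and>
    Domain (frac_power \<Omega> s (-1/2)) = L2_on \<Omega> \<and>
    bounded_linear_between (L2_on \<Omega>) norm (H0s \<Omega> s) (H0s_norm \<Omega> s)
      (op_app (frac_power \<Omega> s (-1/2))) \<and>
    (\<forall>u\<in>H0s \<Omega> s. op_app (frac_power \<Omega> s (-1/2)) (op_app (frac_power \<Omega> s (1/2)) u) = u) \<and>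
    (\<forall>z\<in>L2_on \<Omega>. op_app (frac_power \<Omega> s (1/2)) (op_app (frac_power \<Omega> s (-1/2)) z) = z) \<and>
    (\<forall>z\<in>L2_on \<Omega>. \<exists>!u. u \<in> H0s \<Omega> s \<and> z = op_app (frac_power \<Omega> s (1/2)) u) \<and>
    (\<forall>u\<in>H0s \<Omega> s. \<forall>v\<in>H0s \<Omega> s.
       op_app (frac_power \<Omega> s (1/2)) u \<bullet> op_app (frac_power \<Omega> s (1/2)) v = frac_form \<Omega> s u v)"
proof -
  have "open \<Omega>" using assms(2) by (simp add: lipschitz_domain_def)
  then interpret compact_form "H0s \<Omega> s" "frac_form \<Omega> s" "L2_on \<Omega>"
    using assms by (intro compact_form_frac_form)
  define E where "E = spectral_resolution (L2_on \<Omega>) (frac_operator \<Omega> s)"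
  \<comment> \<open>The existence result gives the Hilbert choice its content; \<open>E\<close> is
    used below only through these two properties.\<close>
  have E: "spectral_measure (L2_on \<Omega>) E \<and> spectral_integral (L2_on \<Omega>) E (\<lambda>t. t) = frac_operator \<Omega> s"
    unfolding E_def spectral_resolution_def frac_operator_def
    by (rule someI_ex[OF spectral_resolution_exists])
  interpret resolved_form "H0s \<Omega> s" "frac_form \<Omega> s" "L2_on \<Omega>" E
    using E closed_H subspace_H by unfold_locales (auto simp: frac_operator_def)
  have norm: "H0s_norm \<Omega> s = (\<lambda>u. sqrt (frac_form \<Omega> s u u))" by (simp add: fun_eq_iff H0s_norm_def)
  show ?thesis
    unfolding frac_power_def op_power_def E_def[symmetric] norm by (rule square_root_isometry)
qed

end
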